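(* Let $a=(a_1,\dots,a_6)\in\mathbb C^6$ with $a_1+\cdots+a_6=3$. If $a_2+a_4+a_5=1$, then the system $E(3,6;a)|X_3$ is reducible and has a subsystem isomorphic to the Appell–Lauricella system $E_D^{(3)}$ in $3$ variables with $4$ free parameters. More precisely, the collection of the solutions of $E(3,6;a)|X_3$ includes $$(1-x^1)^{-a_2}\,S_D^{(3)}\left(a_3,\ a_4,\ 1-a_6,\ a_2,\ 1+a_3-a_5;\ x^3,\ x^4,\ \frac{x^3-x^1}{1-x^1}\right).$$
   Context: Superscripts on $x$ and $y$ are indices. The system $E(3,6;a)|X_3$ in the variables $(x^1,x^3,x^4)$ is the restriction of the hypergeometric system $E(3,6;a)$ on the configuration space of six lines in $\mathbb P^2$ to the three-dimensional stratum $x^2=0$ (exactly one triple point). Explicitly, with $\theta_i=x^i\partial/\partial x^i$ $(i=1,3,4)$, $\theta=\theta_1+\theta_3+\theta_4$ and $a_{234}=a_2+a_3+a_4$, it is $(\theta+a_{234}-1)\theta_1w-x^1(\theta_1+\theta_3+1-a_5)(\theta_1+a_2)w=0$, $(\theta+a_{234}-1)\theta_3w-x^3(\theta_1+\theta_3+1-a_5)(\theta_3+\theta_4+a_3)w=0$, $(\theta+a_{234}-1)\theta_4w-x^4(\theta_4+1-a_6)(\theta_3+\theta_4+a_3)w=0$, $x^3(\theta_1+\theta_3+1-a_5)\theta_4w-x^4(\theta_4+1-a_6)\theta_3w=0$, $x^1(\theta_1+a_2)\theta_3w-x^3(\theta_3+\theta_4+a_3)\theta_1w=0$. The Appell–Lauricella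 system $E_D^{(3)}(A,b_1,b_2,b_3,C;y^1,y^2,y^3)$ is, with $\delta_i=y^i\partial/\partial y^i$, $\delta=\delta_1+\delta_2+\delta_3$, $\delta_i(\delta+C-1)u-y^i(\delta_i+b_i)(\delta+A)u=0$ and $y^i(\delta_i+b_i)\delta_ju-y^j(\delta_j+b_j)\delta_iu=0$ $(1\le i,j\le3)$. $S_D^{(3)}(A,b_1,b_2,b_3,C;y^1,y^2,y^3)$ is its space of local holomorphic solutions at generic points; replacing $y^1,y^2,y^3$ by functions of $x$ means composition. Reducible means that the local system of solutions has a proper nonzero monodromy-invariant subsystem. *)

theory Defs
  imports "HOL-Analysis.Analysis"
begin

section \<open>Germs of holomorphic functions of several complex variables\<close>

type_synonym 'n cfun = "complex ^ 'n \<Rightarrow> complex"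

definition holo_on :: "'n::finite cfun \<Rightarrow> (complex ^ 'n) set \<Rightarrow> bool" where
  "holo_on f U \<longleftrightarrow> open U \<and>
     (\<forall>x\<in>U. \<exists>f'. (f has_derivative f') (at x) \<and> (\<forall>c v. f' (c *s v) = c * f' v))"

definition holo_at :: "'n::finite cfun \<Rightarrow> complex ^ 'n \<Rightarrow> bool" where
  "holo_at f p \<longleftrightarrow> (\<exists>U. p \<in> U \<and> holo_on f U)"

text \<open>A germ at \<open>p\<close> is represented by any total function with that germ; spaces of germs are
  sets of functions that are closed under \<open>germ_eq p\<close>.\<close>

definition germ_eq :: "complex ^ 'n::finite \<Rightarrow> 'n cfun \<Rightarrow> 'n cfun \<Rightarrow> bool" where
  "germ_eq p f g \<longleftrightarrow> (\<forall>\<^sub>F x in nhds p. f x = g x)"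

definition germ_subspace :: "complex ^ 'n::finite \<Rightarrow> 'n cfun set \<Rightarrow> bool" where
  "germ_subspace p V \<longleftrightarrow>
     (\<lambda>x. 0) \<in> V \<and>
     (\<forall>f\<in>V. \<forall>g\<in>V. (\<lambda>x. f x + g x) \<in> V) \<and>
     (\<forall>c. \<forall>f\<in>V. (\<lambda>x. c * f x) \<in> V) \<and>
     (\<forall>f\<in>V. \<forall>g. germ_eq p f g \<longrightarrow> g \<in> V)"

text \<open>\<open>F t\<close> is the germ at \<open>\<gamma> t\<close> of the continuation of \<open>f\<close> along \<open>\<gamma>\<close>.\<close>

definition continuation_along ::
    "(real \<Rightarrow> complex ^ 'n::finite) \<Rightarrow> 'n cfun \<Rightarrow> 'n cfun \<Rightarrow> bool" where
  "continuation_along \<gamma> f g \<longleftrightarrow>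
     (\<exists>F. germ_eq (\<gamma> 0) f (F 0) \<and> germ_eq (\<gamma> 1) g (F 1) \<and>
        (\<forall>t\<in>{0..1}. holo_at (F t) (\<gamma> t) \<and>
           (\<forall>\<^sub>F s in at t within {0..1}. germ_eq (\<gamma> s) (F s) (F t))))"


section \<open>Solutions of linear systems, subsystems, reducibility\<close>

text \<open>A system is given by the predicate that \<open>w\<close> satisfies all its equations at the point \<open>x\<close>.\<close>

type_synonym 'n pde_system = "'n cfun \<Rightarrow> complex ^ 'n \<Rightarrow> bool"

definition solutions_at :: "'n::finite pde_system \<Rightarrow> complex ^ 'n \<Rightarrow> 'n cfun set" where
  "solutions_at E p = {w. \<exists>U. p \<in> U \<and> holo_on w U \<and> (\<forall>x\<in>U. E w x)}"

text \<open>Subsystems are given by their fibres \<open>V p\<close>. Being carried into itself by continuation along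
  all paths in \<open>X\<close>, rather than along the loops at one base point, is the base-point free form of
  monodromy invariance on the connected sets \<open>X\<close> considered here. The existence of the
  continuation is part of the requirement; its germ is unique by the identity theorem.\<close>

definition subsystem_of ::
    "(complex ^ 'n::finite) set \<Rightarrow> (complex ^ 'n \<Rightarrow> 'n cfun set) \<Rightarrow> (complex ^ 'n \<Rightarrow> 'n cfun set) \<Rightarrow> bool"
  where
  "subsystem_of X S V \<longleftrightarrow>
     (\<forall>p\<in>X. germ_subspace p (V p) \<and> V p \<subseteq> S p) \<and>
     (\<forall>\<gamma>. path \<gamma> \<and> path_image \<gamma> \<subseteq> X \<longrightarrow>
        (\<forall>f\<in>V (pathstart \<gamma>). \<exists>g\<in>V (pathfinish \<gamma>). continuation_along \<gamma> f g))"

definition reducible_on ::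
    "(complex ^ 'n::finite) set \<Rightarrow> (complex ^ 'n \<Rightarrow> 'n cfun set) \<Rightarrow> bool" where
  "reducible_on X S \<longleftrightarrow>
     (\<exists>V. subsystem_of X S V \<and>
        (\<forall>p\<in>X. (\<exists>f\<in>V p. \<not> germ_eq p f (\<lambda>x. 0)) \<and> V p \<noteq> S p))"


section \<open>Twisted pull-backs and isomorphism\<close>

definition power_branches ::
    "'n::finite cfun \<Rightarrow> complex \<Rightarrow> complex ^ 'n \<Rightarrow> 'n cfun set" where
  "power_branches h c p =
     {\<phi>. \<exists>L. holo_at L p \<and> (\<forall>\<^sub>F x in nhds p. exp (L x) = h x \<and> \<phi> x = exp (c * L x))}"

text \<open>The germs of the functions \<open>h\<^sup>c \<cdot> (u \<circ> \<psi>)\<close> with \<open>u \<in> W\<close>.\<close>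

definition twisted_pullback ::
    "'n::finite cfun \<Rightarrow> complex \<Rightarrow> (complex ^ 'n \<Rightarrow> complex ^ 'm::finite) \<Rightarrow>
     (complex ^ 'm \<Rightarrow> 'm cfun set) \<Rightarrow> complex ^ 'n \<Rightarrow> 'n cfun set" where
  "twisted_pullback h c \<psi> W p =
     {f. \<exists>\<phi>\<in>power_branches h c p. \<exists>u\<in>W (\<psi> p). germ_eq p f (\<lambda>x. \<phi> x * u (\<psi> x))}"

definition biholomorphic ::
    "(complex ^ 'n::finite \<Rightarrow> complex ^ 'm::finite) \<Rightarrow> (complex ^ 'n) set \<Rightarrow> (complex ^ 'm) set \<Rightarrow> bool"
  where
  "biholomorphic \<psi> X Y \<longleftrightarrow> bij_betw \<psi> X Y \<and>
     (\<forall>i. holo_on (\<lambda>x. \<psi> x $ i) X) \<and> (\<forall>i. holo_on (\<lambda>y. the_inv_into X \<psi> y $ i) Y)"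

text \<open>Isomorphism of systems in the sense customary for hypergeometric systems: a change of the
  independent variables together with multiplication by a (multivalued) power of a nowhere
  vanishing function.\<close>

definition isomorphic_via ::
    "'n::finite cfun \<Rightarrow> complex \<Rightarrow> (complex ^ 'n \<Rightarrow> complex ^ 'm::finite) \<Rightarrow>
     (complex ^ 'n) set \<Rightarrow> (complex ^ 'n \<Rightarrow> 'n cfun set) \<Rightarrow>
     (complex ^ 'm) set \<Rightarrow> (complex ^ 'm \<Rightarrow> 'm cfun set) \<Rightarrow> bool" where
  "isomorphic_via h c \<psi> X V Y W \<longleftrightarrow>
     biholomorphic \<psi> X Y \<and> holo_on h X \<and> (\<forall>p\<in>X. h p \<noteq> 0) \<and>
     (\<forall>p\<in>X. \<forall>\<phi>\<in>power_branches h c p.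
        (\<forall>u\<in>W (\<psi> p). (\<lambda>x. \<phi> x * u (\<psi> x)) \<in> V p) \<and>
        (\<forall>u\<in>W (\<psi> p). \<forall>v\<in>W (\<psi> p).
           germ_eq p (\<lambda>x. \<phi> x * u (\<psi> x)) (\<lambda>x. \<phi> x * v (\<psi> x)) \<longrightarrow> germ_eq (\<psi> p) u v) \<and>
        (\<forall>f\<in>V p. \<exists>u\<in>W (\<psi> p). germ_eq p f (\<lambda>x. \<phi> x * u (\<psi> x))))"


section \<open>The two hypergeometric systems\<close>

definition pderiv_at :: "'n::finite \<Rightarrow> 'n cfun \<Rightarrow> 'n cfun" where
  "pderiv_at i f x = deriv (\<lambda>t. f (x + t *s axis i 1)) 0"

text \<open>The operator \<open>\<Sum>\<^sub>i\<^sub>\<in>\<^sub>I x\<^sub>i \<partial>/\<partial>x\<^sub>i + c\<close>.\<close>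

definition euler :: "'n::finite set \<Rightarrow> complex \<Rightarrow> 'n cfun \<Rightarrow> 'n cfun" where
  "euler I c f x = (\<Sum>i\<in>I. x $ i * pderiv_at i f x) + c * f x"

text \<open>The variables \<open>x\<^sup>1, x\<^sup>3, x\<^sup>4\<close> of the restricted system are the components
  \<open>x $ 1, x $ 2, x $ 3\<close>. The parameters \<open>a\<^sub>1, \<dots>, a\<^sub>6\<close> are \<open>a $ 1, \<dots>, a $ 6\<close>
  (in the index types, the numerals \<open>3 :: 3\<close> and \<open>6 :: 6\<close> denote the element \<open>0\<close>).\<close>

definition E36_X3 :: "complex ^ 6 \<Rightarrow> 3 pde_system" where
  "E36_X3 a w x \<longleftrightarrow>
     (let s = a $ 2 + a $ 3 + a $ 4 - 1 in
      euler {1,2,3} s (euler {1} 0 w) x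
        - x $ 1 * euler {1,2} (1 - a $ 5) (euler {1} (a $ 2) w) x = 0 \<and>
      euler {1,2,3} s (euler {2} 0 w) x
        - x $ 2 * euler {1,2} (1 - a $ 5) (euler {2,3} (a $ 3) w) x = 0 \<and>
      euler {1,2,3} s (euler {3} 0 w) x
        - x $ 3 * euler {3} (1 - a $ 6) (euler {2,3} (a $ 3) w) x = 0 \<and>
      x $ 2 * euler {1,2} (1 - a $ 5) (euler {3} 0 w) x
        - x $ 3 * euler {3} (1 - a $ 6) (euler {2} 0 w) x = 0 \<and>
      x $ 1 * euler {1} (a $ 2) (euler {2} 0 w) x
        - x $ 2 * euler {2,3} (a $ 3) (euler {1} 0 w) x = 0)"

text \<open>The stratum \<open>x\<^sup>2 = 0\<close>: the six lines are given by the columns of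
  \<open>(1 0 0 1 1 1 | 0 1 0 1 x\<^sup>1 x\<^sup>2 | 0 0 1 1 x\<^sup>3 x\<^sup>4)\<close>, and all maximal minors other than the one of
  columns 1, 3, 6 (which is \<open>x\<^sup>2\<close> up to sign) are nonzero. The last condition below is the minor
  of columns 4, 5, 6.\<close>

definition X3 :: "(complex ^ 3) set" where
  "X3 = {x. (\<forall>i. x $ i \<noteq> 0 \<and> x $ i \<noteq> 1) \<and> x $ 1 \<noteq> x $ 2 \<and> x $ 2 \<noteq> x $ 3 \<and>
            x $ 1 * x $ 3 - x $ 1 - x $ 3 + x $ 2 \<noteq> 0}"

definition ED :: "complex \<Rightarrow> complex ^ 3 \<Rightarrow> complex \<Rightarrow> 3 pde_system" where
  "ED A b C u y \<longleftrightarrow>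
     (\<forall>i. euler {i} 0 (euler UNIV (C - 1) u) y
            - y $ i * euler {i} (b $ i) (euler UNIV A u) y = 0) \<and>
     (\<forall>i j. y $ i * euler {i} (b $ i) (euler {j} 0 u) y
            - y $ j * euler {j} (b $ j) (euler {i} 0 u) y = 0)"

text \<open>The complement of the singular locus of the Appell--Lauricella system.\<close>

definition Y3 :: "(complex ^ 3) set" where
  "Y3 = {y. (\<forall>i. y $ i \<noteq> 0 \<and> y $ i \<noteq> 1) \<and> (\<forall>i j. i \<noteq> j \<longrightarrow> y $ i \<noteq> y $ j)}"

definition psi :: "complex ^ 3 \<Rightarrow> complex ^ 3" where
  "psi x = vector [x $ 2, x $ 3, (x $ 2 - x $ 1) / (1 - x $ 1)]"

end

theory Submission
  imports Defs "HOL-Complex_Analysis.Complex_Analysis"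
begin

text \<open>
  Write a germ \<open>w\<close> at a point of \<open>X3\<close> as \<open>w = (1 - x\<^sub>1)\<^bsup>-a\<^sub>2\<^esup> \<cdot> (u \<circ> psi)\<close>. After division by
  \<open>y\<^sub>i\<close> and \<open>y\<^sub>i y\<^sub>j\<close> the Appell--Lauricella equations for \<open>u\<close> are six expressions
  \<open>L\<^sub>i\<close> and \<open>L\<^sub>i\<^sub>j\<close>, \<open>i < j\<close>, in the second order jet of \<open>u\<close>. When \<open>a\<^sub>2 + a\<^sub>4 + a\<^sub>5 = 1\<close> the five equations
  of the restricted system for \<open>w\<close> are combinations of these six that annihilate the vector with
  \<open>L\<^sub>2 = y\<^sub>1 - y\<^sub>3\<close>, \<open>L\<^sub>1\<^sub>2 = 1 - y\<^sub>3\<close>, \<open>L\<^sub>2\<^sub>3 = 1 - y\<^sub>1\<close> and \<open>L\<^sub>1 = L\<^sub>3 = L\<^sub>1\<^sub>3 = 0\<close>.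
  Hence \<open>w\<close> is a solution as soon as the \<open>L\<close>'s are a multiple \<open>g\<close> of this vector
  (\<open>E36_pull\<close>). The choice \<open>g = 0\<close> gives the asserted inclusion of solution spaces.

  With \<open>g\<close> as a fifth unknown next to \<open>u\<close> and its three derivatives one gets a Pfaffian system of
  rank five. In a suitable basis it is \<open>\<Sum> R\<^sub>H dlog f\<^sub>H\<close> with constant matrices \<open>R\<^sub>H\<close>, where
  \<open>f\<^sub>H\<close> runs through \<open>y\<^sub>i\<close>, \<open>y\<^sub>i - 1\<close>, \<open>y\<^sub>i - y\<^sub>j\<close>, so its integrability is a list of commutator
  relations between constant matrices (\<open>conn_flat\<close>). By the Frobenius theorem
  (\<open>pfaffian_local_theory\<close>), around each point of \<open>Y3\<close> there is a ball on which every initial value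
  at every point extends to a unique solution. This has three uses.

  First, a germ of a solution of the Appell--Lauricella system extends to a ball whose radius depends
  on the centre only (\<open>ED_solution_extends\<close>), so that it can be continued along all paths
  (\<open>continuation_along_paths\<close>); therefore the twisted pull-back is a subsystem. Second, the
  Appell--Lauricella system has a nonzero germ at every point for all values of the parameters,
  including those for which the usual series or integrals degenerate. Third, there is
  a solution with \<open>g \<noteq> 0\<close> at every point (\<open>extra_solution_exists\<close>); its transform solves the
  restricted system but is not in the pull-back, so the subsystem is proper and the restricted
  system is reducible.
\<close>

no_notation fps_nth (infixl "$" 75)

section \<open>Holomorphic functions of several variables through their slices\<close>

lemma smult_axis: "t *s axis i (1::complex) = axis i t"
  by (simp add: vec_eq_iff axis_def)

lemma axis_zero [simp]: "axis i (0::complex) = 0"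
  by (simp add: vec_eq_iff axis_def)

lemma norm_axis_complex [simp]: "norm (axis i (t::complex)) = norm t"
proof -
  have "(\<Sum>j\<in>UNIV. (norm (if j = i then t else 0))\<^sup>2) = (\<Sum>j\<in>UNIV. if j = i then (norm t)\<^sup>2 else 0)"
    by (intro sum.cong) auto
  then show ?thesis
    by (simp add: norm_vec_def L2_set_def axis_def)
qed

lemma axis_add: "axis i (s + t :: complex) = axis i s + axis i t"
  by (simp add: vec_eq_iff axis_def)

lemma bounded_linear_axis: "bounded_linear (axis i :: complex \<Rightarrow> complex ^ 'n::finite)"
proof (rule bounded_linear_intro[where K=1])
  show "axis i (r *\<^sub>R x) = r *\<^sub>R (axis i x :: complex ^ 'n)" for r x
    by (simp add: vec_eq_iff axis_def)
qed (simp_all add: axis_add)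

lemma continuous_on_axis [continuous_intros]:
  fixes f :: "'a::topological_space \<Rightarrow> complex"
  shows "continuous_on S f \<Longrightarrow> continuous_on S (\<lambda>x. axis i (f x) :: complex ^ 'n::finite)"
  by (rule bounded_linear.continuous_on[OF bounded_linear_axis])

lemma pderiv_at_axis: "pderiv_at i f x = deriv (\<lambda>t. f (x + axis i t)) 0"
  by (simp add: pderiv_at_def smult_axis)

text \<open>
  A continuous function that is holomorphic in each variable separately. By Osgood's lemma
  (\<open>holo_on_iff_slicewise\<close>) this is the same as \<open>holo_on\<close>, and it lets closure properties,
  parameter integrals and uniform limits be checked with the theory of one complex variable.
\<close>

definition slicewise :: "'n::finite cfun \<Rightarrow> (complex ^ 'n) set \<Rightarrow> bool" where
  "slicewise f U \<longleftrightarrow> open U \<and> continuous_on U f \<and>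
     (\<forall>x\<in>U. \<forall>i. (\<lambda>t. f (x + axis i t)) field_differentiable at 0)"

lemma slice_has_field_derivative:
  assumes "slicewise f U" "x + axis i t \<in> U"
  shows "((\<lambda>t. f (x + axis i t)) has_field_derivative pderiv_at i f (x + axis i t)) (at t)"
proof -
  have "((\<lambda>s. f ((x + axis i t) + axis i s)) has_field_derivative pderiv_at i f (x + axis i t)) (at 0)"
    using assms unfolding slicewise_def pderiv_at_axis by (simp add: DERIV_deriv_iff_field_differentiable)
  then have "((\<lambda>s. f (x + axis i (s + t))) has_field_derivative pderiv_at i f (x + axis i t)) (at (t - t))"
    by (simp add: axis_add add_ac)
  then show ?thesis
    using DERIV_shift[of "\<lambda>s. f (x + axis i s)" "pderiv_at i f (x + axis i t)" 0 t]
    by (simp add: add_ac)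
qed

definition circ :: "real \<Rightarrow> real \<Rightarrow> complex" where
  "circ r t = of_real r * exp (2 * of_real pi * \<i> * of_real t)"

lemma norm_circ [simp]: "norm (circ r t) = \<bar>r\<bar>"
  by (simp add: circ_def norm_mult)

lemma continuous_on_circ [continuous_intros]:
  "continuous_on S f \<Longrightarrow> continuous_on S (\<lambda>x. circ r (f x))"
  unfolding circ_def by (intro continuous_intros)

text \<open>
  The point of writing a partial derivative as an integral over the values of the function is that
  the integral depends continuously, and even differentiably, on the point \<open>x\<close> as a parameter.
\<close>

lemma pderiv_cauchy:
  assumes f: "slicewise f U" and r: "r > 0" and sub: "\<And>t. norm t \<le> r \<Longrightarrow> x + axis i t \<in> U"
  shows "pderiv_at i f x = integral {0..1} (\<lambda>t. f (x + axis i (circ r t)) / circ r t)"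
proof -
  let ?g = "\<lambda>t. f (x + axis i t)"
  have hol: "?g holomorphic_on ball 0 r"
    unfolding holomorphic_on_def field_differentiable_def
  proof
    fix t :: complex assume "t \<in> ball 0 r"
    then show "\<exists>d. (?g has_field_derivative d) (at t within ball 0 r)"
      using has_field_derivative_at_within[OF slice_has_field_derivative[OF f sub[of t]]] by auto
  qed
  have cont: "continuous_on (cball 0 r) ?g"
    by (rule continuous_at_imp_continuous_on)
       (auto intro!: DERIV_isCont[OF slice_has_field_derivative[OF f]] sub)
  have "(?g has_field_derivative (1 / (2 * of_real pi * \<i>) *
      contour_integral (circlepath 0 r) (\<lambda>u. ?g u / (u-0)^2))) (at 0)"
    using r by (intro Cauchy_derivative_integral_circlepath(2) cont hol) auto
  then have "pderiv_at i f x = 1 / (2 * of_real pi * \<i>) *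
      contour_integral (circlepath 0 r) (\<lambda>u. ?g u / u^2)"
    unfolding pderiv_at_axis by (simp add: DERIV_imp_deriv)
  also have "contour_integral (circlepath 0 r) (\<lambda>u. ?g u / u^2) =
      integral {0..1} (\<lambda>t. (?g (circ r t) / circ r t ^ 2) * (2 * of_real pi * \<i> * circ r t))"
  proof -
    have "circlepath 0 r t = circ r t" for t
      by (simp add: circlepath circ_def)
    then show ?thesis
      unfolding contour_integral_integral vector_derivative_circlepath
      by (intro integral_cong) (simp add: circ_def)
  qed
  also have "\<dots> = integral {0..1} (\<lambda>t. (2 * of_real pi * \<i>) * (?g (circ r t) / circ r t))"
    using r by (intro integral_cong) (auto simp: circ_def power2_eq_square)
  also have "\<dots> = (2 * of_real pi * \<i>) * integral {0..1} (\<lambda>t. ?g (circ r t) / circ r t)"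
    by (rule integral_mult_right)
  finally show ?thesis by simp
qed

lemma slicewise_continuous_pderiv:
  fixes f :: "'a::finite cfun"
  assumes f: "slicewise f U"
  shows "continuous_on U (pderiv_at i f)"
proof (rule continuous_at_imp_continuous_on, intro ballI)
  fix x assume "x \<in> U"
  then obtain e where e: "e > 0" "ball x e \<subseteq> U"
    using f openE unfolding slicewise_def by blast
  define r where "r = e / 3"
  have r: "r > 0" using e by (simp add: r_def)
  have sub: "z + axis i t \<in> U" if "z \<in> ball x r" "norm t \<le> r" for z t
  proof -
    have "dist x (z + axis i t) \<le> dist x z + norm (axis i t :: complex ^ 'a)"
      using dist_triangle[of x "z + axis i t" z] by (simp add: dist_norm)
    then have "z + axis i t \<in> ball x e" using that e by (simp add: r_def)
    then show ?thesis using e by blast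
  qed
  have 1: "continuous_on (ball x r) (\<lambda>z. integral (cbox 0 1) (\<lambda>t. f (z + axis i (circ r t)) / circ r t))"
  proof (rule integral_continuous_on_param)
    have "continuous_on (ball x r \<times> cbox 0 1) (\<lambda>p. f (fst p + axis i (circ r (snd p))))"
    proof (rule continuous_on_compose2[of U f])
      show "continuous_on U f" using f by (simp add: slicewise_def)
      show "continuous_on (ball x r \<times> cbox 0 1) (\<lambda>p. fst p + axis i (circ r (snd p)))"
        by (intro continuous_intros)
      show "(\<lambda>p. fst p + axis i (circ r (snd p))) ` (ball x r \<times> cbox 0 1) \<subseteq> U"
      proof (rule image_subsetI)
        fix p assume "p \<in> ball x r \<times> cbox 0 (1::real)"
        then show "fst p + axis i (circ r (snd p)) \<in> U"
          using r by (intro sub) (simp_all add: mem_Times_iff)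
      qed
    qed
    moreover have "circ r t \<noteq> 0" for t
      using r by (simp add: circ_def)
    ultimately show "continuous_on (ball x r \<times> cbox 0 1) (\<lambda>(z, t). f (z + axis i (circ r t)) / circ r t)"
      unfolding split_beta by (intro continuous_on_divide continuous_on_circ continuous_on_snd continuous_on_id) blast+
  qed
  have 2: "integral (cbox 0 1) (\<lambda>t. f (z + axis i (circ r t)) / circ r t) = pderiv_at i f z"
    if "z \<in> ball x r" for z
    unfolding cbox_interval by (rule pderiv_cauchy[OF f r sub[OF that], symmetric])
  have "continuous_on (ball x r) (pderiv_at i f)"
    by (rule continuous_on_eq[OF 1 2])
  then show "isCont (pderiv_at i f) x"
    using r by (simp add: continuous_on_eq_continuous_at)
qed

text \<open>
  The increment is split into steps parallel to the axes. Each step stays in the ball and is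
  estimated by the mean value inequality in one variable.
\<close>

lemma slicewise_increment_bound:
  assumes f: "slicewise f U" and sub: "ball x d \<subseteq> U"
    and bd: "\<And>z i. z \<in> ball x d \<Longrightarrow> norm (pderiv_at i f z - pderiv_at i f x) \<le> e"
    and v: "(\<Sum>i\<in>I. norm (v i)) < d" and I: "finite I"
  shows "norm (f (x + (\<Sum>i\<in>I. axis i (v i))) - f x - (\<Sum>i\<in>I. v i * pderiv_at i f x)) \<le> e * (\<Sum>i\<in>I. norm (v i))"
  using I v
proof (induction I rule: finite_induct)
  case empty
  then show ?case by simp
next
  case (insert k I)
  define z where "z = x + (\<Sum>i\<in>I. axis i (v i))"
  define g where "g = (\<lambda>t. f (z + axis k t) - t * pderiv_at k f x)"
  have in_ball: "z + axis k t \<in> ball x d" if "norm t \<le> norm (v k)" for t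
  proof -
    have "norm ((\<Sum>i\<in>I. axis i (v i)) + axis k t) \<le> (\<Sum>i\<in>I. norm (v i)) + norm t"
      by (rule norm_triangle_le) (use norm_sum[of "\<lambda>i. axis i (v i)" I] in simp)
    also have "\<dots> < d" using insert that by simp
    finally have "dist (x + ((\<Sum>i\<in>I. axis i (v i)) + axis k t)) x < d"
      by (simp only: dist_norm add_diff_cancel_left')
    then show ?thesis by (simp add: z_def dist_commute add.assoc)
  qed
  have der: "(g has_field_derivative pderiv_at k f (z + axis k t) - pderiv_at k f x) (at t within cball 0 (norm (v k)))"
    if "t \<in> cball 0 (norm (v k))" for t
  proof -
    have "z + axis k t \<in> U" using in_ball[of t] that sub by auto
    moreover have "((\<lambda>t. t * pderiv_at k f x) has_field_derivative pderiv_at k f x) (at t)"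
      using DERIV_cmult_right[OF DERIV_ident, of "pderiv_at k f x" t UNIV] by simp
    ultimately show ?thesis unfolding g_def
      using slice_has_field_derivative[OF f] by (intro has_field_derivative_at_within[OF DERIV_diff])
  qed
  have "norm (g (v k) - g 0) \<le> e * norm (v k - 0)"
    by (rule field_differentiable_bound[OF convex_cball[of 0 "norm (v k)"] der])
       (auto intro!: bd in_ball)
  then have 1: "norm (f (z + axis k (v k)) - f z - v k * pderiv_at k f x) \<le> e * norm (v k)"
    by (simp add: g_def algebra_simps)
  have 2: "norm (f z - f x - (\<Sum>i\<in>I. v i * pderiv_at i f x)) \<le> e * (\<Sum>i\<in>I. norm (v i))"
    unfolding z_def
  proof (rule insert.IH)
    have "norm (v k) + (\<Sum>i\<in>I. norm (v i)) < d" using insert by simp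
    then show "(\<Sum>i\<in>I. norm (v i)) < d" using norm_ge_zero[of "v k"] by linarith
  qed
  have "f (x + (\<Sum>i\<in>insert k I. axis i (v i))) - f x - (\<Sum>i\<in>insert k I. v i * pderiv_at i f x) =
     (f (z + axis k (v k)) - f z - v k * pderiv_at k f x) + (f z - f x - (\<Sum>i\<in>I. v i * pderiv_at i f x))"
    using insert by (simp add: z_def algebra_simps)
  also have "norm \<dots> \<le> e * norm (v k) + e * (\<Sum>i\<in>I. norm (v i))"
    by (intro norm_triangle_mono 1 2)
  finally show ?case using insert by (simp add: algebra_simps)
qed

lemma sum_axis: "(\<Sum>i\<in>UNIV. axis i (v $ i)) = (v :: complex ^ 'n::finite)"
  by (simp add: vec_eq_iff axis_def if_distrib cong: if_cong)

lemma slicewise_has_derivative: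
  fixes f :: "'n::finite cfun"
  assumes f: "slicewise f U" and x: "x \<in> U"
  shows "(f has_derivative (\<lambda>v. \<Sum>i\<in>UNIV. v $ i * pderiv_at i f x)) (at x)"
  unfolding has_derivative_at_alt
proof (intro conjI allI impI)
  show "bounded_linear (\<lambda>v. \<Sum>i\<in>UNIV. v $ i * pderiv_at i f x)"
    by (intro bounded_linear_sum bounded_linear_mult_left[THEN bounded_linear_compose]
        bounded_linear_vec_nth)
  fix e :: real assume e: "e > 0"
  define N where "N = real CARD('n)"
  have N: "N > 0" by (simp add: N_def)
  have "\<exists>d>0. \<forall>z. dist z x < d \<longrightarrow> norm (pderiv_at i f z - pderiv_at i f x) < e / N" for i
  proof -
    have "isCont (pderiv_at i f) x"
      using slicewise_continuous_pderiv[OF f] f x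
      by (auto simp: slicewise_def continuous_on_eq_continuous_at)
    then show ?thesis using e N
      by (auto simp: continuous_at_eps_delta dist_norm)
  qed
  then obtain d where d: "\<And>i. d i > 0"
    "\<And>i z. dist z x < d i \<Longrightarrow> norm (pderiv_at i f z - pderiv_at i f x) < e / N" by metis
  obtain d0 where d0: "d0 > 0" "ball x d0 \<subseteq> U"
    using f x openE unfolding slicewise_def by blast
  define D where "D = Min (insert d0 (range d))"
  have D: "D > 0" "D \<le> d0" "\<And>i. D \<le> d i" by (auto simp: D_def d d0 intro: min.coboundedI2)
  show "\<exists>D>0. \<forall>y. norm (y - x) < D \<longrightarrow>
     norm (f y - f x - (\<Sum>i\<in>UNIV. (y - x) $ i * pderiv_at i f x)) \<le> e * norm (y - x)"
  proof (intro exI conjI allI impI)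
    show "D / N > 0" using D N by simp
    fix y assume y: "norm (y - x) < D / N"
    have S: "(\<Sum>i\<in>UNIV. norm ((y - x) $ i)) \<le> N * norm (y - x)"
      using sum_mono[of UNIV "\<lambda>i. norm ((y - x) $ i)" "\<lambda>i. norm (y - x)"]
      Finite_Cartesian_Product.norm_nth_le[of "y - x"] by (simp add: N_def)
    have "norm (f (x + (\<Sum>i\<in>UNIV. axis i ((y - x) $ i))) - f x - (\<Sum>i\<in>UNIV. (y - x) $ i * pderiv_at i f x))
       \<le> e / N * (\<Sum>i\<in>UNIV. norm ((y - x) $ i))"
    proof (rule slicewise_increment_bound[OF f])
      show "ball x D \<subseteq> U" using D d0 by (auto simp: subset_iff)
      show "norm (pderiv_at i f z - pderiv_at i f x) \<le> e / N" if "z \<in> ball x D" for z i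
        using d(2)[of z i] D(3)[of i] that by (simp add: dist_commute less_imp_le)
      show "(\<Sum>i\<in>UNIV. norm ((y - x) $ i)) < D"
        using S y N by (simp add: field_simps)
    qed simp
    also have "e / N * (\<Sum>i\<in>UNIV. norm ((y - x) $ i)) \<le> e / N * (N * norm (y - x))"
      using e N by (intro mult_left_mono S) simp
    finally show "norm (f y - f x - (\<Sum>i\<in>UNIV. (y - x) $ i * pderiv_at i f x)) \<le> e * norm (y - x)"
      using N sum_axis[of "y - x"] by simp
  qed
qed

theorem holo_on_iff_slicewise: "holo_on f U \<longleftrightarrow> slicewise f U"
proof
  assume f: "holo_on f U"
  have "(\<lambda>t. f (x + axis i t)) field_differentiable at 0" if x: "x \<in> U" for x i
  proof -
    obtain f' where f': "(f has_derivative f') (at x)" "\<And>c v. f' (c *s v) = c * f' v"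
      using f x unfolding holo_on_def by blast
    have "((\<lambda>t. x + axis i t) has_derivative (\<lambda>t. axis i t)) (at 0)"
      using has_derivative_add[OF has_derivative_const
          bounded_linear_imp_has_derivative[OF bounded_linear_axis]] by simp
    then have "((\<lambda>t. f (x + axis i t)) has_derivative (\<lambda>t. f' (axis i t))) (at 0)"
      using has_derivative_compose[of "\<lambda>t. x + axis i t" "\<lambda>t. axis i t" 0 UNIV f f'] f'(1)
      by simp
    moreover have "(\<lambda>t. f' (axis i t)) = (*) (f' (axis i 1))"
    proof
      show "f' (axis i t) = f' (axis i 1) * t" for t
        using f'(2)[of t "axis i 1"] by (simp only: smult_axis mult.commute)
    qed
    ultimately show ?thesis
      unfolding field_differentiable_def has_field_derivative_def by auto
  qed
  moreover have "continuous_on U f"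
  proof (intro continuous_at_imp_continuous_on ballI)
    show "isCont f x" if "x \<in> U" for x
      using f that has_derivative_continuous[of f _ x] unfolding holo_on_def by auto
  qed
  ultimately show "slicewise f U"
    using f unfolding slicewise_def holo_on_def by blast
next
  assume f: "slicewise f U"
  show "holo_on f U" unfolding holo_on_def
  proof (intro conjI ballI exI)
    show "open U" using f by (simp add: slicewise_def)
    fix x assume "x \<in> U"
    then show "(f has_derivative (\<lambda>v. \<Sum>i\<in>UNIV. v $ i * pderiv_at i f x)) (at x)"
      by (rule slicewise_has_derivative[OF f])
  qed (simp add: sum_distrib_left mult.assoc)
qed

lemma tendsto_add_axis: "((\<lambda>t. x + axis i t) \<longlongrightarrow> (x :: complex ^ 'n::finite)) (nhds 0)"
proof -
  have "((\<lambda>t. x + axis i t) \<longlongrightarrow> x + axis i (0::complex)) (nhds 0)"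
    by (intro tendsto_add tendsto_const bounded_linear.tendsto[OF bounded_linear_axis] filterlim_ident)
  then show ?thesis by simp
qed

lemma eventually_axis:
  "eventually P (nhds (x :: complex ^ 'n::finite)) \<Longrightarrow> \<forall>\<^sub>F t in nhds 0. P (x + axis i t)"
  using tendsto_add_axis[of x] unfolding filterlim_iff by blast

lemma slice_in_open: "open U \<Longrightarrow> x \<in> U \<Longrightarrow> \<forall>\<^sub>F t in nhds 0. x + axis i t \<in> (U :: (complex ^ 'n::finite) set)"
  by (intro eventually_axis eventually_nhds_in_open)

lemma slicewise_subset: "slicewise f U \<Longrightarrow> open V \<Longrightarrow> V \<subseteq> U \<Longrightarrow> slicewise f V"
  unfolding slicewise_def using continuous_on_subset by blast

lemma slicewise_open: "slicewise f U \<Longrightarrow> open U"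
  by (simp add: slicewise_def)

lemma slicewise_deriv:
  assumes "slicewise f U" "x \<in> U"
  shows "((\<lambda>t. f (x + axis i t)) has_field_derivative pderiv_at i f x) (at 0)"
  using slice_has_field_derivative[OF assms(1), of x i 0] assms by simp

lemma slicewiseI:
  assumes "open U" "continuous_on U f"
    and "\<And>x i. x \<in> U \<Longrightarrow> ((\<lambda>t. f (x + axis i t)) has_field_derivative f' i x) (at 0)"
  shows "slicewise f U"
  using assms unfolding slicewise_def field_differentiable_def by blast

lemma pderiv_atI:
  "((\<lambda>t. f (x + axis i t)) has_field_derivative d) (at 0) \<Longrightarrow> pderiv_at i f x = d"
  unfolding pderiv_at_axis by (rule DERIV_imp_deriv)

lemma pderiv_at_cong:
  assumes "\<forall>\<^sub>F z in nhds x. f z = g z"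
  shows "pderiv_at i f x = pderiv_at i g x"
  unfolding pderiv_at_axis by (intro deriv_cong_ev eventually_axis assms refl)

lemma slicewise_cong:
  assumes f: "slicewise f U" and eq: "\<And>x. x \<in> U \<Longrightarrow> f x = g x"
  shows "slicewise g U"
proof (rule slicewiseI)
  show "open U" using f by (rule slicewise_open)
  show "continuous_on U g"
    using f continuous_on_cong[of U U f g] eq by (simp add: slicewise_def)
  fix x i assume x: "x \<in> U"
  have "\<forall>\<^sub>F t in nhds 0. f (x + axis i t) = g (x + axis i t)"
    by (rule eventually_mono[OF slice_in_open[OF slicewise_open[OF f] x]]) (rule eq)
  from DERIV_cong_ev[OF refl this refl] slicewise_deriv[OF f x, of i]
  show "((\<lambda>t. g (x + axis i t)) has_field_derivative pderiv_at i f x) (at 0)" by simp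
qed

lemma slicewise_local:
  assumes "\<And>x. x \<in> U \<Longrightarrow> \<exists>V. x \<in> V \<and> V \<subseteq> U \<and> slicewise f V"
  shows "slicewise f U"
proof -
  have "open U"
    unfolding open_subopen[of U]
  proof
    fix x assume "x \<in> U"
    from assms[OF this] show "\<exists>T. open T \<and> x \<in> T \<and> T \<subseteq> U"
      using slicewise_open[of f] by auto
  qed
  moreover have "continuous_on U f"
  proof (intro continuous_at_imp_continuous_on ballI)
    fix x assume "x \<in> U"
    from assms[OF this] obtain V where "x \<in> V" "open V" "continuous_on V f"
      unfolding slicewise_def by auto
    then show "isCont f x" using continuous_on_eq_continuous_at by auto
  qed
  moreover have "(\<lambda>t. f (x + axis i t)) field_differentiable at 0" if "x \<in> U" for x i
    using assms[OF that] unfolding slicewise_def by auto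
  ultimately show ?thesis by (simp add: slicewise_def)
qed

lemma slicewise_const: "open U \<Longrightarrow> slicewise (\<lambda>x. c) U"
  by (rule slicewiseI) (auto intro!: continuous_intros derivative_eq_intros)

lemma coord_deriv: "((\<lambda>t. (x + axis i t) $ j) has_field_derivative (if i = j then 1 else 0)) (at (0::complex))"
proof -
  have "((\<lambda>t. x $ j + (if i = j then t else 0)) has_field_derivative (if i = j then 1 else 0)) (at (0::complex))"
    by (auto intro!: derivative_eq_intros)
  also have "(\<lambda>t. x $ j + (if i = j then t else 0)) = (\<lambda>t. (x + axis i t) $ j)"
    by (auto simp: axis_def)
  finally show ?thesis .
qed

lemma slicewise_coord: "open U \<Longrightarrow> slicewise (\<lambda>x. x $ j) U"
  using coord_deriv by (intro slicewiseI continuous_intros)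

lemma slicewise_add: "slicewise f U \<Longrightarrow> slicewise g U \<Longrightarrow> slicewise (\<lambda>x. f x + g x) U"
  unfolding slicewise_def by (auto intro!: continuous_intros field_differentiable_add)

lemma slicewise_diff: "slicewise f U \<Longrightarrow> slicewise g U \<Longrightarrow> slicewise (\<lambda>x. f x - g x) U"
  unfolding slicewise_def by (auto intro!: continuous_intros field_differentiable_diff)

lemma slicewise_mult: "slicewise f U \<Longrightarrow> slicewise g U \<Longrightarrow> slicewise (\<lambda>x. f x * g x) U"
  unfolding slicewise_def by (auto intro!: continuous_intros field_differentiable_mult)

lemma slicewise_divide:
  "slicewise f U \<Longrightarrow> slicewise g U \<Longrightarrow> (\<And>x. x \<in> U \<Longrightarrow> g x \<noteq> 0) \<Longrightarrow> slicewise (\<lambda>x. f x / g x) U"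
  unfolding slicewise_def by (auto intro!: continuous_intros field_differentiable_divide)

lemma slicewise_sum:
  "open U \<Longrightarrow> (\<And>k. k \<in> I \<Longrightarrow> slicewise (f k) U) \<Longrightarrow> slicewise (\<lambda>x. \<Sum>k\<in>I. f k x) U"
  unfolding slicewise_def by (auto intro!: continuous_intros field_differentiable_sum)

lemma pderiv_const: "pderiv_at i (\<lambda>x. c) x = 0"
  by (rule pderiv_atI) (rule DERIV_const)

lemma pderiv_coord: "pderiv_at i (\<lambda>x. x $ j) x = (if i = j then 1 else 0)"
  by (intro pderiv_atI coord_deriv)

lemma pderiv_add:
  assumes "slicewise f U" "slicewise g U" "x \<in> U"
  shows "pderiv_at i (\<lambda>x. f x + g x) x = pderiv_at i f x + pderiv_at i g x"
  by (intro pderiv_atI DERIV_add slicewise_deriv[OF assms(1)] slicewise_deriv[OF assms(2)] assms(3))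

lemma pderiv_diff:
  assumes "slicewise f U" "slicewise g U" "x \<in> U"
  shows "pderiv_at i (\<lambda>x. f x - g x) x = pderiv_at i f x - pderiv_at i g x"
  by (intro pderiv_atI DERIV_diff slicewise_deriv[OF assms(1)] slicewise_deriv[OF assms(2)] assms(3))

lemma pderiv_mult:
  assumes "slicewise f U" "slicewise g U" "x \<in> U"
  shows "pderiv_at i (\<lambda>x. f x * g x) x = pderiv_at i f x * g x + f x * pderiv_at i g x"
  using DERIV_mult[OF slicewise_deriv[OF assms(1,3)] slicewise_deriv[OF assms(2,3)], of i i]
  by (intro pderiv_atI) (simp add: mult.commute)

lemma pderiv_sum:
  assumes "\<And>k. k \<in> I \<Longrightarrow> slicewise (f k) U" "x \<in> U"
  shows "pderiv_at i (\<lambda>x. \<Sum>k\<in>I. f k x) x = (\<Sum>k\<in>I. pderiv_at i (f k) x)"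
  by (intro pderiv_atI DERIV_sum slicewise_deriv[of _ U] assms)

lemma slicewise_compose_holomorphic:
  assumes f: "slicewise f U" and g: "g holomorphic_on S" "open S" and sub: "\<And>x. x \<in> U \<Longrightarrow> f x \<in> S"
  shows "slicewise (\<lambda>x. g (f x)) U"
proof (rule slicewiseI)
  show "open U" using f by (rule slicewise_open)
  show "continuous_on U (\<lambda>x. g (f x))"
    using f sub holomorphic_on_imp_continuous_on[OF g(1)]
    by (intro continuous_on_compose2[of S g U f]) (auto simp: slicewise_def)
  fix x i assume x: "x \<in> U"
  have "(g has_field_derivative deriv g (f (x + axis i 0))) (at (f (x + axis i 0)))"
    using holomorphic_derivI[OF g] sub[OF x] by simp
  from DERIV_chain2[OF this slicewise_deriv[OF f x]]
  show "((\<lambda>t. g (f (x + axis i t))) has_field_derivative deriv g (f (x + axis i 0)) * pderiv_at i f x) (at 0)" .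
qed

lemma slicewise_compose:
  fixes \<psi> :: "complex ^ 'n::finite \<Rightarrow> complex ^ 'm::finite"
  assumes f: "slicewise f V" and psi: "\<And>k. slicewise (\<lambda>x. \<psi> x $ k) U" and sub: "\<And>x. x \<in> U \<Longrightarrow> \<psi> x \<in> V"
  shows "slicewise (\<lambda>x. f (\<psi> x)) U"
    and "x \<in> U \<Longrightarrow> pderiv_at i (\<lambda>x. f (\<psi> x)) x =
           (\<Sum>k\<in>UNIV. pderiv_at k f (\<psi> x) * pderiv_at i (\<lambda>x. \<psi> x $ k) x)"
proof -
  have *: "((\<lambda>t. f (\<psi> (x + axis i t))) has_field_derivative
      (\<Sum>k\<in>UNIV. pderiv_at k f (\<psi> x) * pderiv_at i (\<lambda>x. \<psi> x $ k) x)) (at 0)"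
    if x: "x \<in> U" for x i
  proof -
    have "((\<lambda>t. \<Sum>k\<in>UNIV. axis k (\<psi> (x + axis i t) $ k)) has_derivative
          (\<lambda>t. \<Sum>k\<in>UNIV. axis k (pderiv_at i (\<lambda>x. \<psi> x $ k) x * t))) (at 0)"
      using slicewise_deriv[OF psi x]
      by (intro has_derivative_sum bounded_linear.has_derivative[OF bounded_linear_axis])
         (simp add: has_field_derivative_def)
    then have 1: "((\<lambda>t. \<psi> (x + axis i t)) has_derivative
          (\<lambda>t. \<Sum>k\<in>UNIV. axis k (pderiv_at i (\<lambda>x. \<psi> x $ k) x * t))) (at 0)"
      unfolding sum_axis .
    have 2: "(f has_derivative (\<lambda>v. \<Sum>k\<in>UNIV. v $ k * pderiv_at k f (\<psi> x))) (at (\<psi> (x + axis i 0)))"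
      using slicewise_has_derivative[OF f sub[OF x]] by simp
    have "(\<Sum>j\<in>UNIV. axis j (c j)) $ k = c k" for c :: "'m \<Rightarrow> complex" and k
      by (simp add: axis_def if_distrib cong: if_cong)
    then have "(\<lambda>t. \<Sum>k\<in>UNIV. (\<Sum>j\<in>UNIV. axis j (pderiv_at i (\<lambda>x. \<psi> x $ j) x * t)) $ k * pderiv_at k f (\<psi> x)) =
       (*) (\<Sum>k\<in>UNIV. pderiv_at k f (\<psi> x) * pderiv_at i (\<lambda>x. \<psi> x $ k) x)"
      by (simp add: fun_eq_iff sum_distrib_left sum_distrib_right mult_ac)
    then show ?thesis
      using has_derivative_compose[OF 1 2] unfolding has_field_derivative_def by (simp only:)
  qed
  show "x \<in> U \<Longrightarrow> pderiv_at i (\<lambda>x. f (\<psi> x)) x =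
           (\<Sum>k\<in>UNIV. pderiv_at k f (\<psi> x) * pderiv_at i (\<lambda>x. \<psi> x $ k) x)"
    by (intro pderiv_atI *)
  have "continuous_on U (\<lambda>x. \<psi> x)"
  proof -
    have "continuous_on U (\<lambda>x. \<Sum>k\<in>UNIV. axis k (\<psi> x $ k))"
      using psi by (intro continuous_on_sum continuous_on_axis) (simp add: slicewise_def)
    then show ?thesis unfolding sum_axis .
  qed
  then have "continuous_on U (\<lambda>x. f (\<psi> x))"
    using f sub by (intro continuous_on_compose2[of V f U \<psi>]) (auto simp: slicewise_def)
  then show "slicewise (\<lambda>x. f (\<psi> x)) U"
    using * psi by (intro slicewiseI) (auto simp: slicewise_def)
qed

text \<open>
  Differentiation under the integral sign. For a separately holomorphic integrand it suffices that
  the partial derivatives are jointly continuous.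
\<close>

lemma slicewise_integral:
  fixes f :: "real \<Rightarrow> 'n::finite cfun"
  assumes U: "open U"
    and cont: "continuous_on (U \<times> {0..1}) (\<lambda>(x, t). f t x)"
    and der: "\<And>t x i. t \<in> {0..1} \<Longrightarrow> x \<in> U \<Longrightarrow> ((\<lambda>s. f t (x + axis i s)) has_field_derivative fd i t x) (at 0)"
    and contd: "\<And>i. continuous_on (U \<times> {0..1}) (\<lambda>(x, t). fd i t x)"
  shows "slicewise (\<lambda>x. integral {0..1} (\<lambda>t. f t x)) U"
    and "x \<in> U \<Longrightarrow> pderiv_at i (\<lambda>x. integral {0..1} (\<lambda>t. f t x)) x = integral {0..1} (\<lambda>t. fd i t x)"
proof -
  have *: "((\<lambda>s. integral {0..1} (\<lambda>t. f t (x + axis i s))) has_field_derivative integral {0..1} (\<lambda>t. fd i t x)) (at 0)"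
    if x: "x \<in> U" for x i
  proof -
    obtain e where e: "e > 0" "ball x e \<subseteq> U" using U x openE by blast
    have in_U: "x + axis i s \<in> U" if "s \<in> ball 0 e" for s :: complex
    proof -
      have "x + axis i s \<in> ball x e" using that by (simp add: dist_norm)
      then show ?thesis using e by blast
    qed
    have "((\<lambda>s. integral (cbox 0 1) (\<lambda>t. f t (x + axis i s))) has_field_derivative
        integral (cbox 0 1) (\<lambda>t. fd i t (x + axis i 0))) (at 0 within ball 0 e)"
    proof (rule leibniz_rule_field_derivative[where fx="\<lambda>(s::complex) t. fd i t (x + axis i s)"])
      fix s :: complex and t assume s: "s \<in> ball 0 e" and t: "t \<in> cbox (0::real) 1"
      have "((\<lambda>h. f t ((x + axis i s) + axis i h)) has_field_derivative fd i t (x + axis i s)) (at (s - s))"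
        using der[of t "x + axis i s" i] in_U[OF s] t by simp
      then have "((\<lambda>h. f t (x + axis i h)) has_field_derivative fd i t (x + axis i s)) (at s)"
        using DERIV_shift[of "\<lambda>h. f t (x + axis i h)" "fd i t (x + axis i s)" 0 s]
        by (simp add: axis_add add_ac)
      then show "((\<lambda>s. f t (x + axis i s)) has_field_derivative fd i t (x + axis i s)) (at s within ball 0 e)"
        by (rule has_field_derivative_at_within)
    next
      fix s :: complex assume s: "s \<in> ball 0 e"
      have "continuous_on (cbox 0 1) (\<lambda>t. (\<lambda>(x, t). f t x) (x + axis i s, t))"
        using in_U[OF s] by (intro continuous_on_compose2[OF cont] continuous_intros) auto
      then show "(\<lambda>t. f t (x + axis i s)) integrable_on cbox 0 1"
        by (intro integrable_continuous) simp
    next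
      have "continuous_on (ball 0 e \<times> cbox 0 1) (\<lambda>p. (\<lambda>(x, t). fd i t x) (x + axis i (fst p), snd p))"
        using in_U by (intro continuous_on_compose2[OF contd] continuous_intros) auto
      then show "continuous_on (ball 0 e \<times> cbox 0 1) (\<lambda>(s, t). fd i t (x + axis i s))"
        by (simp add: split_beta)
    qed (use e in auto)
    moreover have "at (0::complex) within ball 0 e = at 0"
      using e by (intro at_within_open) auto
    ultimately show ?thesis by simp
  qed
  show "x \<in> U \<Longrightarrow> pderiv_at i (\<lambda>x. integral {0..1} (\<lambda>t. f t x)) x = integral {0..1} (\<lambda>t. fd i t x)"
    by (intro pderiv_atI *)
  have "continuous_on U (\<lambda>x. integral (cbox 0 1) (\<lambda>t. f t x))"
    using cont by (intro integral_continuous_on_param) simp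
  then show "slicewise (\<lambda>x. integral {0..1} (\<lambda>t. f t x)) U"
    using U * by (intro slicewiseI) simp_all
qed

text \<open>
  All statements about second derivatives come from Cauchy's formula for \<open>pderiv_at i f\<close> with one
  radius that serves all centres near \<open>x\<close>: the parameter \<open>x\<close> may be differentiated under the
  integral. The formula for the second derivative is again a Cauchy integral, now of
  \<open>pderiv_at j f\<close>, and this is what makes the partial derivatives commute.
\<close>

lemma slicewise_pderiv_local:
  fixes f :: "'n::finite cfun"
  assumes f: "slicewise f U" and x: "x \<in> U"
  shows "\<exists>r>0. ball x r \<subseteq> U \<and> slicewise (pderiv_at i f) (ball x r) \<and> (\<forall>t. norm t \<le> r \<longrightarrow> x + axis i t \<in> U) \<and>
    (\<forall>j. pderiv_at j (pderiv_at i f) x = integral {0..1} (\<lambda>t. pderiv_at j f (x + axis i (circ r t)) / circ r t))"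
proof -
  obtain e where e: "e > 0" "ball x e \<subseteq> U"
    using f x openE unfolding slicewise_def by blast
  define r where "r = e / 3"
  have r: "r > 0" using e by (simp add: r_def)
  have sub: "z + axis i t \<in> U" if "z \<in> ball x r" "norm t \<le> r" for z t
  proof -
    have "dist x (z + axis i t) \<le> dist x z + norm (axis i t :: complex ^ 'n)"
      using dist_triangle[of x "z + axis i t" z] by (simp add: dist_norm)
    then have "z + axis i t \<in> ball x e" using that e by (simp add: r_def)
    then show ?thesis using e by blast
  qed
  have circ0: "circ r t \<noteq> 0" for t using r by (simp add: circ_def)
  have contc: "continuous_on (ball x r \<times> {0..1}) (\<lambda>(z, t). g (z + axis i (circ r t)) / circ r t)"
    if g: "continuous_on U g" for g :: "'n cfun"
  proof -
    have "continuous_on (ball x r \<times> {0..1}) (\<lambda>p. g (fst p + axis i (circ r (snd p))))"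
    proof (rule continuous_on_compose2[OF g])
      show "continuous_on (ball x r \<times> {0..1}) (\<lambda>p. fst p + axis i (circ r (snd p)))"
        by (intro continuous_intros)
      show "(\<lambda>p. fst p + axis i (circ r (snd p))) ` (ball x r \<times> {0..1}) \<subseteq> U"
      proof (rule image_subsetI)
        fix p assume "p \<in> ball x r \<times> {0..1::real}"
        then show "fst p + axis i (circ r (snd p)) \<in> U"
          using r by (intro sub) (simp_all add: mem_Times_iff)
      qed
    qed
    then show ?thesis
      unfolding split_beta using circ0
      by (intro continuous_on_divide continuous_on_circ continuous_on_snd continuous_on_id) blast+
  qed
  have der: "((\<lambda>s. f (z + axis j s + axis i (circ r t)) / circ r t) has_field_derivative
      pderiv_at j f (z + axis i (circ r t)) / circ r t) (at 0)" if z: "z \<in> ball x r" for z j t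
  proof -
    have "z + axis i (circ r t) \<in> U" using r by (intro sub z) simp
    from DERIV_cdivide[OF slicewise_deriv[OF f this, of j], of "circ r t"]
    show ?thesis by (simp add: add_ac)
  qed
  note I = slicewise_integral[of "ball x r" "\<lambda>t z. f (z + axis i (circ r t)) / circ r t"
      "\<lambda>j t z. pderiv_at j f (z + axis i (circ r t)) / circ r t", OF open_ball contc der contc]
  have contf: "continuous_on U f" using f by (simp add: slicewise_def)
  note I = I[OF contf _ slicewise_continuous_pderiv[OF f]]
  have eq: "pderiv_at i f z = integral {0..1} (\<lambda>t. f (z + axis i (circ r t)) / circ r t)" if "z \<in> ball x r" for z
    by (rule pderiv_cauchy[OF f r sub[OF that]])
  have "slicewise (pderiv_at i f) (ball x r)"
    by (rule slicewise_cong[OF I(1) eq[symmetric]])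
  moreover have "pderiv_at j (pderiv_at i f) z = integral {0..1} (\<lambda>t. pderiv_at j f (z + axis i (circ r t)) / circ r t)"
    if z: "z \<in> ball x r" for z j
  proof -
    have "\<forall>\<^sub>F y in nhds z. pderiv_at i f y = integral {0..1} (\<lambda>t. f (y + axis i (circ r t)) / circ r t)"
      using z by (intro eventually_mono[OF eventually_nhds_in_open[OF open_ball z]] eq)
    from pderiv_at_cong[OF this] show ?thesis using I(2)[OF _ z] by simp
  qed
  moreover have "ball x r \<subseteq> U" using e r by (auto simp: r_def)
  moreover have "x \<in> ball x r" using r by simp
  ultimately show ?thesis using sub r by blast
qed

lemma slicewise_pderiv:
  assumes f: "slicewise f U"
  shows "slicewise (pderiv_at i f) U"
proof (rule slicewise_local)
  fix x assume "x \<in> U"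
  from slicewise_pderiv_local[OF f this, of i]
  show "\<exists>V. x \<in> V \<and> V \<subseteq> U \<and> slicewise (pderiv_at i f) V"
  proof (elim exE conjE)
    fix r :: real
    assume "r > 0" "ball x r \<subseteq> U" "slicewise (pderiv_at i f) (ball x r)"
    then show ?thesis using centre_in_ball by blast
  qed
qed

lemma pderiv_commute:
  assumes f: "slicewise f U" and x: "x \<in> U"
  shows "pderiv_at j (pderiv_at i f) x = pderiv_at i (pderiv_at j f) x"
proof -
  from slicewise_pderiv_local[OF f x, of i] show ?thesis
  proof (elim exE conjE)
    fix r :: real
    assume r: "r > 0" "\<forall>t. norm t \<le> r \<longrightarrow> x + axis i t \<in> U"
      "\<forall>j. pderiv_at j (pderiv_at i f) x = integral {0..1} (\<lambda>t. pderiv_at j f (x + axis i (circ r t)) / circ r t)"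
    have "pderiv_at i (pderiv_at j f) x = integral {0..1} (\<lambda>t. pderiv_at j f (x + axis i (circ r t)) / circ r t)"
      using r(2) by (intro pderiv_cauchy[OF slicewise_pderiv[OF f] r(1)]) blast
    with r(3) show ?thesis by (metis (lifting))
  qed
qed

lemma slicewise_uniform_limit:
  assumes f: "\<And>n. slicewise (f n) U" and lim: "uniform_limit U f g sequentially"
  shows "slicewise g U"
proof -
  have U: "open U" by (rule slicewise_open[OF f])
  have "continuous_on U g"
    using f by (intro uniform_limit_theorem[OF _ lim]) (auto simp: slicewise_def)
  moreover have "(\<lambda>t. g (x + axis i t)) field_differentiable at 0" if x: "x \<in> U" for x i
  proof -
    obtain e where e: "e > 0" "ball x e \<subseteq> U" using U x openE by blast
    have in_U: "x + axis i s \<in> U" if "s \<in> ball 0 e" for s :: complex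
    proof -
      have "x + axis i s \<in> ball x e" using that by (simp add: dist_norm)
      then show ?thesis using e by blast
    qed
    have "(\<lambda>t. g (x + axis i t)) holomorphic_on ball 0 e"
    proof (rule holomorphic_uniform_sequence)
      show "(\<lambda>t. f n (x + axis i t)) holomorphic_on ball 0 e" for n
        unfolding holomorphic_on_def field_differentiable_def
        using has_field_derivative_at_within[OF slice_has_field_derivative[OF f in_U]] by fast
      fix s :: complex assume s: "s \<in> ball 0 e"
      then obtain d where d: "d > 0" "cball s d \<subseteq> ball 0 e"
        using open_ball open_contains_cball by blast
      have "uniform_limit (cball s d) (\<lambda>n t. f n (x + axis i t)) (\<lambda>t. g (x + axis i t)) sequentially"
        unfolding uniform_limit_iff
      proof (intro allI impI)
        fix \<epsilon> :: real assume "\<epsilon> > 0"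
        then have "\<forall>\<^sub>F n in sequentially. \<forall>x\<in>U. dist (f n x) (g x) < \<epsilon>"
          using lim unfolding uniform_limit_iff by blast
        then show "\<forall>\<^sub>F n in sequentially. \<forall>t\<in>cball s d. dist (f n (x + axis i t)) (g (x + axis i t)) < \<epsilon>"
          by (rule eventually_mono) (use in_U d in blast)
      qed
      then show "\<exists>d. 0 < d \<and> cball s d \<subseteq> ball 0 e \<and>
          uniform_limit (cball s d) (\<lambda>n t. f n (x + axis i t)) (\<lambda>t. g (x + axis i t)) sequentially"
        using d by blast
    qed simp
    then show ?thesis using e
      by (intro holomorphic_on_imp_differentiable_at[of _ "ball 0 e"]) auto
  qed
  ultimately show ?thesis using U by (simp add: slicewise_def)
qed

lemma slicewise_radial_integral:
  fixes F :: "'n::finite cfun"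
  assumes F: "slicewise F B" and star: "\<And>z t. z \<in> B \<Longrightarrow> t \<in> {0..1} \<Longrightarrow> q + t *\<^sub>R (z - q) \<in> B"
  shows "slicewise (\<lambda>z. integral {0..1} (\<lambda>t. F (q + t *\<^sub>R (z - q)))) B"
    and "z \<in> B \<Longrightarrow> pderiv_at i (\<lambda>z. integral {0..1} (\<lambda>t. F (q + t *\<^sub>R (z - q)))) z =
           integral {0..1} (\<lambda>t. of_real t * pderiv_at i F (q + t *\<^sub>R (z - q)))"
proof -
  have contc: "continuous_on (B \<times> {0..1}) (\<lambda>p. g (q + snd p *\<^sub>R (fst p - q)))"
    if g: "continuous_on B g" for g :: "'n cfun"
    by (rule continuous_on_compose2[OF g])
       (auto intro!: continuous_intros star[simplified])
  have der: "((\<lambda>s. F (q + t *\<^sub>R (z + axis i s - q))) has_field_derivative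
      of_real t * pderiv_at i F (q + t *\<^sub>R (z - q))) (at 0)" if t: "t \<in> {0..1}" and z: "z \<in> B" for t z i
  proof -
    have "((\<lambda>s. F ((q + t *\<^sub>R (z - q)) + axis i (of_real t * s))) has_field_derivative
      pderiv_at i F (q + t *\<^sub>R (z - q)) * of_real t) (at 0)"
      by (rule DERIV_chain2[where f="\<lambda>s. F ((q + t *\<^sub>R (z - q)) + axis i s)"])
         (use slicewise_deriv[OF F star[OF z t]] in \<open>auto intro!: derivative_eq_intros\<close>)
    moreover have "q + t *\<^sub>R (z + axis i s - q) = (q + t *\<^sub>R (z - q)) + axis i (of_real t * s)" for s
      by (simp add: vec_eq_iff axis_def algebra_simps) (simp add: scaleR_conv_of_real algebra_simps)
    ultimately show ?thesis by (simp add: mult.commute add.assoc)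
  qed
  note I = slicewise_integral[of B "\<lambda>t z. F (q + t *\<^sub>R (z - q))" "\<lambda>i t z. of_real t * pderiv_at i F (q + t *\<^sub>R (z - q))",
      OF slicewise_open[OF F]]
  have 1: "continuous_on (B \<times> {0..1}) (\<lambda>(z, t). F (q + t *\<^sub>R (z - q)))"
    unfolding split_beta using F by (intro contc) (simp add: slicewise_def)
  have 2: "continuous_on (B \<times> {0..1}) (\<lambda>(z, t). of_real t * pderiv_at i F (q + t *\<^sub>R (z - q)))" for i
    unfolding split_beta
    by (intro continuous_on_mult contc slicewise_continuous_pderiv[OF F] continuous_on_of_real
        continuous_on_snd continuous_on_id)
  show "slicewise (\<lambda>z. integral {0..1} (\<lambda>t. F (q + t *\<^sub>R (z - q)))) B"
    by (rule I(1)[OF 1 der 2])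
  show "z \<in> B \<Longrightarrow> pderiv_at i (\<lambda>z. integral {0..1} (\<lambda>t. F (q + t *\<^sub>R (z - q)))) z =
           integral {0..1} (\<lambda>t. of_real t * pderiv_at i F (q + t *\<^sub>R (z - q)))"
    by (rule I(2)[OF 1 der 2])
qed

section \<open>Integrable linear Pfaffian systems\<close>

text \<open>
  The horizontal sections of the connection \<open>d - \<Sum>\<^sub>i Om\<^sub>i dz\<^sub>i\<close> on the trivial bundle whose
  coordinates are indexed by \<open>'k\<close>.
\<close>

definition pfaffian_solution ::
  "('n::finite \<Rightarrow> 'k::finite \<Rightarrow> 'k \<Rightarrow> 'n cfun) \<Rightarrow> (complex ^ 'n) set \<Rightarrow> ('k \<Rightarrow> 'n cfun) \<Rightarrow> bool" where
  "pfaffian_solution Om B U \<longleftrightarrow> (\<forall>a. slicewise (U a) B) \<and>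
     (\<forall>z\<in>B. \<forall>i a. pderiv_at i (U a) z = (\<Sum>c\<in>UNIV. Om i a c z * U c z))"

text \<open>
  The smallness of the coefficients replaces Gronwall's inequality: at a point where the largest
  component is maximal the mean value inequality bounds the maximum by half of itself.
\<close>

lemma linear_ode_zero:
  fixes W :: "'k::finite \<Rightarrow> real \<Rightarrow> complex"
  assumes der: "\<And>a t. t \<in> {0..1} \<Longrightarrow> (W a has_vector_derivative (\<Sum>c\<in>UNIV. k a c t * W c t)) (at t within {0..1})"
    and zero: "\<And>a. W a 0 = 0"
    and small: "\<And>a t. t \<in> {0..1} \<Longrightarrow> (\<Sum>c\<in>UNIV. norm (k a c t)) \<le> 1/2"
    and t: "t \<in> {0..1}"
  shows "W a t = 0"
proof -
  have cont: "continuous_on {0..1} (\<lambda>t. norm (W a t))" for a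
    by (intro continuous_on_norm continuous_on_vector_derivative[of "{0..1}" "W a" "\<lambda>t. \<Sum>c\<in>UNIV. k a c t * W c t"] der)
  have "\<exists>s\<in>{0..1}. \<forall>t\<in>{0..1}. norm (W a t) \<le> norm (W a s)" for a
    by (rule continuous_attains_sup[OF compact_Icc _ cont]) simp
  then obtain s where s: "\<And>a. s a \<in> {0..1}" "\<And>a t. t \<in> {0..1} \<Longrightarrow> norm (W a t) \<le> norm (W a (s a))"
    by metis
  define M where "M = Max (range (\<lambda>a. norm (W a (s a))))"
  have M: "norm (W a t) \<le> M" if "t \<in> {0..1}" for a t
  proof -
    have "norm (W a (s a)) \<le> M" unfolding M_def by (rule Max_ge) auto
    then show ?thesis using s(2)[OF that, of a] by simp
  qed
  have "M \<in> range (\<lambda>a. norm (W a (s a)))" unfolding M_def by (rule Max_in) auto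
  then obtain b where b: "M = norm (W b (s b))" by auto
  have M0: "M \<ge> 0" unfolding b by simp
  have "norm (W b (s b) - W b 0) \<le> M / 2 * norm (s b - 0)"
  proof (rule differentiable_bound[of "{0..1}" "W b" "\<lambda>t h. h *\<^sub>R (\<Sum>c\<in>UNIV. k b c t * W c t)" "M / 2"])
    fix t :: real assume t: "t \<in> {0..1}"
    show "(W b has_derivative (\<lambda>h. h *\<^sub>R (\<Sum>c\<in>UNIV. k b c t * W c t))) (at t within {0..1})"
      using der[OF t] by (simp add: has_vector_derivative_def)
    have "norm (\<Sum>c\<in>UNIV. k b c t * W c t) \<le> (\<Sum>c\<in>UNIV. norm (k b c t) * M)"
      by (rule sum_norm_le) (simp add: norm_mult mult_left_mono M[OF t])
    also have "\<dots> \<le> 1/2 * M"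
      unfolding sum_distrib_right[symmetric] by (intro mult_right_mono small t M0)
    finally have "norm (\<Sum>c\<in>UNIV. k b c t * W c t) \<le> M / 2" by simp
    from mult_left_mono[OF this abs_ge_zero]
    show "onorm (\<lambda>h. h *\<^sub>R (\<Sum>c\<in>UNIV. k b c t * W c t)) \<le> M / 2"
      by (intro onorm_le) (simp only: norm_scaleR real_norm_def mult.commute[of "M / 2"])
  qed (use s(1)[of b] in auto)
  then have "M \<le> M / 2 * s b" using zero b s(1)[of b] by simp
  also have "\<dots> \<le> M / 2" using s(1)[of b] M0 by (simp add: mult_left_le)
  finally have "M = 0" using M0 by simp
  then show ?thesis using M[OF t, of a] by simp
qed

lemma ray_derivative:
  fixes F :: "'n::finite cfun"
  assumes F: "slicewise F B" and in_B: "q + t *\<^sub>R (z - q) \<in> B"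
  shows "((\<lambda>t. F (q + t *\<^sub>R (z - q))) has_vector_derivative
           (\<Sum>j\<in>UNIV. (z $ j - q $ j) * pderiv_at j F (q + t *\<^sub>R (z - q)))) (at t within S)"
proof -
  have "((\<lambda>t. q + t *\<^sub>R (z - q)) has_derivative (\<lambda>h. h *\<^sub>R (z - q))) (at t within S)"
    by (auto intro!: derivative_eq_intros)
  from has_derivative_compose[OF this slicewise_has_derivative[OF F in_B]]
  show ?thesis
    unfolding has_vector_derivative_def
    by (simp add: sum_distrib_left scaleR_conv_of_real[where 'a=complex] mult.assoc)
qed

lemma pfaffian_solution_diff:
  assumes U: "pfaffian_solution Om C U" and U': "pfaffian_solution Om C U'"
  shows "pfaffian_solution Om C (\<lambda>a z. U a z - U' a z)"
  unfolding pfaffian_solution_def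
proof (intro conjI allI ballI)
  show "slicewise (\<lambda>z. U a z - U' a z) C" for a
    using U U' by (intro slicewise_diff) (simp_all add: pfaffian_solution_def)
  fix z i a assume z: "z \<in> C"
  have "pderiv_at i (\<lambda>z. U a z - U' a z) z = pderiv_at i (U a) z - pderiv_at i (U' a) z"
    using U U' z by (intro pderiv_diff[of _ C]) (simp_all add: pfaffian_solution_def)
  then show "pderiv_at i (\<lambda>z. U a z - U' a z) z = (\<Sum>c\<in>UNIV. Om i a c z * (U c z - U' c z))"
    using U U' z by (simp add: pfaffian_solution_def sum_subtractf right_diff_distrib)
qed

text \<open>
  The bound makes the integral operator below a contraction with constant \<open>1/2\<close> for the supremum
  norm on all of \<open>B\<close>. The second point \<open>z'\<close> ranges over \<open>B\<close> independently of \<open>z\<close>, because the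
  coefficients are evaluated on the whole segment from \<open>q\<close> to \<open>z\<close>.
\<close>

locale small_connection =
  fixes B :: "(complex ^ 'n::finite) set" and q :: "complex ^ 'n"
    and Om :: "'n \<Rightarrow> 'k::finite \<Rightarrow> 'k \<Rightarrow> 'n cfun"
  assumes convex_B: "convex B" and q_in_B: "q \<in> B"
    and holo_Om: "\<And>i a c. slicewise (Om i a c) B"
    and small: "\<And>z z' a. z \<in> B \<Longrightarrow> z' \<in> B \<Longrightarrow>
      (\<Sum>c\<in>UNIV. \<Sum>i\<in>UNIV. norm (z $ i - q $ i) * norm (Om i a c z')) \<le> 1/2"
begin

lemma open_B: "open B"
  using holo_Om slicewise_open by blast

lemma ray_in_B: "z \<in> B \<Longrightarrow> t \<in> {0..1} \<Longrightarrow> q + t *\<^sub>R (z - q) \<in> B"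
  using convexD_alt[OF convex_B q_in_B, of z t] by (simp add: algebra_simps)

lemma small_ray:
  assumes "z \<in> B" "z' \<in> B"
  shows "(\<Sum>c\<in>UNIV. norm (\<Sum>j\<in>UNIV. (z $ j - q $ j) * Om j a c z')) \<le> 1/2"
proof -
  have "(\<Sum>c\<in>UNIV. norm (\<Sum>j\<in>UNIV. (z $ j - q $ j) * Om j a c z'))
      \<le> (\<Sum>c\<in>UNIV. \<Sum>i\<in>UNIV. norm (z $ i - q $ i) * norm (Om i a c z'))"
    by (intro sum_mono sum_norm_le) (simp add: norm_mult)
  then show ?thesis using small[OF assms] by (rule order_trans)
qed

text \<open>
  Uniqueness for the initial value problem, by restriction to segments from \<open>q\<close>. The index set
  \<open>Z\<close> is allowed to be smaller than everything: if the equations for the components in \<open>Z\<close> involve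
  only these components, then these components vanish on their own. With all indices this gives
  uniqueness; with a single index it shows that a component that is zero at one point stays zero.
\<close>

lemma solution_vanishes:
  assumes C: "convex C" "open C" "C \<subseteq> B" "q \<in> C"
    and U: "pfaffian_solution Om C U"
    and Z: "\<And>i a c y. a \<in> Z \<Longrightarrow> c \<notin> Z \<Longrightarrow> Om i a c y = 0"
    and zero: "\<And>a. a \<in> Z \<Longrightarrow> U a q = 0" and a: "a \<in> Z" and z: "z \<in> C"
  shows "U a z = 0"
proof -
  have sU: "slicewise (U a) C" for a
    using U by (simp add: pfaffian_solution_def)
  have pU: "pderiv_at i (U a) y = (\<Sum>c\<in>UNIV. Om i a c y * U c y)" if "y \<in> C" for i a y
    using U that by (simp add: pfaffian_solution_def)
  have ray: "q + t *\<^sub>R (z - q) \<in> C" if "t \<in> {0..1}" for t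
    using convexD_alt[OF C(1) C(4) z, of t] that by (simp add: algebra_simps)
  define W where "W a t = (if a \<in> Z then U a (q + t *\<^sub>R (z - q)) else 0)" for a t
  define k where "k a c t = (if a \<in> Z then \<Sum>j\<in>UNIV. (z $ j - q $ j) * Om j a c (q + t *\<^sub>R (z - q)) else 0)" for a c t
  have "W a 1 = 0"
  proof (rule linear_ode_zero[of W k])
    fix a and t :: real assume t: "t \<in> {0..1}"
    show "(W a has_vector_derivative (\<Sum>c\<in>UNIV. k a c t * W c t)) (at t within {0..1})"
    proof (cases "a \<in> Z")
      case False
      then have "W a = (\<lambda>t. 0)" "(\<Sum>c\<in>UNIV. k a c t * W c t) = 0" by (simp_all add: W_def fun_eq_iff k_def)
      then show ?thesis by simp
    next
      case True
      have "(\<Sum>j\<in>UNIV. (z $ j - q $ j) * pderiv_at j (U a) (q + t *\<^sub>R (z - q))) =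
        (\<Sum>c\<in>UNIV. (\<Sum>j\<in>UNIV. (z $ j - q $ j) * Om j a c (q + t *\<^sub>R (z - q))) * U c (q + t *\<^sub>R (z - q)))"
        unfolding pU[OF ray[OF t]] sum_distrib_left sum_distrib_right
        by (subst sum.swap) (simp add: mult.assoc)
      also have "\<dots> = (\<Sum>c\<in>UNIV. k a c t * W c t)"
        using Z[OF True] True by (intro sum.cong refl) (simp add: k_def W_def)
      finally have "((\<lambda>t. U a (q + t *\<^sub>R (z - q))) has_vector_derivative (\<Sum>c\<in>UNIV. k a c t * W c t)) (at t within {0..1})"
        using ray_derivative[OF sU ray[OF t], of a "{0..1}"] by simp
      moreover have "W a = (\<lambda>t. U a (q + t *\<^sub>R (z - q)))" using True by (simp add: W_def fun_eq_iff)
      ultimately show ?thesis by simp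
    qed
    show "(\<Sum>c\<in>UNIV. norm (k a c t)) \<le> 1/2"
      using small_ray[of z "q + t *\<^sub>R (z - q)" a] z ray[OF t] C by (cases "a \<in> Z") (auto simp: k_def)
  qed (use zero in \<open>auto simp: W_def\<close>)
  then show ?thesis using a by (simp add: W_def)
qed

text \<open>
  Integration of the connection form along the segment from \<open>q\<close> to \<open>z\<close>. The solutions with
  \<open>U a q = v a\<close> are to be found among the fixed points of \<open>U \<mapsto> v + transport U\<close>.
\<close>

definition transport :: "('k \<Rightarrow> 'n cfun) \<Rightarrow> 'k \<Rightarrow> 'n cfun" where
  "transport U a z = (\<Sum>i\<in>UNIV. (z $ i - q $ i) *
     integral {0..1} (\<lambda>t. \<Sum>c\<in>UNIV. Om i a c (q + t *\<^sub>R (z - q)) * U c (q + t *\<^sub>R (z - q))))"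

lemma slicewise_Om_sum:
  assumes "\<And>c. slicewise (U c) B"
  shows "slicewise (\<lambda>y. \<Sum>c\<in>UNIV. Om i a c y * U c y) B"
  by (intro slicewise_sum slicewise_mult open_B holo_Om assms)

lemma slicewise_shift: "slicewise (\<lambda>z. z $ i - q $ i) B"
  by (intro slicewise_diff slicewise_coord slicewise_const open_B)

lemma pderiv_shift: "z \<in> B \<Longrightarrow> pderiv_at j (\<lambda>z. z $ i - q $ i) z = (if j = i then 1 else 0)"
  by (subst pderiv_diff[of _ B])
     (auto intro!: slicewise_coord slicewise_const open_B simp: pderiv_coord pderiv_const)

lemma slicewise_transport:
  assumes "\<And>c. slicewise (U c) B"
  shows "slicewise (transport U a) B"
  unfolding transport_def[abs_def]
  by (intro slicewise_sum slicewise_mult open_B slicewise_shift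
      slicewise_radial_integral(1)[OF slicewise_Om_sum[OF assms] ray_in_B])

lemma ray_continuous:
  assumes "slicewise F B" "z \<in> B"
  shows "continuous_on {0..1} (\<lambda>t. F (q + t *\<^sub>R (z - q)))"
proof (rule continuous_on_compose2[of B F])
  show "continuous_on B F" using assms(1) by (simp add: slicewise_def)
  show "continuous_on {0..1} (\<lambda>t. q + t *\<^sub>R (z - q))" by (intro continuous_intros)
  show "(\<lambda>t. q + t *\<^sub>R (z - q)) ` {0..1} \<subseteq> B"
    by (rule image_subsetI) (rule ray_in_B[OF assms(2)])
qed

text \<open>
  For \<open>F\<close> holomorphic and \<open>J F\<close> its mean over the segment, \<open>(E + 1) (J F) = F\<close> where \<open>E\<close> is the
  Euler operator centred at \<open>q\<close>: the integrand is the derivative of \<open>t F(q + t (z - q))\<close>.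
  So a fixed point of \<open>v + transport\<close> satisfies the radial part of the Pfaffian system.
\<close>

lemma transport_euler:
  assumes U: "\<And>c. slicewise (U c) B" and z: "z \<in> B"
  shows "(\<Sum>j\<in>UNIV. (z $ j - q $ j) * pderiv_at j (transport U a) z) =
         (\<Sum>i\<in>UNIV. (z $ i - q $ i) * (\<Sum>c\<in>UNIV. Om i a c z * U c z))"
proof -
  define F where "F i y = (\<Sum>c\<in>UNIV. Om i a c y * U c y)" for i y
  define R where "R i z = integral {0..1} (\<lambda>t. F i (q + t *\<^sub>R (z - q)))" for i z
  have F: "slicewise (F i) B" for i
    unfolding F_def by (rule slicewise_Om_sum[OF U])
  have R: "slicewise (R i) B" for i
    unfolding R_def by (rule slicewise_radial_integral(1)[OF F ray_in_B])
  have pR: "pderiv_at j (R i) z = integral {0..1} (\<lambda>t. of_real t * pderiv_at j (F i) (q + t *\<^sub>R (z - q)))" for i j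
    unfolding R_def by (rule slicewise_radial_integral(2)[OF F ray_in_B z])
  have T: "transport U a = (\<lambda>z. \<Sum>i\<in>UNIV. (z $ i - q $ i) * R i z)"
    by (simp add: transport_def[abs_def] R_def F_def)
  have "pderiv_at j (transport U a) z = R j z + (\<Sum>i\<in>UNIV. (z $ i - q $ i) * pderiv_at j (R i) z)" for j
  proof -
    have "pderiv_at j (transport U a) z = (\<Sum>i\<in>UNIV. pderiv_at j (\<lambda>z. (z $ i - q $ i) * R i z) z)"
      unfolding T by (intro pderiv_sum[of _ _ B] slicewise_mult slicewise_shift R z)
    also have "\<dots> = (\<Sum>i\<in>UNIV. (if j = i then 1 else 0) * R i z + (z $ i - q $ i) * pderiv_at j (R i) z)"
      by (intro sum.cong refl) (simp only: pderiv_mult[OF slicewise_shift R z] pderiv_shift[OF z])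
    also have "\<dots> = R j z + (\<Sum>i\<in>UNIV. (z $ i - q $ i) * pderiv_at j (R i) z)"
      by (simp add: sum.distrib if_distrib[of "\<lambda>x. x * _"] cong: if_cong)
    finally show ?thesis .
  qed
  then have "(\<Sum>j\<in>UNIV. (z $ j - q $ j) * pderiv_at j (transport U a) z) =
     (\<Sum>j\<in>UNIV. (z $ j - q $ j) * R j z) +
     (\<Sum>j\<in>UNIV. \<Sum>i\<in>UNIV. (z $ j - q $ j) * ((z $ i - q $ i) * pderiv_at j (R i) z))"
    by (simp add: distrib_left sum.distrib sum_distrib_left)
  also have "(\<Sum>j\<in>UNIV. \<Sum>i\<in>UNIV. (z $ j - q $ j) * ((z $ i - q $ i) * pderiv_at j (R i) z)) =
     (\<Sum>i\<in>UNIV. (z $ i - q $ i) * (\<Sum>j\<in>UNIV. (z $ j - q $ j) * pderiv_at j (R i) z))"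
    by (subst sum.swap) (simp add: sum_distrib_left mult_ac)
  also have "(\<Sum>j\<in>UNIV. (z $ j - q $ j) * R j z) + \<dots> =
     (\<Sum>i\<in>UNIV. (z $ i - q $ i) * (R i z + (\<Sum>j\<in>UNIV. (z $ j - q $ j) * pderiv_at j (R i) z)))"
    by (simp add: distrib_left sum.distrib)
  finally have main: "(\<Sum>j\<in>UNIV. (z $ j - q $ j) * pderiv_at j (transport U a) z) =
     (\<Sum>i\<in>UNIV. (z $ i - q $ i) * (R i z + (\<Sum>j\<in>UNIV. (z $ j - q $ j) * pderiv_at j (R i) z)))" .
  have "R i z + (\<Sum>j\<in>UNIV. (z $ j - q $ j) * pderiv_at j (R i) z) = F i z" for i
  proof -
    let ?g = "\<lambda>t. F i (q + t *\<^sub>R (z - q))"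
    let ?g' = "\<lambda>t. (\<Sum>j\<in>UNIV. (z $ j - q $ j) * pderiv_at j (F i) (q + t *\<^sub>R (z - q)))"
    have cont: "continuous_on {0..1} ?g" by (rule ray_continuous[OF F z])
    have contp: "continuous_on {0..1} (\<lambda>t. of_real t * pderiv_at j (F i) (q + t *\<^sub>R (z - q)))" for j
      by (intro continuous_on_mult continuous_on_of_real continuous_on_id ray_continuous[OF slicewise_pderiv[OF F] z])
    have "((\<lambda>t. of_real t * ?g t) has_vector_derivative ?g t + of_real t * ?g' t) (at t within {0..1})"
      if t: "t \<in> {0..1}" for t
      using has_vector_derivative_mult[OF has_vector_derivative_of_real[OF DERIV_ident]
          ray_derivative[OF F ray_in_B[OF z t], where S="{0..1}"]]
      by (simp add: add.commute)
    then have "((\<lambda>t. ?g t + of_real t * ?g' t) has_integral of_real 1 * ?g 1 - of_real 0 * ?g 0) {0..1}"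
      by (intro fundamental_theorem_of_calculus) auto
    from integral_unique[OF this]
    have "integral {0..1} (\<lambda>t. ?g t + of_real t * ?g' t) = F i z"
      by simp
    moreover have "integral {0..1} (\<lambda>t. ?g t + of_real t * ?g' t) =
       integral {0..1} (\<lambda>t. ?g t + (\<Sum>j\<in>UNIV. (z $ j - q $ j) * (of_real t * pderiv_at j (F i) (q + t *\<^sub>R (z - q)))))"
      by (intro integral_cong) (simp add: sum_distrib_left mult_ac)
    also have "\<dots> = integral {0..1} ?g + integral {0..1} (\<lambda>t. \<Sum>j\<in>UNIV. (z $ j - q $ j) * (of_real t * pderiv_at j (F i) (q + t *\<^sub>R (z - q))))"
      by (intro Henstock_Kurzweil_Integration.integral_add integrable_continuous_real continuous_on_sum continuous_on_mult_left cont contp)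
    also have "integral {0..1} (\<lambda>t. \<Sum>j\<in>UNIV. (z $ j - q $ j) * (of_real t * pderiv_at j (F i) (q + t *\<^sub>R (z - q)))) =
       (\<Sum>j\<in>UNIV. integral {0..1} (\<lambda>t. (z $ j - q $ j) * (of_real t * pderiv_at j (F i) (q + t *\<^sub>R (z - q)))))"
      by (intro Henstock_Kurzweil_Integration.integral_sum integrable_continuous_real continuous_on_mult_left contp) simp
    finally show ?thesis unfolding R_def[symmetric] pR integral_mult_right by simp
  qed
  then show ?thesis unfolding main by (simp add: F_def)
qed

lemma transport_eq_integral:
  assumes U: "\<And>c. slicewise (U c) B" and z: "z \<in> B"
  shows "transport U a z = integral {0..1} (\<lambda>t. \<Sum>i\<in>UNIV. (z $ i - q $ i) *
     (\<Sum>c\<in>UNIV. Om i a c (q + t *\<^sub>R (z - q)) * U c (q + t *\<^sub>R (z - q))))"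
  unfolding transport_def integral_mult_right[symmetric]
  by (intro Henstock_Kurzweil_Integration.integral_sum[symmetric] integrable_continuous_real continuous_on_mult_left
      ray_continuous[OF slicewise_Om_sum[OF U] z]) simp

lemma transport_diff:
  assumes U: "\<And>c. slicewise (U c) B" and U': "\<And>c. slicewise (U' c) B" and z: "z \<in> B"
  shows "transport (\<lambda>c z. U c z - U' c z) a z = transport U a z - transport U' a z"
proof -
  have "integral {0..1} (\<lambda>t. \<Sum>c\<in>UNIV. Om i a c (q + t *\<^sub>R (z - q)) * (U c (q + t *\<^sub>R (z - q)) - U' c (q + t *\<^sub>R (z - q)))) =
     integral {0..1} (\<lambda>t. \<Sum>c\<in>UNIV. Om i a c (q + t *\<^sub>R (z - q)) * U c (q + t *\<^sub>R (z - q))) -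
     integral {0..1} (\<lambda>t. \<Sum>c\<in>UNIV. Om i a c (q + t *\<^sub>R (z - q)) * U' c (q + t *\<^sub>R (z - q)))" for i
    unfolding right_diff_distrib sum_subtractf
    by (intro Henstock_Kurzweil_Integration.integral_diff integrable_continuous_real
        ray_continuous[OF slicewise_Om_sum[OF U] z] ray_continuous[OF slicewise_Om_sum[OF U'] z])
  then show ?thesis by (simp add: transport_def right_diff_distrib sum_subtractf)
qed

lemma transport_bound:
  assumes U: "\<And>c. slicewise (U c) B" and z: "z \<in> B" and K: "\<And>c y. y \<in> B \<Longrightarrow> norm (U c y) \<le> K"
  shows "norm (transport U a z) \<le> K / 2"
proof -
  have K0: "0 \<le> K" using K[OF q_in_B] norm_ge_zero order_trans by blast
  have "norm (integral {0..1} (\<lambda>t. \<Sum>i\<in>UNIV. (z $ i - q $ i) *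
     (\<Sum>c\<in>UNIV. Om i a c (q + t *\<^sub>R (z - q)) * U c (q + t *\<^sub>R (z - q))))) \<le> K / 2 * (1 - 0)"
  proof (rule integral_bound)
    show "continuous_on {0..1} (\<lambda>t. \<Sum>i\<in>UNIV. (z $ i - q $ i) *
     (\<Sum>c\<in>UNIV. Om i a c (q + t *\<^sub>R (z - q)) * U c (q + t *\<^sub>R (z - q))))"
      by (intro continuous_on_sum continuous_on_mult_left ray_continuous[OF slicewise_Om_sum[OF U] z])
    fix t :: real assume t: "t \<in> {0..1}"
    let ?y = "q + t *\<^sub>R (z - q)"
    have y: "?y \<in> B" by (rule ray_in_B[OF z t])
    have "(\<Sum>i\<in>UNIV. (z $ i - q $ i) * (\<Sum>c\<in>UNIV. Om i a c ?y * U c ?y)) =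
       (\<Sum>c\<in>UNIV. (\<Sum>i\<in>UNIV. (z $ i - q $ i) * Om i a c ?y) * U c ?y)"
      unfolding sum_distrib_left sum_distrib_right by (subst sum.swap) (simp add: mult.assoc)
    also have "norm \<dots> \<le> (\<Sum>c\<in>UNIV. norm (\<Sum>i\<in>UNIV. (z $ i - q $ i) * Om i a c ?y) * K)"
      by (rule sum_norm_le) (simp add: norm_mult mult_left_mono K[OF y])
    also have "\<dots> \<le> 1/2 * K"
      unfolding sum_distrib_right[symmetric] by (intro mult_right_mono small_ray z y K0)
    finally show "norm (\<Sum>i\<in>UNIV. (z $ i - q $ i) * (\<Sum>c\<in>UNIV. Om i a c ?y * U c ?y)) \<le> K / 2" by simp
  qed simp
  then show ?thesis unfolding transport_eq_integral[OF U z] by simp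
qed

primrec neumann :: "('k \<Rightarrow> complex) \<Rightarrow> nat \<Rightarrow> 'k \<Rightarrow> 'n cfun" where
  "neumann v 0 = (\<lambda>a z. v a)"
| "neumann v (Suc n) = transport (neumann v n)"

lemma slicewise_neumann: "slicewise (neumann v n a) B"
  by (induction n arbitrary: a) (auto intro!: slicewise_const open_B slicewise_transport)

text \<open>
  The Neumann series converges geometrically and uniformly on \<open>B\<close>, so that its sum is holomorphic on
  the same set on which the connection is given.
\<close>

lemma transport_fixpoint:
  "\<exists>U. (\<forall>a. slicewise (U a) B) \<and> (\<forall>a. \<forall>z\<in>B. U a z = v a + transport U a z)"
proof -
  define K where "K = (\<Sum>c\<in>UNIV. norm (v c))"
  have bound: "z \<in> B \<Longrightarrow> norm (neumann v n a z) \<le> K * (1/2) ^ n" for n a z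
  proof (induction n arbitrary: a z)
    case 0
    have "norm (v a) \<le> K" unfolding K_def by (rule member_le_sum) auto
    then show ?case by simp
  next
    case (Suc n)
    have "norm (transport (neumann v n) a z) \<le> K * (1/2) ^ n / 2"
      using Suc by (intro transport_bound slicewise_neumann) auto
    then show ?case by simp
  qed
  define S where "S N a z = (\<Sum>n<N. neumann v n a z)" for N a z
  define U where "U a z = (\<Sum>n. neumann v n a z)" for a z
  have lim: "uniform_limit B (\<lambda>N z. S N a z) (U a) sequentially" for a
    unfolding S_def U_def
    by (rule Weierstrass_m_test[where M="\<lambda>n. K * (1/2) ^ n"])
       (auto intro!: bound summable_mult summable_geometric)
  have S: "slicewise (S N a) B" for N a
    unfolding S_def by (intro slicewise_sum open_B slicewise_neumann)
  have U: "slicewise (U a) B" for a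
    by (rule slicewise_uniform_limit[OF S lim])
  have S_Suc: "S (Suc N) a z = v a + transport (S N) a z" if z: "z \<in> B" for N a z
  proof (induction N arbitrary: a)
    case 0
    show ?case by (simp add: S_def transport_def)
  next
    case (Suc N)
    have "transport (neumann v (Suc N)) a z = transport (\<lambda>c z. S (Suc (Suc N)) c z - S (Suc N) c z) a z"
      by (simp add: S_def)
    also have "\<dots> = transport (S (Suc (Suc N))) a z - transport (S (Suc N)) a z"
      by (rule transport_diff[OF S S z])
    finally have 1: "transport (neumann v (Suc N)) a z = transport (S (Suc (Suc N))) a z - transport (S (Suc N)) a z" .
    have "transport (neumann v N) a z = transport (\<lambda>c z. S (Suc N) c z - S N c z) a z"
      by (simp add: S_def)
    also have "\<dots> = transport (S (Suc N)) a z - transport (S N) a z"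
      by (rule transport_diff[OF S S z])
    finally have 2: "transport (neumann v N) a z = transport (S (Suc N)) a z - transport (S N) a z" .
    have "S (Suc (Suc N)) a z = S (Suc N) a z + transport (neumann v N) a z"
      by (simp add: S_def)
    then show ?case using Suc[of a] 2 by simp
  qed
  have "U a z = v a + transport U a z" if z: "z \<in> B" for a z
  proof (rule LIMSEQ_unique)
    have "(\<lambda>N. S N a z) \<longlonglongrightarrow> U a z"
      using tendsto_uniform_limitI[OF lim z] .
    then show "(\<lambda>N. S (Suc N) a z) \<longlonglongrightarrow> U a z" by (rule LIMSEQ_Suc)
    have "(\<lambda>N. transport (S N) a z) \<longlonglongrightarrow> transport U a z"
    proof (rule tendstoI)
      fix e :: real assume e: "e > 0"
      have "\<forall>\<^sub>F N in sequentially. \<forall>c. \<forall>y\<in>B. dist (S N c y) (U c y) < e"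
        using lim e unfolding uniform_limit_iff by (intro eventually_all_finite) blast
      then show "\<forall>\<^sub>F N in sequentially. dist (transport (S N) a z) (transport U a z) < e"
      proof (rule eventually_mono)
        fix N assume N: "\<forall>c. \<forall>y\<in>B. dist (S N c y) (U c y) < e"
        have "norm (transport (\<lambda>c z. S N c z - U c z) a z) \<le> e / 2"
          using N by (intro transport_bound slicewise_diff S U z) (simp add: dist_norm less_imp_le)
        then show "dist (transport (S N) a z) (transport U a z) < e"
          using e unfolding transport_diff[OF S U z] by (simp add: dist_norm)
      qed
    qed
    then show "(\<lambda>N. S (Suc N) a z) \<longlonglongrightarrow> v a + transport U a z"
      unfolding S_Suc[OF z] by (intro tendsto_add tendsto_const)
  qed
  with U show ?thesis by blast
qed

text \<open>
  The Frobenius theorem. Let \<open>V\<^sub>i = \<partial>\<^sub>i U - Om\<^sub>i U\<close>, with \<open>\<Sum>\<^sub>j (z - q)\<^sub>j V\<^sub>j = 0\<close> because the radial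
  equation holds. Flatness turns \<open>\<partial>\<^sub>i V\<^sub>j - \<partial>\<^sub>j V\<^sub>i\<close> into an expression that is linear in the \<open>V\<close>'s.
  Differentiating the radial equation then shows that \<open>t V\<^sub>i(q + t (z - q))\<close> satisfies a
  homogeneous linear differential equation in \<open>t\<close>; it is zero at \<open>t = 0\<close>, hence zero.
\<close>

lemma transport_fixpoint_solution:
  assumes flat: "\<And>i j a c z. z \<in> B \<Longrightarrow>
      pderiv_at i (Om j a c) z - pderiv_at j (Om i a c) z =
      (\<Sum>d\<in>UNIV. Om i a d z * Om j d c z) - (\<Sum>d\<in>UNIV. Om j a d z * Om i d c z)"
    and U: "\<And>a. slicewise (U a) B" and fp: "\<And>a z. z \<in> B \<Longrightarrow> U a z = v a + transport U a z"
  shows "pfaffian_solution Om B U"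
proof -
  define V where "V i a z = pderiv_at i (U a) z - (\<Sum>c\<in>UNIV. Om i a c z * U c z)" for i a z
  have V: "slicewise (V i a) B" for i a
    unfolding V_def by (intro slicewise_diff slicewise_pderiv U slicewise_Om_sum)
  have pU: "pderiv_at i (U a) z = V i a z + (\<Sum>c\<in>UNIV. Om i a c z * U c z)" for i a z
    by (simp add: V_def)
  have radial: "(\<Sum>j\<in>UNIV. (z $ j - q $ j) * V j a z) = 0" if z: "z \<in> B" for a z
  proof -
    have "pderiv_at j (U a) z = pderiv_at j (transport U a) z" for j
    proof -
      have "pderiv_at j (U a) z = pderiv_at j (\<lambda>z. v a + transport U a z) z"
        by (rule pderiv_at_cong, rule eventually_mono[OF eventually_nhds_in_open[OF open_B z]], rule fp)
      also have "\<dots> = pderiv_at j (\<lambda>z. v a) z + pderiv_at j (transport U a) z"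
        by (rule pderiv_add[OF slicewise_const[OF open_B] slicewise_transport[OF U] z])
      finally show ?thesis by (simp add: pderiv_const)
    qed
    then show ?thesis
      using transport_euler[OF U z, where a=a] by (simp add: V_def right_diff_distrib sum_subtractf)
  qed
  have leibniz: "pderiv_at i (\<lambda>z. \<Sum>j\<in>UNIV. (z $ j - q $ j) * V j a z) z =
      V i a z + (\<Sum>j\<in>UNIV. (z $ j - q $ j) * pderiv_at i (V j a) z)" if z: "z \<in> B" for i a z
  proof -
    have "pderiv_at i (\<lambda>z. \<Sum>j\<in>UNIV. (z $ j - q $ j) * V j a z) z =
       (\<Sum>j\<in>UNIV. pderiv_at i (\<lambda>z. (z $ j - q $ j) * V j a z) z)"
      by (intro pderiv_sum[of _ _ B] slicewise_mult slicewise_shift V z)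
    also have "\<dots> = (\<Sum>j\<in>UNIV. (if i = j then 1 else 0) * V j a z + (z $ j - q $ j) * pderiv_at i (V j a) z)"
      by (intro sum.cong refl) (simp only: pderiv_mult[OF slicewise_shift V z] pderiv_shift[OF z])
    also have "\<dots> = V i a z + (\<Sum>j\<in>UNIV. (z $ j - q $ j) * pderiv_at i (V j a) z)"
      by (simp add: sum.distrib if_distrib[of "\<lambda>x. x * _"] cong: if_cong)
    finally show ?thesis .
  qed
  have vanish: "pderiv_at i (\<lambda>z. \<Sum>j\<in>UNIV. (z $ j - q $ j) * V j a z) z = 0" if z: "z \<in> B" for i a z
  proof -
    have "pderiv_at i (\<lambda>z. \<Sum>j\<in>UNIV. (z $ j - q $ j) * V j a z) z = pderiv_at i (\<lambda>z. 0) z"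
      by (rule pderiv_at_cong, rule eventually_mono[OF eventually_nhds_in_open[OF open_B z]], rule radial)
    then show ?thesis by (simp add: pderiv_const)
  qed
  have d_radial: "(\<Sum>j\<in>UNIV. (z $ j - q $ j) * pderiv_at i (V j a) z) = - V i a z" if z: "z \<in> B" for i a z
    using leibniz[OF z, where i=i and a=a] vanish[OF z, where i=i and a=a] by (simp add: eq_neg_iff_add_eq_0 add.commute)
  have curl: "pderiv_at i (V j a) z - pderiv_at j (V i a) z =
      (\<Sum>c\<in>UNIV. Om i a c z * V j c z) - (\<Sum>c\<in>UNIV. Om j a c z * V i c z)" if z: "z \<in> B" for i j a z
  proof -
    have pV: "pderiv_at i (V j a) z = pderiv_at i (pderiv_at j (U a)) z -
      (\<Sum>c\<in>UNIV. pderiv_at i (Om j a c) z * U c z) - (\<Sum>c\<in>UNIV. Om j a c z * V i c z)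
      - (\<Sum>d\<in>UNIV. (\<Sum>c\<in>UNIV. Om j a c z * Om i c d z) * U d z)" for i j
    proof -
      have "pderiv_at i (V j a) z = pderiv_at i (pderiv_at j (U a)) z - pderiv_at i (\<lambda>z. \<Sum>c\<in>UNIV. Om j a c z * U c z) z"
        unfolding V_def by (intro pderiv_diff[of _ B] slicewise_pderiv U slicewise_Om_sum z)
      also have "pderiv_at i (\<lambda>z. \<Sum>c\<in>UNIV. Om j a c z * U c z) z = (\<Sum>c\<in>UNIV. pderiv_at i (\<lambda>z. Om j a c z * U c z) z)"
        by (intro pderiv_sum[of _ _ B] slicewise_mult holo_Om U z)
      also have "\<dots> = (\<Sum>c\<in>UNIV. pderiv_at i (Om j a c) z * U c z + Om j a c z * (V i c z + (\<Sum>d\<in>UNIV. Om i c d z * U d z)))"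
        by (intro sum.cong refl) (simp only: pderiv_mult[OF holo_Om U z] pU)
      also have "\<dots> = (\<Sum>c\<in>UNIV. pderiv_at i (Om j a c) z * U c z) + (\<Sum>c\<in>UNIV. Om j a c z * V i c z)
         + (\<Sum>c\<in>UNIV. \<Sum>d\<in>UNIV. Om j a c z * Om i c d z * U d z)"
        by (simp add: distrib_left sum.distrib sum_distrib_left mult.assoc)
      also have "(\<Sum>c\<in>UNIV. \<Sum>d\<in>UNIV. Om j a c z * Om i c d z * U d z) = (\<Sum>d\<in>UNIV. (\<Sum>c\<in>UNIV. Om j a c z * Om i c d z) * U d z)"
        by (subst sum.swap) (simp add: sum_distrib_right)
      finally show ?thesis by (simp add: algebra_simps)
    qed
    have "(\<Sum>c\<in>UNIV. pderiv_at i (Om j a c) z * U c z) - (\<Sum>c\<in>UNIV. pderiv_at j (Om i a c) z * U c z) =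
       (\<Sum>c\<in>UNIV. (pderiv_at i (Om j a c) z - pderiv_at j (Om i a c) z) * U c z)"
      by (simp add: left_diff_distrib sum_subtractf)
    also have "\<dots> = (\<Sum>c\<in>UNIV. (\<Sum>d\<in>UNIV. Om i a d z * Om j d c z) * U c z) - (\<Sum>c\<in>UNIV. (\<Sum>d\<in>UNIV. Om j a d z * Om i d c z) * U c z)"
      unfolding flat[OF z] by (simp add: left_diff_distrib sum_subtractf)
    finally have eq: "(\<Sum>c\<in>UNIV. pderiv_at i (Om j a c) z * U c z) - (\<Sum>c\<in>UNIV. pderiv_at j (Om i a c) z * U c z) = \<dots>" .
    have alg: "A - B = D - C \<Longrightarrow> (w - A - e - C) - (w - B - f - D) = f - e" for A B C D e f w :: complex
      by (simp add: algebra_simps)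
    show ?thesis
      unfolding pV pderiv_commute[OF U[of a] z, of i j] by (rule alg[OF eq])
  qed
  have euler_V: "(\<Sum>j\<in>UNIV. (z $ j - q $ j) * pderiv_at j (V i a) z) =
      (\<Sum>c\<in>UNIV. (\<Sum>j\<in>UNIV. (z $ j - q $ j) * Om j a c z) * V i c z) - V i a z" if z: "z \<in> B" for i a z
  proof -
    have "(\<Sum>j\<in>UNIV. (z $ j - q $ j) * (\<Sum>c\<in>UNIV. Om i a c z * V j c z)) =
       (\<Sum>c\<in>UNIV. Om i a c z * (\<Sum>j\<in>UNIV. (z $ j - q $ j) * V j c z))"
      unfolding sum_distrib_left by (subst sum.swap) (simp add: mult_ac)
    also have "\<dots> = 0" by (simp add: radial[OF z])
    finally have 0: "(\<Sum>j\<in>UNIV. (z $ j - q $ j) * (\<Sum>c\<in>UNIV. Om i a c z * V j c z)) = 0" .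
    have "(\<Sum>j\<in>UNIV. (z $ j - q $ j) * pderiv_at j (V i a) z) =
       (\<Sum>j\<in>UNIV. (z $ j - q $ j) * (pderiv_at i (V j a) z - (\<Sum>c\<in>UNIV. Om i a c z * V j c z) + (\<Sum>c\<in>UNIV. Om j a c z * V i c z)))"
    proof (intro sum.cong refl)
      fix j
      show "(z $ j - q $ j) * pderiv_at j (V i a) z = (z $ j - q $ j) *
        (pderiv_at i (V j a) z - (\<Sum>c\<in>UNIV. Om i a c z * V j c z) + (\<Sum>c\<in>UNIV. Om j a c z * V i c z))"
        using curl[where i=i and j=j and a=a, OF z] by (simp add: algebra_simps)
    qed
    also have "\<dots> = - V i a z + (\<Sum>j\<in>UNIV. (z $ j - q $ j) * (\<Sum>c\<in>UNIV. Om j a c z * V i c z))"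
      using 0 by (simp add: distrib_left right_diff_distrib sum.distrib sum_subtractf d_radial[OF z])
    also have "(\<Sum>j\<in>UNIV. (z $ j - q $ j) * (\<Sum>c\<in>UNIV. Om j a c z * V i c z)) =
       (\<Sum>c\<in>UNIV. (\<Sum>j\<in>UNIV. (z $ j - q $ j) * Om j a c z) * V i c z)"
      unfolding sum_distrib_left sum_distrib_right by (subst sum.swap) (simp add: mult.assoc)
    finally show ?thesis by simp
  qed
  have V0: "V i a z = 0" if z: "z \<in> B" for i a z
  proof -
    let ?y = "\<lambda>t. q + t *\<^sub>R (z - q)"
    have "(\<lambda>t. of_real t * V i a (?y t)) 1 = 0"
    proof (rule linear_ode_zero[where W="\<lambda>a t. of_real t * V i a (?y t)" and
          k="\<lambda>a c t. \<Sum>j\<in>UNIV. (z $ j - q $ j) * Om j a c (?y t)" and t=1])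
      fix a and t :: real assume t: "t \<in> {0..1}"
      have y: "?y t \<in> B" by (rule ray_in_B[OF z t])
      have "of_real t * (\<Sum>j\<in>UNIV. (z $ j - q $ j) * pderiv_at j (V i a) (?y t)) + V i a (?y t) =
        (\<Sum>j\<in>UNIV. (?y t $ j - q $ j) * pderiv_at j (V i a) (?y t)) + V i a (?y t)"
        by (simp add: sum_distrib_left mult.assoc scaleR_conv_of_real[where 'a=complex])
      also have "\<dots> = (\<Sum>c\<in>UNIV. (\<Sum>j\<in>UNIV. (?y t $ j - q $ j) * Om j a c (?y t)) * V i c (?y t))"
        using euler_V[OF y] by simp
      also have "\<dots> = (\<Sum>c\<in>UNIV. (\<Sum>j\<in>UNIV. (z $ j - q $ j) * Om j a c (?y t)) * (of_real t * V i c (?y t)))"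
        by (intro sum.cong refl)
           (simp add: sum_distrib_left sum_distrib_right mult_ac scaleR_conv_of_real[where 'a=complex])
      finally have eq: "of_real t * (\<Sum>j\<in>UNIV. (z $ j - q $ j) * pderiv_at j (V i a) (?y t)) + V i a (?y t) =
        (\<Sum>c\<in>UNIV. (\<Sum>j\<in>UNIV. (z $ j - q $ j) * Om j a c (?y t)) * (of_real t * V i c (?y t)))" .
      have "((\<lambda>t. of_real t * V i a (?y t)) has_vector_derivative
          of_real t * (\<Sum>j\<in>UNIV. (z $ j - q $ j) * pderiv_at j (V i a) (?y t)) + of_real 1 * V i a (?y t)) (at t within {0..1})"
        by (intro has_vector_derivative_mult[OF has_vector_derivative_of_real[OF DERIV_ident]
          ray_derivative[OF V y]])
      then show "((\<lambda>t. of_real t * V i a (?y t)) has_vector_derivative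
        (\<Sum>c\<in>UNIV. (\<Sum>j\<in>UNIV. (z $ j - q $ j) * Om j a c (?y t)) * (of_real t * V i c (?y t)))) (at t within {0..1})"
        unfolding eq[symmetric] by simp
      show "(\<Sum>c\<in>UNIV. norm (\<Sum>j\<in>UNIV. (z $ j - q $ j) * Om j a c (?y t))) \<le> 1/2"
        by (rule small_ray[OF z y])
    qed auto
    then show ?thesis by simp
  qed
  show ?thesis
    unfolding pfaffian_solution_def using U pU V0 by simp
qed

end

text \<open>
  The radius \<open>r\<close> works for all initial points \<open>q\<close> in the ball at once. This uniformity is what
  analytic continuation along paths needs.
\<close>

theorem pfaffian_local_theory:
  fixes Om :: "'n::finite \<Rightarrow> 'k::finite \<Rightarrow> 'k \<Rightarrow> 'n cfun"
  assumes hol: "\<And>i a c. slicewise (Om i a c) Y" and p: "p \<in> Y"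
    and flat: "\<And>i j a c z. z \<in> Y \<Longrightarrow>
      pderiv_at i (Om j a c) z - pderiv_at j (Om i a c) z =
      (\<Sum>d\<in>UNIV. Om i a d z * Om j d c z) - (\<Sum>d\<in>UNIV. Om j a d z * Om i d c z)"
  obtains r where "r > 0" "ball p r \<subseteq> Y"
    "\<And>q v. q \<in> ball p r \<Longrightarrow> \<exists>U. pfaffian_solution Om (ball p r) U \<and> (\<forall>a. U a q = v a)"
    "\<And>C q U Z a z. convex C \<Longrightarrow> open C \<Longrightarrow> C \<subseteq> ball p r \<Longrightarrow> q \<in> C \<Longrightarrow> pfaffian_solution Om C U \<Longrightarrow>
       (\<And>i a c y. a \<in> Z \<Longrightarrow> c \<notin> Z \<Longrightarrow> Om i a c y = 0) \<Longrightarrow> (\<And>a. a \<in> Z \<Longrightarrow> U a q = 0) \<Longrightarrow>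
       a \<in> Z \<Longrightarrow> z \<in> C \<Longrightarrow> U a z = 0"
proof -
  have "open Y" using hol slicewise_open by blast
  then obtain r0 where r0: "r0 > 0" "cball p r0 \<subseteq> Y" using p open_contains_cball by blast
  have "\<exists>M. \<forall>z\<in>cball p r0. norm (Om i a c z) \<le> M" for i a c
  proof -
    have "continuous_on (cball p r0) (Om i a c)"
      using hol[of i a c] r0 unfolding slicewise_def by (blast intro: continuous_on_subset)
    then have "compact (Om i a c ` cball p r0)"
      by (rule compact_continuous_image) simp
    from compact_imp_bounded[OF this] show ?thesis unfolding bounded_iff by auto
  qed
  then obtain M where M: "\<And>i a c z. z \<in> cball p r0 \<Longrightarrow> norm (Om i a c z) \<le> M i a c" by metis
  define K where "K = 1 + (\<Sum>a\<in>UNIV. \<Sum>c\<in>UNIV. \<Sum>i\<in>UNIV. \<bar>M i a c\<bar>)"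
  have K: "(\<Sum>c\<in>UNIV. \<Sum>i\<in>UNIV. \<bar>M i a c\<bar>) \<le> K" for a
  proof -
    have "(\<Sum>c\<in>UNIV. \<Sum>i\<in>UNIV. \<bar>M i a c\<bar>) \<le> (\<Sum>a\<in>UNIV. \<Sum>c\<in>UNIV. \<Sum>i\<in>UNIV. \<bar>M i a c\<bar>)"
      by (rule member_le_sum) (auto intro!: sum_nonneg)
    then show ?thesis by (simp add: K_def)
  qed
  have K1: "K \<ge> 1" unfolding K_def by (auto intro!: sum_nonneg)
  \<comment> \<open>two points of the ball differ by at most \<open>2 r\<close>, and \<open>2 r K \<le> 1/2\<close> is the required bound\<close>
  define r where "r = min r0 (1 / (4 * K))"
  have r: "r > 0" "r \<le> r0" "2 * r * K \<le> 1/2" using r0 K1 by (auto simp: r_def min_def field_simps)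
  have sub: "ball p r \<subseteq> cball p r0" using r by auto
  have "small_connection (ball p r) q Om" if q: "q \<in> ball p r" for q
  proof
    show "slicewise (Om i a c) (ball p r)" for i a c
      by (rule slicewise_subset[OF hol]) (use sub r0 in auto)
    fix z z' :: "complex ^ 'n" and a assume z: "z \<in> ball p r" "z' \<in> ball p r"
    have "norm (z - q) \<le> 2 * r"
      using dist_triangle_less_add[of z p r q r] z q by (simp add: dist_norm norm_minus_commute)
    then have zq: "norm (z $ i - q $ i) \<le> 2 * r" for i
      using Finite_Cartesian_Product.norm_nth_le[of "z - q" i] by simp
    have "(\<Sum>c\<in>UNIV. \<Sum>i\<in>UNIV. norm (z $ i - q $ i) * norm (Om i a c z')) \<le> (\<Sum>c\<in>UNIV. \<Sum>i\<in>UNIV. 2 * r * \<bar>M i a c\<bar>)"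
    proof (intro sum_mono mult_mono zq)
      show "norm (Om i a c z') \<le> \<bar>M i a c\<bar>" for i c
        using M[of z' i a c] z sub by fastforce
    qed (use r in auto)
    also have "\<dots> = 2 * r * (\<Sum>c\<in>UNIV. \<Sum>i\<in>UNIV. \<bar>M i a c\<bar>)"
      by (simp add: sum_distrib_left)
    also have "\<dots> \<le> 2 * r * K" using r K by (intro mult_left_mono) auto
    finally show "(\<Sum>c\<in>UNIV. \<Sum>i\<in>UNIV. norm (z $ i - q $ i) * norm (Om i a c z')) \<le> 1/2"
      using r by simp
  qed (use q in auto)
  note sc = this
  show ?thesis
  proof
    show "r > 0" by (rule r)
    show BY: "ball p r \<subseteq> Y" using sub r0 by blast
    fix q v assume q: "q \<in> ball p r"
    interpret small_connection "ball p r" q Om by (rule sc[OF q])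
    obtain U where "\<forall>a. slicewise (U a) (ball p r)" "\<forall>a. \<forall>z\<in>ball p r. U a z = v a + transport U a z"
      using transport_fixpoint[of v] by (elim exE conjE)
    then have U: "slicewise (U a) (ball p r)" "z \<in> ball p r \<Longrightarrow> U a z = v a + transport U a z" for a z
      by simp_all
    have "pfaffian_solution Om (ball p r) U"
      using BY by (intro transport_fixpoint_solution[OF flat U]) auto
    moreover have "U a q = v a" for a using U(2)[OF q, of a] by (simp add: transport_def)
    ultimately show "\<exists>U. pfaffian_solution Om (ball p r) U \<and> (\<forall>a. U a q = v a)" by blast
  next
    fix C q U Z a z
    assume C: "convex C" "open C" "C \<subseteq> ball p r" "q \<in> C" and U: "pfaffian_solution Om C U"
      "\<And>i a c y. a \<in> Z \<Longrightarrow> c \<notin> Z \<Longrightarrow> Om i a c y = 0" "\<And>a. a \<in> Z \<Longrightarrow> U a q = 0" "a \<in> Z" "z \<in> C"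
    interpret small_connection "ball p r" q Om using C by (intro sc) auto
    show "U a z = 0" by (rule solution_vanishes[OF C U])
  qed
qed

section \<open>Continuation along paths\<close>

lemma germ_eq_refl: "germ_eq p f f"
  by (simp add: germ_eq_def)

lemma germ_eq_sym: "germ_eq p f g \<Longrightarrow> germ_eq p g f"
  by (simp add: germ_eq_def eq_commute)

lemma germ_eq_trans: "germ_eq p f g \<Longrightarrow> germ_eq p g h \<Longrightarrow> germ_eq p f h"
  unfolding germ_eq_def by (erule (1) eventually_elim2) simp

lemma continuation_glue:
  fixes \<gamma> :: "real \<Rightarrow> complex ^ 'n::finite"
  assumes ab: "a < b" and bc: "b \<le> c"
    and F1: "\<And>t. t \<in> {a..b} \<Longrightarrow> \<forall>\<^sub>F s in at t within {a..b}. germ_eq (\<gamma> s) (F1 s) (F1 t)"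
    and F2: "\<And>t. t \<in> {b..c} \<Longrightarrow> \<forall>\<^sub>F s in at t within {b..c}. germ_eq (\<gamma> s) (F2 s) (F2 t)"
    and eq: "germ_eq (\<gamma> b) (F1 b) (F2 b)"
    and cont: "(\<gamma> \<longlongrightarrow> \<gamma> b) (at b within {a..b})"
    and t: "t \<in> {a..c}"
  defines "F \<equiv> \<lambda>t. if t < b then F1 t else F2 t"
  shows "\<forall>\<^sub>F s in at t within {a..c}. germ_eq (\<gamma> s) (F s) (F t)"
proof (cases "t = b")
  case False
  show ?thesis
  proof (cases "t < b")
    case True
    have "\<forall>\<^sub>F s in at t within {a..b}. germ_eq (\<gamma> s) (F1 s) (F1 t)"
      using t True by (intro F1) auto
    then obtain d where d: "d > 0" "\<And>s. s \<in> {a..b} \<Longrightarrow> s \<noteq> t \<Longrightarrow> dist s t < d \<Longrightarrow> germ_eq (\<gamma> s) (F1 s) (F1 t)"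
      unfolding eventually_at by auto
    show ?thesis unfolding eventually_at
    proof (intro exI[of _ "min d (b - t)"] conjI ballI impI)
      fix s assume s: "s \<in> {a..c}" "s \<noteq> t \<and> dist s t < min d (b - t)"
      then have "s < b" by (auto simp: dist_real_def)
      then show "germ_eq (\<gamma> s) (F s) (F t)" using d(2)[of s] s True by (auto simp: F_def)
    qed (use d True in auto)
  next
    case nlt: False
    with False have tb: "b < t" by simp
    have "\<forall>\<^sub>F s in at t within {b..c}. germ_eq (\<gamma> s) (F2 s) (F2 t)"
      using t tb by (intro F2) auto
    then obtain d where d: "d > 0" "\<And>s. s \<in> {b..c} \<Longrightarrow> s \<noteq> t \<Longrightarrow> dist s t < d \<Longrightarrow> germ_eq (\<gamma> s) (F2 s) (F2 t)"
      unfolding eventually_at by auto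
    show ?thesis unfolding eventually_at
    proof (intro exI[of _ "min d (t - b)"] conjI ballI impI)
      fix s assume s: "s \<in> {a..c}" "s \<noteq> t \<and> dist s t < min d (t - b)"
      then have "s > b" by (auto simp: dist_real_def)
      then show "germ_eq (\<gamma> s) (F s) (F t)" using d(2)[of s] s tb by (auto simp: F_def)
    qed (use d tb in auto)
  qed
next
  case True
  have "\<forall>\<^sub>F s in at b within {a..b}. germ_eq (\<gamma> s) (F1 s) (F1 b)"
    using ab by (intro F1) auto
  moreover have "\<forall>\<^sub>F s in at b within {a..b}. germ_eq (\<gamma> s) (F1 b) (F2 b)"
  proof -
    have "\<forall>\<^sub>F y in nhds (\<gamma> b). germ_eq y (F1 b) (F2 b)"
      using eq unfolding germ_eq_def by (simp add: eventually_eventually)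
    with cont show ?thesis unfolding filterlim_iff by blast
  qed
  ultimately have "\<forall>\<^sub>F s in at b within {a..b}. germ_eq (\<gamma> s) (F1 s) (F2 b)"
    by eventually_elim (rule germ_eq_trans)
  then obtain d1 where d1: "d1 > 0" "\<And>s. s \<in> {a..b} \<Longrightarrow> s \<noteq> b \<Longrightarrow> dist s b < d1 \<Longrightarrow> germ_eq (\<gamma> s) (F1 s) (F2 b)"
    unfolding eventually_at by auto
  have "\<forall>\<^sub>F s in at b within {b..c}. germ_eq (\<gamma> s) (F2 s) (F2 b)"
    using bc by (intro F2) auto
  then obtain d2 where d2: "d2 > 0" "\<And>s. s \<in> {b..c} \<Longrightarrow> s \<noteq> b \<Longrightarrow> dist s b < d2 \<Longrightarrow> germ_eq (\<gamma> s) (F2 s) (F2 b)"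
    unfolding eventually_at by auto
  show ?thesis unfolding eventually_at True
  proof (intro exI[of _ "min d1 d2"] conjI ballI impI)
    fix s assume "s \<in> {a..c}" "s \<noteq> b \<and> dist s b < min d1 d2"
    then show "germ_eq (\<gamma> s) (F s) (F b)" using d1(2)[of s] d2(2)[of s] by (auto simp: F_def)
  qed (use d1 d2 in auto)
qed

text \<open>
  Bisection of the parameter interval. The property that is passed on is that every germ of \<open>V\<close> at
  the left end has a continuation that ends in \<open>V\<close>, and this is what can be composed.
\<close>

lemma continuation_along_paths:
  assumes path: "path \<gamma>" "path_image \<gamma> \<subseteq> X"
    and loc: "\<And>p. p \<in> X \<Longrightarrow> \<exists>e>0. \<forall>q\<in>ball p e. \<forall>f\<in>V q. \<exists>G. germ_eq q f G \<and> (\<forall>z\<in>ball p e. holo_at G z \<and> G \<in> V z)"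
    and f: "f \<in> V (pathstart \<gamma>)"
  shows "\<exists>g\<in>V (pathfinish \<gamma>). continuation_along \<gamma> f g"
proof -
  define P where "P a b \<longleftrightarrow> (0 \<le> a \<longrightarrow> a \<le> b \<longrightarrow> b \<le> 1 \<longrightarrow> (\<forall>f\<in>V (\<gamma> a). \<exists>F. germ_eq (\<gamma> a) f (F a) \<and> F b \<in> V (\<gamma> b) \<and>
     (\<forall>t\<in>{a..b}. holo_at (F t) (\<gamma> t) \<and> (\<forall>\<^sub>F s in at t within {a..b}. germ_eq (\<gamma> s) (F s) (F t)))))" for a b
  have cont: "continuous_on {0..1} \<gamma>" using path by (simp add: path_def)
  have "P 0 1"
  proof (rule Bolzano[of 0 1 P])
    fix a b c assume trans: "P a b" "P b c" "a \<le> b" "b \<le> c"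
    show "P a c" unfolding P_def
    proof (intro impI ballI)
      fix f assume 0: "0 \<le> a" "a \<le> c" "c \<le> 1" and f: "f \<in> V (\<gamma> a)"
      have le: "0 \<le> b" "b \<le> 1" using 0 trans by auto
      from trans(1)[unfolded P_def, THEN mp, OF 0(1), THEN mp, OF trans(3), THEN mp, OF le(2), THEN bspec, OF f]
      obtain F1 where "germ_eq (\<gamma> a) f (F1 a) \<and> F1 b \<in> V (\<gamma> b) \<and>
         (\<forall>t\<in>{a..b}. holo_at (F1 t) (\<gamma> t) \<and> (\<forall>\<^sub>F s in at t within {a..b}. germ_eq (\<gamma> s) (F1 s) (F1 t)))" ..
      then have F1: "germ_eq (\<gamma> a) f (F1 a)" "F1 b \<in> V (\<gamma> b)"
        "\<And>t. t \<in> {a..b} \<Longrightarrow> holo_at (F1 t) (\<gamma> t)"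
        "\<And>t. t \<in> {a..b} \<Longrightarrow> \<forall>\<^sub>F s in at t within {a..b}. germ_eq (\<gamma> s) (F1 s) (F1 t)"
        by simp_all
      from trans(2)[unfolded P_def, THEN mp, OF le(1), THEN mp, OF trans(4), THEN mp, OF 0(3), THEN bspec, OF F1(2)]
      obtain F2 where "germ_eq (\<gamma> b) (F1 b) (F2 b) \<and> F2 c \<in> V (\<gamma> c) \<and>
         (\<forall>t\<in>{b..c}. holo_at (F2 t) (\<gamma> t) \<and> (\<forall>\<^sub>F s in at t within {b..c}. germ_eq (\<gamma> s) (F2 s) (F2 t)))" ..
      then have F2: "germ_eq (\<gamma> b) (F1 b) (F2 b)" "F2 c \<in> V (\<gamma> c)"
        "\<And>t. t \<in> {b..c} \<Longrightarrow> holo_at (F2 t) (\<gamma> t)"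
        "\<And>t. t \<in> {b..c} \<Longrightarrow> \<forall>\<^sub>F s in at t within {b..c}. germ_eq (\<gamma> s) (F2 s) (F2 t)"
        by simp_all
      show "\<exists>F. germ_eq (\<gamma> a) f (F a) \<and> F c \<in> V (\<gamma> c) \<and>
         (\<forall>t\<in>{a..c}. holo_at (F t) (\<gamma> t) \<and> (\<forall>\<^sub>F s in at t within {a..c}. germ_eq (\<gamma> s) (F s) (F t)))"
      proof (cases "a < b")
        case True
        have "(\<gamma> \<longlongrightarrow> \<gamma> b) (at b within {a..b})"
          using cont continuous_on_subset[of "{0..1}" \<gamma> "{a..b}"] 0 trans True
          by (auto simp: continuous_on_def)
        note glue = continuation_glue[where \<gamma>=\<gamma>, OF True trans(4) F1(4) F2(4) F2(1) this]
        show ?thesis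
        proof (intro exI[of _ "\<lambda>t. if t < b then F1 t else F2 t"] conjI ballI)
          show "\<forall>\<^sub>F s in at t within {a..c}. germ_eq (\<gamma> s) (if s < b then F1 s else F2 s) (if t < b then F1 t else F2 t)"
            if "t \<in> {a..c}" for t using glue[OF _ _ that] by simp
        qed (use True trans F1 F2 in auto)
      next
        case False
        then have "b = a" using trans by simp
        show ?thesis
        proof (intro exI[of _ F2] conjI ballI)
          show "germ_eq (\<gamma> a) f (F2 a)"
            using F1(1) F2(1) unfolding \<open>b = a\<close> by (rule germ_eq_trans)
        qed (use F2 in \<open>auto simp: \<open>b = a\<close>\<close>)
      qed
    qed
  next
    fix x :: real assume local: "0 \<le> x" "x \<le> 1"
    then have "\<gamma> x \<in> X" using path by (auto simp: path_image_def)
    from loc[OF this] obtain e where e: "e > 0"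
      "\<And>q f. q \<in> ball (\<gamma> x) e \<Longrightarrow> f \<in> V q \<Longrightarrow> \<exists>G. germ_eq q f G \<and> (\<forall>z\<in>ball (\<gamma> x) e. holo_at G z \<and> G \<in> V z)"
      by auto
    have "x \<in> {0..1}" using local by simp
    from cont[unfolded continuous_on_iff, THEN bspec, OF this, THEN spec, THEN mp, OF e(1)]
    obtain d where d: "d > 0" "\<And>t. t \<in> {0..1} \<Longrightarrow> dist t x < d \<Longrightarrow> dist (\<gamma> t) (\<gamma> x) < e"
      by auto
    show "\<exists>d>0. \<forall>a b. a \<le> x \<and> x \<le> b \<and> b - a < d \<longrightarrow> P a b"
    proof (intro exI[of _ d] conjI allI impI)
      show "d > 0" by (rule d)
      fix a b assume ab: "a \<le> x \<and> x \<le> b \<and> b - a < d"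
      show "P a b" unfolding P_def
      proof (intro impI ballI)
        fix f assume 0: "0 \<le> a" "a \<le> b" "b \<le> 1" and f: "f \<in> V (\<gamma> a)"
        have ball: "\<gamma> t \<in> ball (\<gamma> x) e" if "t \<in> {a..b}" for t
          using d(2)[of t] that ab 0 by (auto simp: dist_commute dist_real_def)
        obtain G where G: "germ_eq (\<gamma> a) f G" "\<And>z. z \<in> ball (\<gamma> x) e \<Longrightarrow> holo_at G z \<and> G \<in> V z"
          using e(2)[OF ball f] 0 by auto
        show "\<exists>F. germ_eq (\<gamma> a) f (F a) \<and> F b \<in> V (\<gamma> b) \<and>
           (\<forall>t\<in>{a..b}. holo_at (F t) (\<gamma> t) \<and> (\<forall>\<^sub>F s in at t within {a..b}. germ_eq (\<gamma> s) (F s) (F t)))"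
        proof (intro exI[of _ "\<lambda>_. G"] conjI ballI)
          show "G \<in> V (\<gamma> b)" using G(2)[OF ball[of b]] 0 by simp
          show "holo_at G (\<gamma> t)" if "t \<in> {a..b}" for t using G(2)[OF ball[OF that]] by simp
        qed (use G in \<open>simp_all add: germ_eq_refl\<close>)
      qed
    qed
  qed simp
  from this[unfolded P_def] f
  have "\<exists>F. germ_eq (\<gamma> 0) f (F 0) \<and> F 1 \<in> V (\<gamma> 1) \<and>
    (\<forall>t\<in>{0..1}. holo_at (F t) (\<gamma> t) \<and> (\<forall>\<^sub>F s in at t within {0..1}. germ_eq (\<gamma> s) (F s) (F t)))"
    by (simp add: pathstart_def)
  then obtain F where "germ_eq (\<gamma> 0) f (F 0) \<and> F 1 \<in> V (\<gamma> 1) \<and>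
    (\<forall>t\<in>{0..1}. holo_at (F t) (\<gamma> t) \<and> (\<forall>\<^sub>F s in at t within {0..1}. germ_eq (\<gamma> s) (F s) (F t)))" ..
  then have F: "germ_eq (\<gamma> 0) f (F 0)" "F 1 \<in> V (\<gamma> 1)"
    "\<forall>t\<in>{0..1}. holo_at (F t) (\<gamma> t) \<and> (\<forall>\<^sub>F s in at t within {0..1}. germ_eq (\<gamma> s) (F s) (F t))"
    by simp_all
  show ?thesis
  proof (rule bexI[of _ "F 1"])
    show "continuation_along \<gamma> f (F 1)"
      unfolding continuation_along_def using F germ_eq_refl[of "\<gamma> 1" "F 1"] by (intro exI[of _ F] conjI)
    show "F 1 \<in> V (pathfinish \<gamma>)" using F by (simp add: pathfinish_def)
  qed
qed

section \<open>A flat connection of rank five with logarithmic poles\<close>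

text \<open>
  Coordinates of the bundle of rank five: \<open>Val\<close> stands for \<open>u\<close>, \<open>Der k\<close> for
  \<open>(1 - y\<^sub>k) \<partial>\<^sub>k u\<close>, and \<open>Aux\<close> for \<open>(1 - y\<^sub>1) (1 - y\<^sub>3) g\<close>. The factors are chosen so that the
  connection matrices become logarithmic with constant residues.
\<close>

datatype jet = Val | Der 3 | Aux
text \<open>
  The divisors \<open>y\<^sub>i = 0\<close>, \<open>y\<^sub>i = 1\<close> and \<open>y\<^sub>i = y\<^sub>j\<close> on which the coefficients in the direction
  \<open>i\<close> have poles.
\<close>

datatype pole = Zero | One | Pt 3

lemma UNIV_jet: "UNIV = {Val, Der 1, Der 2, Der 3, Aux}"
proof (rule UNIV_eq_I)
  show "a \<in> {Val, Der 1, Der 2, Der 3, Aux}" for a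
    using exhaust_3 by (cases a) auto
qed

instance jet :: finite
  by standard (simp add: UNIV_jet)

lemma sum_jet: "sum f (UNIV :: jet set) = f Val + f (Der 1) + f (Der 2) + f (Der 3) + f Aux"
  by (simp add: UNIV_jet add_ac)

lemma forall_jet: "(\<forall>a. P a) \<longleftrightarrow> P Val \<and> P (Der 1) \<and> P (Der 2) \<and> P (Der 3) \<and> P Aux"
proof -
  have "(\<forall>a. P a) \<longleftrightarrow> (\<forall>a\<in>UNIV. P a)" by simp
  then show ?thesis unfolding UNIV_jet by simp
qed

lemma forall_pole: "(\<forall>a. P a) \<longleftrightarrow> P Zero \<and> P One \<and> P (Pt 1) \<and> P (Pt 2) \<and> P (Pt 3)"
proof -
  have "(\<forall>a. P a) \<longleftrightarrow> P Zero \<and> P One \<and> (\<forall>j. P (Pt j))"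
    by (metis pole.exhaust)
  then show ?thesis by (simp add: forall_3)
qed

definition residue_aux :: "3 \<Rightarrow> pole \<Rightarrow> 3 \<Rightarrow> complex" where
  "residue_aux i m k = (case m of
      Zero \<Rightarrow> (if k = i then (if i = 1 then 1 else if i = 3 then -1 else 0) else 0)
    | One \<Rightarrow> (if k = 2 then (if i = 1 then -1 else if i = 3 then 1 else 0) else 0)
    | Pt j \<Rightarrow> (if i = 1 \<and> j = 2 \<or> i = 2 \<and> j = 1 then (if k = 1 then -1 else if k = 2 then 1 else 0)
       else if i = 2 \<and> j = 3 \<or> i = 3 \<and> j = 2 then (if k = 2 then -1 else if k = 3 then 1 else 0) else 0))"

definition residue_der :: "complex \<Rightarrow> complex ^ 3 \<Rightarrow> 3 \<Rightarrow> pole \<Rightarrow> 3 \<Rightarrow> 3 \<Rightarrow> complex" where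
  "residue_der A b i m k l = (case m of
      Zero \<Rightarrow> (if k = i then (if l = i then b $ 2 - A else 0) - b $ i else 0)
    | One \<Rightarrow> (if l = i then (if k = i then b $ 1 + b $ 3 else 0) - b $ k else 0)
    | Pt j \<Rightarrow> (if k = i then (if l = i then - b $ j else if l = j then b $ i else 0)
       else if k = j then (if l = j then - b $ i else if l = i then b $ j else 0) else 0))"

definition residue_aux_aux :: "complex \<Rightarrow> complex ^ 3 \<Rightarrow> 3 \<Rightarrow> pole \<Rightarrow> complex" where
  "residue_aux_aux A b i m = (case m of
      Zero \<Rightarrow> (if i = 2 then - A else 0)
    | One \<Rightarrow> (if i = 1 then b $ 3 else if i = 3 then b $ 1 else 0)
    | Pt j \<Rightarrow> (if i = 1 \<and> j = 3 \<or> i = 3 \<and> j = 1 then - (b $ 1 + b $ 3) else 0))"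

fun pole_residue :: "complex \<Rightarrow> complex ^ 3 \<Rightarrow> 3 \<Rightarrow> pole \<Rightarrow> jet \<Rightarrow> jet \<Rightarrow> complex" where
  "pole_residue A b i m Val (Der l) = (if m = One \<and> l = i then -1 else 0)"
| "pole_residue A b i m (Der k) Val = (if m = Zero \<and> k = i then A * b $ i else 0)"
| "pole_residue A b i m (Der k) (Der l) = residue_der A b i m k l"
| "pole_residue A b i m (Der k) Aux = residue_aux i m k"
| "pole_residue A b i m Aux Aux = residue_aux_aux A b i m"
| "pole_residue A b i m Val Val = 0"
| "pole_residue A b i m Val Aux = 0"
| "pole_residue A b i m Aux Val = 0"
| "pole_residue A b i m Aux (Der l) = 0"

definition comm :: "('k::finite \<Rightarrow> 'k \<Rightarrow> complex) \<Rightarrow> ('k \<Rightarrow> 'k \<Rightarrow> complex) \<Rightarrow> 'k \<Rightarrow> 'k \<Rightarrow> complex" where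
  "comm X Y a c = (\<Sum>d\<in>UNIV. X a d * Y d c) - (\<Sum>d\<in>UNIV. Y a d * X d c)"

lemma residue_sym: "i \<noteq> j \<Longrightarrow> pole_residue A b i (Pt j) a c = pole_residue A b j (Pt i) a c"
  by (cases a; cases c) (auto simp: residue_der_def residue_aux_def residue_aux_aux_def)

text \<open>
  These relations and those of \<open>residue_braid_all\<close> are the infinitesimal braid relations for the five
  points \<open>0, 1, y\<^sub>1, y\<^sub>2, y\<^sub>3\<close>. They are identities between polynomials in the parameters and are
  checked entry by entry.
\<close>

lemma residue_commute_all:
  "\<forall>i j. i \<noteq> j \<longrightarrow> (\<forall>m n. m \<noteq> n \<longrightarrow> m \<notin> {Pt i, Pt j} \<longrightarrow> n \<notin> {Pt i, Pt j} \<longrightarrow>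
     (\<forall>a c. comm (pole_residue A b i m) (pole_residue A b j n) a c = 0))"
  unfolding forall_3 forall_pole
  by (simp add: forall_jet comm_def sum_jet residue_der_def residue_aux_def residue_aux_aux_def algebra_simps)

lemma residue_braid_all:
  "\<forall>i j. i \<noteq> j \<longrightarrow> (\<forall>m. m \<notin> {Pt i, Pt j} \<longrightarrow>
     (\<forall>a c. comm (pole_residue A b i m) (pole_residue A b j m) a c + comm (pole_residue A b i (Pt j)) (pole_residue A b j m) a c = 0))"
  unfolding forall_3 forall_pole
  by (simp add: forall_jet comm_def sum_jet residue_der_def residue_aux_def residue_aux_aux_def algebra_simps)

definition conn :: "complex \<Rightarrow> complex ^ 3 \<Rightarrow> 3 \<Rightarrow> jet \<Rightarrow> jet \<Rightarrow> 3 cfun" where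
  "conn A b i a c y = pole_residue A b i Zero a c / y $ i + pole_residue A b i One a c / (y $ i - 1) +
     (\<Sum>j\<in>UNIV - {i}. pole_residue A b i (Pt j) a c / (y $ i - y $ j))"

lemma open_Y3: "open Y3"
proof -
  have "Y3 = {y. y $ 1 \<noteq> 0 \<and> y $ 2 \<noteq> 0 \<and> y $ 3 \<noteq> 0 \<and> y $ 1 \<noteq> 1 \<and> y $ 2 \<noteq> 1 \<and> y $ 3 \<noteq> 1 \<and>
      y $ 1 \<noteq> y $ 2 \<and> y $ 1 \<noteq> y $ 3 \<and> y $ 2 \<noteq> y $ 3}"
    by (auto simp: Y3_def forall_3)
  also have "open \<dots>"
    by (intro open_Collect_conj open_Collect_neq continuous_on_component continuous_on_id continuous_on_const)
  finally show ?thesis .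
qed

lemma Y3_D:
  assumes "y \<in> Y3"
  shows "y $ 1 \<noteq> 0" "y $ 2 \<noteq> 0" "y $ 3 \<noteq> 0" "y $ 1 \<noteq> 1" "y $ 2 \<noteq> 1" "y $ 3 \<noteq> 1"
    "y $ 1 \<noteq> y $ 2" "y $ 1 \<noteq> y $ 3" "y $ 2 \<noteq> y $ 3"
  using assms by (auto simp: Y3_def)

lemma slicewise_conn: "slicewise (conn A b i a c) Y3"
  unfolding conn_def[abs_def]
  by (intro slicewise_add slicewise_sum slicewise_divide slicewise_const slicewise_diff slicewise_coord open_Y3)
     (auto simp: Y3_def)

lemma pderiv_conn:
  assumes z: "z \<in> Y3" and ij: "i \<noteq> j"
  shows "pderiv_at i (conn A b j a c) z = pole_residue A b j (Pt i) a c / (z $ j - z $ i)\<^sup>2"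
proof (rule pderiv_atI)
  define K where "K = pole_residue A b j Zero a c / z $ j + pole_residue A b j One a c / (z $ j - 1) +
     (\<Sum>k\<in>UNIV - {j} - {i}. pole_residue A b j (Pt k) a c / (z $ j - z $ k))"
  have "conn A b j a c (z + axis i t) = K + pole_residue A b j (Pt i) a c / (z $ j - z $ i - t)" for t
  proof -
    have "(\<Sum>k\<in>UNIV - {j}. pole_residue A b j (Pt k) a c / ((z + axis i t) $ j - (z + axis i t) $ k)) =
       pole_residue A b j (Pt i) a c / ((z + axis i t) $ j - (z + axis i t) $ i) +
       (\<Sum>k\<in>UNIV - {j} - {i}. pole_residue A b j (Pt k) a c / ((z + axis i t) $ j - (z + axis i t) $ k))"
      using ij by (intro sum.remove) auto
    also have "(\<Sum>k\<in>UNIV - {j} - {i}. pole_residue A b j (Pt k) a c / ((z + axis i t) $ j - (z + axis i t) $ k)) =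
       (\<Sum>k\<in>UNIV - {j} - {i}. pole_residue A b j (Pt k) a c / (z $ j - z $ k))"
      using ij by (intro sum.cong) (auto simp: axis_def)
    finally show ?thesis using ij by (simp add: conn_def K_def axis_def diff_diff_eq)
  qed
  moreover have "((\<lambda>t. K + pole_residue A b j (Pt i) a c / (z $ j - z $ i - t)) has_field_derivative
      pole_residue A b j (Pt i) a c / (z $ j - z $ i)\<^sup>2) (at 0)"
    using z ij by (auto intro!: derivative_eq_intros simp: Y3_def power2_eq_square)
  ultimately show "((\<lambda>t. conn A b j a c (z + axis i t)) has_field_derivative
      pole_residue A b j (Pt i) a c / (z $ j - z $ i)\<^sup>2) (at 0)" by simp
qed

lemma conn_closed:
  assumes z: "z \<in> Y3"
  shows "pderiv_at i (conn A b j a c) z = pderiv_at j (conn A b i a c) z"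
proof (cases "i = j")
  case False
  then show ?thesis
    using residue_sym[OF False, of A b a c]
    by (simp add: pderiv_conn[OF z] power2_commute[of "z $ j"])
qed simp

lemma comm_add_left: "comm (\<lambda>a c. X a c + X' a c) Y a c = comm X Y a c + comm X' Y a c"
  by (simp add: comm_def distrib_left distrib_right sum.distrib)

lemma comm_add_right: "comm X (\<lambda>a c. Y a c + Y' a c) a c = comm X Y a c + comm X Y' a c"
  by (simp add: comm_def distrib_left distrib_right sum.distrib)

lemma comm_scale_left: "comm (\<lambda>a c. s * X a c) Y a c = s * comm X Y a c"
  by (simp add: comm_def right_diff_distrib sum_distrib_left mult_ac)

lemma comm_scale_right: "comm X (\<lambda>a c. s * Y a c) a c = s * comm X Y a c"
  by (simp add: comm_def right_diff_distrib sum_distrib_left mult_ac)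

lemma comm_self: "comm X X a c = 0"
  by (simp add: comm_def)

lemma comm_swap: "comm X Y a c = - comm Y X a c"
  by (simp add: comm_def)

text \<open>
  The only relation between the products of the functions \<open>1 / (y\<^sub>i - z)\<close> that enters the flatness of
  a logarithmic connection of this type.
\<close>

lemma arnold_relation:
  fixes s t z :: "'a::field"
  assumes "s \<noteq> t" "s \<noteq> z" "t \<noteq> z"
  shows "(1 / (s - z)) * (1 / (t - z)) = (1 / (s - t)) * (1 / (t - z)) - (1 / (s - t)) * (1 / (s - z))"
proof -
  have "s - t \<noteq> 0" "s - z \<noteq> 0" "t - z \<noteq> 0" using assms by auto
  then show ?thesis by (simp add: divide_simps)
qed

lemma Diff_3: "UNIV - {1::3} = {2, 3}" "UNIV - {2::3} = {1, 3}" "UNIV - {3::3} = {1, 2}"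
  unfolding UNIV_3 by (simp_all add: insert_Diff_if)

lemma ex_3: "(\<exists>i::3. P i) \<longleftrightarrow> P 1 \<or> P 2 \<or> P 3"
  using exhaust_3 by metis

text \<open>
  In the commutator of the matrices in the directions \<open>i\<close> and \<open>j\<close> the products of poles at different
  points drop out by \<open>residue_commute_all\<close>. For each of the points \<open>0\<close>, \<open>1\<close>, \<open>y\<^sub>k\<close> the braid relations
  collect the rest into one commutator times the Arnold relation.
\<close>

lemma conn_commute:
  assumes z: "z \<in> Y3"
  shows "comm (\<lambda>a c. conn A b i a c z) (\<lambda>a c. conn A b j a c z) a c = 0"
proof (cases "i = j")
  case True
  then show ?thesis by (simp add: comm_self)
next
  case ij: False
  have "\<exists>k. k \<noteq> i \<and> k \<noteq> j \<and> UNIV - {i} = {j, k} \<and> UNIV - {j} = {i, k}"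
  proof -
    have "i = 1 \<or> i = 2 \<or> i = 3" "j = 1 \<or> j = 2 \<or> j = 3" using exhaust_3 by auto
    then show ?thesis
      using ij by (elim disjE) (simp_all add: ex_3 Diff_3 doubleton_eq_iff)
  qed
  then obtain k where k: "k \<noteq> i" "k \<noteq> j" "UNIV - {i} = {j, k}" "UNIV - {j} = {i, k}" by blast
  define X where "X = pole_residue A b i"
  define Y where "Y = pole_residue A b j"
  define D where "D = X (Pt j)"
  have YD: "Y (Pt i) = D"
    using residue_sym[OF ij, of A b] by (simp add: X_def Y_def D_def fun_eq_iff)
  define \<delta> where "\<delta> = 1 / (z $ i - z $ j)"
  define \<alpha>0 where "\<alpha>0 = 1 / (z $ i - 0)"
  define \<alpha>1 where "\<alpha>1 = 1 / (z $ i - 1)"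
  define \<alpha>k where "\<alpha>k = 1 / (z $ i - z $ k)"
  define \<beta>0 where "\<beta>0 = 1 / (z $ j - 0)"
  define \<beta>1 where "\<beta>1 = 1 / (z $ j - 1)"
  define \<beta>k where "\<beta>k = 1 / (z $ j - z $ k)"
  have neq: "z $ i \<noteq> z $ j" "z $ i \<noteq> z $ k" "z $ j \<noteq> z $ k" "z $ i \<noteq> 0" "z $ j \<noteq> 0" "z $ i \<noteq> 1" "z $ j \<noteq> 1"
    using z ij k by (auto simp: Y3_def)
  have arnold: "\<alpha>0 * \<beta>0 = \<delta> * \<beta>0 - \<delta> * \<alpha>0" "\<alpha>1 * \<beta>1 = \<delta> * \<beta>1 - \<delta> * \<alpha>1" "\<alpha>k * \<beta>k = \<delta> * \<beta>k - \<delta> * \<alpha>k"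
    unfolding \<alpha>0_def \<alpha>1_def \<alpha>k_def \<beta>0_def \<beta>1_def \<beta>k_def \<delta>_def
    by (rule arnold_relation[OF neq(1)]; use neq in simp)+
  have ci: "(\<lambda>a c. conn A b i a c z) = (\<lambda>a c. \<alpha>0 * X Zero a c + \<alpha>1 * X One a c + \<alpha>k * X (Pt k) a c + \<delta> * D a c)"
    using k by (simp add: fun_eq_iff conn_def X_def D_def \<alpha>0_def \<alpha>1_def \<alpha>k_def \<delta>_def)
  have \<delta>': "1 / (z $ j - z $ i) = - \<delta>"
    using minus_divide_right[of 1 "z $ i - z $ j"] by (simp add: \<delta>_def)
  have cj: "(\<lambda>a c. conn A b j a c z) = (\<lambda>a c. \<beta>0 * Y Zero a c + \<beta>1 * Y One a c + \<beta>k * Y (Pt k) a c + (- \<delta>) * D a c)"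
    using k unfolding \<delta>'[symmetric] YD[symmetric]
    by (simp add: fun_eq_iff conn_def Y_def \<beta>0_def \<beta>1_def \<beta>k_def)
  have c0: "comm (X m) (Y n) a c = 0" if "m \<noteq> n" "m \<in> {Zero, One, Pt k}" "n \<in> {Zero, One, Pt k}" for m n
    unfolding X_def Y_def using that k by (intro residue_commute_all[rule_format, OF ij that(1)]) auto
  have cD: "comm (X m) (Y m) a c + comm D (Y m) a c = 0" if "m \<in> {Zero, One, Pt k}" for m
    unfolding X_def Y_def D_def using that k by (intro residue_braid_all[rule_format, OF ij]) auto
  have cD': "comm (X m) (Y m) a c + comm (X m) D a c = 0" if "m \<in> {Zero, One, Pt k}" for m
  proof -
    have "comm (Y m) (X m) a c + comm D (X m) a c = 0"
      unfolding X_def Y_def YD[symmetric] using that k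
      by (intro residue_braid_all[rule_format, OF ij[symmetric]]) auto
    then show ?thesis by (simp add: comm_swap[of "Y m"] comm_swap[of D] add_eq_0_iff)
  qed
  have D0: "comm D (Y m) a c = - comm (X m) (Y m) a c" "comm (X m) D a c = - comm (X m) (Y m) a c"
    if "m \<in> {Zero, One, Pt k}" for m
    using cD[OF that] cD'[OF that] by (simp_all add: eq_neg_iff_add_eq_0 add.commute)
  have "comm (\<lambda>a c. conn A b i a c z) (\<lambda>a c. conn A b j a c z) a c =
     (\<alpha>0 * \<beta>0 - \<delta> * \<beta>0 + \<delta> * \<alpha>0) * comm (X Zero) (Y Zero) a c +
     (\<alpha>1 * \<beta>1 - \<delta> * \<beta>1 + \<delta> * \<alpha>1) * comm (X One) (Y One) a c +
     (\<alpha>k * \<beta>k - \<delta> * \<beta>k + \<delta> * \<alpha>k) * comm (X (Pt k)) (Y (Pt k)) a c"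
    unfolding ci cj comm_add_left comm_add_right comm_scale_left comm_scale_right
    by (simp add: comm_self c0 D0 algebra_simps)
  also have "\<dots> = 0" by (simp add: arnold)
  finally show ?thesis .
qed

lemma conn_flat:
  assumes z: "z \<in> Y3"
  shows "pderiv_at i (conn A b j a c) z - pderiv_at j (conn A b i a c) z =
    (\<Sum>d\<in>UNIV. conn A b i a d z * conn A b j d c z) - (\<Sum>d\<in>UNIV. conn A b j a d z * conn A b i d c z)"
  using conn_closed[OF z, of i A b j a c] conn_commute[OF z, of A b i j a c] by (simp add: comm_def)

text \<open>
  The vector \<open>(L\<^sub>i, L\<^sub>i\<^sub>j)\<close> that is annihilated by the five equations of the restricted system, with
  \<open>L\<^sub>i\<close> in the diagonal entries and the skew symmetric \<open>L\<^sub>i\<^sub>j\<close> off the diagonal.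
\<close>

definition obstruction :: "3 \<Rightarrow> 3 \<Rightarrow> 3 cfun" where
  "obstruction i j y = (if i = 1 \<and> j = 2 then 1 - y $ 3 else if i = 2 \<and> j = 1 then y $ 3 - 1
     else if i = 2 \<and> j = 3 then 1 - y $ 1 else if i = 3 \<and> j = 2 then y $ 1 - 1
     else if i = 2 \<and> j = 2 then y $ 1 - y $ 3 else 0)"

definition hess_off :: "complex ^ 3 \<Rightarrow> complex \<Rightarrow> (3 \<Rightarrow> complex) \<Rightarrow> complex ^ 3 \<Rightarrow> 3 \<Rightarrow> 3 \<Rightarrow> complex" where
  "hess_off b g p y i j = (b $ j * p i - b $ i * p j + obstruction i j y * g) / (y $ i - y $ j)"

text \<open>
  The second derivatives of \<open>u\<close>, solved from \<open>L\<^sub>i = g \<cdot> obstruction i i\<close> and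
  \<open>L\<^sub>i\<^sub>j = g \<cdot> obstruction i j\<close>, as functions of \<open>g\<close>, of \<open>u\<close> and of the first derivatives \<open>p\<close>.
\<close>

definition hess :: "complex \<Rightarrow> complex ^ 3 \<Rightarrow> complex \<Rightarrow> complex \<Rightarrow> (3 \<Rightarrow> complex) \<Rightarrow> complex ^ 3 \<Rightarrow> 3 \<Rightarrow> 3 \<Rightarrow> complex" where
  "hess A b g u p y i j = (if i \<noteq> j then hess_off b g p y i j else
     (A * b $ i * u - (A + b $ 1 + b $ 3 - (1 + A) * y $ i) * p i + b $ i * (\<Sum>k\<in>UNIV. y $ k * p k)
       - (1 - y $ i) * (\<Sum>k\<in>UNIV - {i}. y $ k * hess_off b g p y i k) + obstruction i i y * g) / (y $ i * (1 - y $ i)))"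

fun jet_value :: "complex \<Rightarrow> complex \<Rightarrow> (3 \<Rightarrow> complex) \<Rightarrow> complex ^ 3 \<Rightarrow> jet \<Rightarrow> complex" where
  "jet_value g u p y Val = u"
| "jet_value g u p y (Der k) = (1 - y $ k) * p k"
| "jet_value g u p y Aux = (1 - y $ 1) * (1 - y $ 3) * g"

section \<open>The Appell--Lauricella system and its inhomogeneous companion as horizontal sections\<close>

lemma divide_via_inverse:
  fixes d :: "'a::field"
  shows "d * e = 1 \<Longrightarrow> x / d = x * e"
  by (cases "d = 0") (auto simp: field_simps)

lemma divide_via_inverse_swap:
  fixes s :: "'a::field"
  assumes "(s - t) * e = 1"
  shows "x / (t - s) = - (x * e)"
proof -
  have "(t - s) * (- e) = 1" using assms by (simp add: algebra_simps)
  from divide_via_inverse[OF this, of x] show ?thesis by simp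
qed

text \<open>
  The residues were chosen to make this identity true. After the inverses of the linear forms are
  treated as variables subject to their defining relations, it is a polynomial identity in each of
  the nine cases.
\<close>

lemma conn_Der:
  assumes "y \<in> Y3"
  shows "(\<Sum>c\<in>UNIV. conn A b i (Der j) c y * jet_value g u p y c) =
    (1 - y $ j) * hess A b g u p y i j - (if i = j then p j else 0)"
proof -
  define \<iota> where "\<iota> k = 1 / y $ k" for k
  define \<kappa> where "\<kappa> k = 1 / (1 - y $ k)" for k
  define \<alpha> where "\<alpha> = 1 / (y $ 1 - y $ 2)"
  define \<beta> where "\<beta> = 1 / (y $ 2 - y $ 3)"
  define \<gamma> where "\<gamma> = 1 / (y $ 1 - y $ 3)"
  have inv: "y $ 1 * \<iota> 1 = 1" "y $ 2 * \<iota> 2 = 1" "y $ 3 * \<iota> 3 = 1"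
    "(1 - y $ 1) * \<kappa> 1 = 1" "(1 - y $ 2) * \<kappa> 2 = 1" "(1 - y $ 3) * \<kappa> 3 = 1"
    "(y $ 1 - y $ 2) * \<alpha> = 1" "(y $ 2 - y $ 3) * \<beta> = 1" "(y $ 1 - y $ 3) * \<gamma> = 1"
    using assms by (auto simp: Y3_def \<iota>_def \<kappa>_def \<alpha>_def \<beta>_def \<gamma>_def)
  have prod: "(y $ k * (1 - y $ k)) * (\<iota> k * \<kappa> k) = 1" for k
    using assms by (simp add: Y3_def \<iota>_def \<kappa>_def)
  note div = inv[THEN divide_via_inverse] inv(4-9)[THEN divide_via_inverse_swap] prod[THEN divide_via_inverse]
  note D = conn_def sum_jet Diff_3 hess_def hess_off_def obstruction_def sum_3 residue_der_def residue_aux_def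
  have c11: "(\<Sum>c\<in>UNIV. conn A b 1 (Der 1) c y * jet_value g u p y c) =
    (1 - y $ 1) * hess A b g u p y 1 1 - (if (1::3) = 1 then p 1 else 0)"
    by (simp add: D div) (use inv in algebra)
  have c12: "(\<Sum>c\<in>UNIV. conn A b 1 (Der 2) c y * jet_value g u p y c) =
    (1 - y $ 2) * hess A b g u p y 1 2 - (if (1::3) = 2 then p 2 else 0)"
    by (simp add: D div) (use inv in algebra)
  have c13: "(\<Sum>c\<in>UNIV. conn A b 1 (Der 3) c y * jet_value g u p y c) =
    (1 - y $ 3) * hess A b g u p y 1 3 - (if (1::3) = 3 then p 3 else 0)"
    by (simp add: D div) (use inv in algebra)
  have c21: "(\<Sum>c\<in>UNIV. conn A b 2 (Der 1) c y * jet_value g u p y c) =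
    (1 - y $ 1) * hess A b g u p y 2 1 - (if (2::3) = 1 then p 1 else 0)"
    by (simp add: D div) (use inv in algebra)
  have c22: "(\<Sum>c\<in>UNIV. conn A b 2 (Der 2) c y * jet_value g u p y c) =
    (1 - y $ 2) * hess A b g u p y 2 2 - (if (2::3) = 2 then p 2 else 0)"
    by (simp add: D div) (use inv in algebra)
  have c23: "(\<Sum>c\<in>UNIV. conn A b 2 (Der 3) c y * jet_value g u p y c) =
    (1 - y $ 3) * hess A b g u p y 2 3 - (if (2::3) = 3 then p 3 else 0)"
    by (simp add: D div) (use inv in algebra)
  have c31: "(\<Sum>c\<in>UNIV. conn A b 3 (Der 1) c y * jet_value g u p y c) =
    (1 - y $ 1) * hess A b g u p y 3 1 - (if (3::3) = 1 then p 1 else 0)"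
    by (simp add: D div) (use inv in algebra)
  have c32: "(\<Sum>c\<in>UNIV. conn A b 3 (Der 2) c y * jet_value g u p y c) =
    (1 - y $ 2) * hess A b g u p y 3 2 - (if (3::3) = 2 then p 2 else 0)"
    by (simp add: D div) (use inv in algebra)
  have c33: "(\<Sum>c\<in>UNIV. conn A b 3 (Der 3) c y * jet_value g u p y c) =
    (1 - y $ 3) * hess A b g u p y 3 3 - (if (3::3) = 3 then p 3 else 0)"
    by (simp add: D div) (use inv in algebra)
  have "i = 1 \<or> i = 2 \<or> i = 3" "j = 1 \<or> j = 2 \<or> j = 3" using exhaust_3 by auto
  then show ?thesis using c11 c12 c13 c21 c22 c23 c31 c32 c33 by (elim disjE) (simp_all only:)
qed

lemma residue_Val: "pole_residue A b i m Val c = (if m = One \<and> c = Der i then -1 else 0)"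
  by (cases c) auto

lemma residue_Aux: "pole_residue A b i m Aux c = (if c = Aux then residue_aux_aux A b i m else 0)"
  by (cases c) auto

lemma conn_Val: "(\<Sum>c\<in>UNIV. conn A b i Val c y * X c) = X (Der i) / (1 - y $ i)"
proof -
  have "conn A b i Val c y = (if c = Der i then - 1 / (y $ i - 1) else 0)" for c
    by (simp add: conn_def residue_Val)
  then have "(\<Sum>c\<in>UNIV. conn A b i Val c y * X c) = (\<Sum>c\<in>UNIV. if c = Der i then - 1 / (y $ i - 1) * X (Der i) else 0)"
    by (intro sum.cong) auto
  also have "\<dots> = - 1 / (y $ i - 1) * X (Der i)"
    by (subst sum.delta) simp_all
  also have "- 1 / (y $ i - 1) = 1 / (1 - y $ i)"
    using minus_divide_divide[of 1 "1 - y $ i"] by (simp only: minus_diff_eq)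
  finally show ?thesis by simp
qed

lemma conn_Aux: "(\<Sum>c\<in>UNIV. conn A b i Aux c y * X c) = conn A b i Aux Aux y * X Aux"
proof -
  have "conn A b i Aux c y = 0" if "c \<noteq> Aux" for c
    using that by (simp add: conn_def residue_Aux)
  then have "(\<Sum>c\<in>UNIV. conn A b i Aux c y * X c) = (\<Sum>c\<in>{Aux}. conn A b i Aux c y * X c)"
    by (intro sum.mono_neutral_right) auto
  then show ?thesis by simp
qed

lemma pderiv_one_minus_coord_mult:
  assumes f: "slicewise f N" and y: "y \<in> N"
  shows "slicewise (\<lambda>z. (1 - z $ j) * f z) N"
    and "pderiv_at i (\<lambda>z. (1 - z $ j) * f z) y = (1 - y $ j) * pderiv_at i f y - (if i = j then f y else 0)"
proof -
  have N: "open N" using f by (rule slicewise_open)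
  have c: "slicewise (\<lambda>z. 1 - z $ j) N"
    by (intro slicewise_diff slicewise_const slicewise_coord N)
  show "slicewise (\<lambda>z. (1 - z $ j) * f z) N"
    by (rule slicewise_mult[OF c f])
  have "pderiv_at i (\<lambda>z. 1 - z $ j) y = 0 - (if i = j then 1 else 0)"
    unfolding pderiv_diff[OF slicewise_const[OF N] slicewise_coord[OF N] y] pderiv_const pderiv_coord ..
  then show "pderiv_at i (\<lambda>z. (1 - z $ j) * f z) y = (1 - y $ j) * pderiv_at i f y - (if i = j then f y else 0)"
    unfolding pderiv_mult[OF c f y] by simp
qed

lemma pfaffian_imp_hess:
  assumes U: "pfaffian_solution (conn A b) B U" and B: "B \<subseteq> Y3" and y: "y \<in> B"
  shows "pderiv_at i (pderiv_at j (U Val)) y =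
    hess A b (U Aux y / ((1 - y $ 1) * (1 - y $ 3))) (U Val y) (\<lambda>k. pderiv_at k (U Val) y) y i j"
proof -
  have sU: "slicewise (U a) B" for a using U by (simp add: pfaffian_solution_def)
  have pU: "pderiv_at i (U a) z = (\<Sum>c\<in>UNIV. conn A b i a c z * U c z)" if "z \<in> B" for i a z
    using U that by (simp add: pfaffian_solution_def)
  have ne: "1 - z $ k \<noteq> 0" if "z \<in> B" for z k using that B by (auto simp: Y3_def)
  have Der: "U (Der k) z = (1 - z $ k) * pderiv_at k (U Val) z" if z: "z \<in> B" for k z
    using ne[OF z, of k] by (simp add: pU[OF z] conn_Val)
  define p where "p = (\<lambda>k. pderiv_at k (U Val) y)"
  define g where "g = U Aux y / ((1 - y $ 1) * (1 - y $ 3))"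
  have jet: "U c y = jet_value g (U Val y) p y c" for c
    using ne[OF y] by (cases c) (simp_all add: Der[OF y] p_def g_def)
  have "pderiv_at i (U (Der j)) y = pderiv_at i (\<lambda>z. (1 - z $ j) * pderiv_at j (U Val) z) y"
    by (rule pderiv_at_cong, rule eventually_mono[OF eventually_nhds_in_open[OF slicewise_open[OF sU] y]], rule Der)
  also have "\<dots> = (1 - y $ j) * pderiv_at i (pderiv_at j (U Val)) y - (if i = j then p j else 0)"
    unfolding p_def by (rule pderiv_one_minus_coord_mult(2)[OF slicewise_pderiv[OF sU] y])
  finally have 1: "pderiv_at i (U (Der j)) y = \<dots>" .
  have "pderiv_at i (U (Der j)) y = (\<Sum>c\<in>UNIV. conn A b i (Der j) c y * jet_value g (U Val y) p y c)"
    unfolding pU[OF y] jet[symmetric] ..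
  also have "\<dots> = (1 - y $ j) * hess A b g (U Val y) p y i j - (if i = j then p j else 0)"
    using y B by (intro conn_Der) auto
  finally have "(1 - y $ j) * pderiv_at i (pderiv_at j (U Val)) y = (1 - y $ j) * hess A b g (U Val y) p y i j"
    using 1 by simp
  then show ?thesis using ne[OF y, of j] by (simp add: g_def p_def)
qed

lemma hess_imp_pfaffian:
  assumes u: "slicewise u N" and N: "N \<subseteq> Y3"
    and h: "\<And>y i j. y \<in> N \<Longrightarrow> pderiv_at i (pderiv_at j u) y = hess A b 0 (u y) (\<lambda>k. pderiv_at k u y) y i j"
  shows "pfaffian_solution (conn A b) N (\<lambda>c y. jet_value 0 (u y) (\<lambda>k. pderiv_at k u y) y c)"
  unfolding pfaffian_solution_def
proof (intro conjI allI ballI)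
  have oN: "open N" using u by (rule slicewise_open)
  show "slicewise (\<lambda>y. jet_value 0 (u y) (\<lambda>k. pderiv_at k u y) y a) N" for a
    by (cases a) (simp_all add: u slicewise_const[OF oN] slicewise_mult slicewise_diff slicewise_coord[OF oN] slicewise_pderiv[OF u])
  fix y i a assume y: "y \<in> N"
  have ne: "1 - y $ k \<noteq> 0" for k using y N by (auto simp: Y3_def)
  show "pderiv_at i (\<lambda>y. jet_value 0 (u y) (\<lambda>k. pderiv_at k u y) y a) y =
      (\<Sum>c\<in>UNIV. conn A b i a c y * jet_value 0 (u y) (\<lambda>k. pderiv_at k u y) y c)"
  proof (cases a)
    case Val
    then show ?thesis using ne[of i] by (simp add: conn_Val)
  next
    case Aux
    then show ?thesis by (simp add: conn_Aux pderiv_const)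
  next
    case (Der j)
    have "pderiv_at i (\<lambda>y. jet_value 0 (u y) (\<lambda>k. pderiv_at k u y) y a) y =
      (1 - y $ j) * pderiv_at i (pderiv_at j u) y - (if i = j then pderiv_at j u y else 0)"
      unfolding Der jet_value.simps by (rule pderiv_one_minus_coord_mult(2)[OF slicewise_pderiv[OF u] y])
    also have "\<dots> = (\<Sum>c\<in>UNIV. conn A b i a c y * jet_value 0 (u y) (\<lambda>k. pderiv_at k u y) y c)"
      unfolding h[OF y] Der using y N by (subst conn_Der) auto
    finally show ?thesis .
  qed
qed

lemma euler_jet:
  assumes f: "slicewise f N" and x: "x \<in> N" and I: "finite I"
  shows "pderiv_at j (euler I c f) x = (\<Sum>i\<in>I. (if j = i then pderiv_at i f x else 0) + x $ i * pderiv_at j (pderiv_at i f) x) + c * pderiv_at j f x"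
proof -
  have N: "open N" using f by (rule slicewise_open)
  have s: "slicewise (\<lambda>x. x $ i * pderiv_at i f x) N" for i
    by (intro slicewise_mult slicewise_coord N slicewise_pderiv f)
  have "euler I c f = (\<lambda>x. (\<Sum>i\<in>I. x $ i * pderiv_at i f x) + c * f x)"
    by (simp add: fun_eq_iff euler_def)
  then have "pderiv_at j (euler I c f) x = pderiv_at j (\<lambda>x. \<Sum>i\<in>I. x $ i * pderiv_at i f x) x + pderiv_at j (\<lambda>x. c * f x) x"
    using pderiv_add[OF slicewise_sum[OF N s] slicewise_mult[OF slicewise_const[OF N] f] x] by simp
  also have "pderiv_at j (\<lambda>x. c * f x) x = c * pderiv_at j f x"
    unfolding pderiv_mult[OF slicewise_const[OF N] f x] pderiv_const by simp
  also have "pderiv_at j (\<lambda>x. \<Sum>i\<in>I. x $ i * pderiv_at i f x) x = (\<Sum>i\<in>I. pderiv_at j (\<lambda>x. x $ i * pderiv_at i f x) x)"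
    by (rule pderiv_sum[OF s x])
  also have "\<dots> = (\<Sum>i\<in>I. (if j = i then pderiv_at i f x else 0) + x $ i * pderiv_at j (pderiv_at i f) x)"
    unfolding pderiv_mult[OF slicewise_coord[OF N] slicewise_pderiv[OF f] x] pderiv_coord
    by (intro sum.cong) auto
  finally show ?thesis .
qed

lemma hess_off_eq:
  assumes "y \<in> Y3" "i \<noteq> j"
  shows "(y $ i - y $ j) * hess A b g u p y i j = b $ j * p i - b $ i * p j + obstruction i j y * g"
proof -
  have "y $ i - y $ j \<noteq> 0" using assms by (auto simp: Y3_def)
  then show ?thesis using assms by (simp add: hess_def hess_off_def)
qed

lemma hess_diag_eq:
  assumes "y \<in> Y3"
  shows "(1 - y $ i) * (\<Sum>k\<in>UNIV. y $ k * hess A b g u p y i k) =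
    A * b $ i * u - (A + b $ 1 + b $ 3 - (1 + A) * y $ i) * p i + b $ i * (\<Sum>k\<in>UNIV. y $ k * p k) + obstruction i i y * g"
proof -
  have ne: "y $ i \<noteq> 0" "1 - y $ i \<noteq> 0" using assms by (auto simp: Y3_def)
  have "(\<Sum>k\<in>UNIV. y $ k * hess A b g u p y i k) = y $ i * hess A b g u p y i i + (\<Sum>k\<in>UNIV - {i}. y $ k * hess A b g u p y i k)"
    by (rule sum.remove) auto
  also have "(\<Sum>k\<in>UNIV - {i}. y $ k * hess A b g u p y i k) = (\<Sum>k\<in>UNIV - {i}. y $ k * hess_off b g p y i k)"
    by (intro sum.cong) (auto simp: hess_def)
  finally have "(1 - y $ i) * (\<Sum>k\<in>UNIV. y $ k * hess A b g u p y i k) =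
     (y $ i * (1 - y $ i)) * hess A b g u p y i i + (1 - y $ i) * (\<Sum>k\<in>UNIV - {i}. y $ k * hess_off b g p y i k)"
    by (simp add: algebra_simps)
  also have "(y $ i * (1 - y $ i)) * hess A b g u p y i i =
     A * b $ i * u - (A + b $ 1 + b $ 3 - (1 + A) * y $ i) * p i + b $ i * (\<Sum>k\<in>UNIV. y $ k * p k)
       - (1 - y $ i) * (\<Sum>k\<in>UNIV - {i}. y $ k * hess_off b g p y i k) + obstruction i i y * g"
    using ne by (simp add: hess_def)
  finally show ?thesis by simp
qed

text \<open>
  In polynomial form the relations between second derivatives and first order data are linear, and
  they determine the second derivatives. So linearity of \<open>hess\<close> in its data, or its agreement with
  the equations of the system, need not be read off from the fractions.
\<close>

lemma hess_unique:
  assumes y: "y \<in> Y3"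
    and off: "\<And>i j. i \<noteq> j \<Longrightarrow> (y $ i - y $ j) * h i j = b $ j * p i - b $ i * p j + obstruction i j y * g"
    and diag: "\<And>i. (1 - y $ i) * (\<Sum>k\<in>UNIV. y $ k * h i k) =
      A * b $ i * u - (A + b $ 1 + b $ 3 - (1 + A) * y $ i) * p i + b $ i * (\<Sum>k\<in>UNIV. y $ k * p k) + obstruction i i y * g"
  shows "h i j = hess A b g u p y i j"
proof -
  have o: "h i j = hess A b g u p y i j" if "i \<noteq> j" for i j
  proof -
    have "y $ i - y $ j \<noteq> 0" using y that by (auto simp: Y3_def)
    moreover have "(y $ i - y $ j) * h i j = (y $ i - y $ j) * hess A b g u p y i j"
      unfolding off[OF that] hess_off_eq[OF y that] ..
    ultimately show ?thesis by simp
  qed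
  have "h i i = hess A b g u p y i i" for i
  proof -
    have ne: "y $ i \<noteq> 0" "1 - y $ i \<noteq> 0" using y by (auto simp: Y3_def)
    have "(1 - y $ i) * (\<Sum>k\<in>UNIV. y $ k * h i k) = (1 - y $ i) * (\<Sum>k\<in>UNIV. y $ k * hess A b g u p y i k)"
      unfolding diag hess_diag_eq[OF y] ..
    then have "(\<Sum>k\<in>UNIV. y $ k * h i k) = (\<Sum>k\<in>UNIV. y $ k * hess A b g u p y i k)" using ne by simp
    moreover have "(\<Sum>k\<in>UNIV. y $ k * h' k) = y $ i * h' i + (\<Sum>k\<in>UNIV - {i}. y $ k * h' k)" for h' :: "3 \<Rightarrow> complex"
      by (rule sum.remove) auto
    moreover have "(\<Sum>k\<in>UNIV - {i}. y $ k * h i k) = (\<Sum>k\<in>UNIV - {i}. y $ k * hess A b g u p y i k)"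
      by (intro sum.cong) (auto simp: o)
    ultimately show ?thesis using ne by simp
  qed
  then show ?thesis using o by (cases "i = j") auto
qed

text \<open>
  The Appell--Lauricella equations carry the factors \<open>y\<^sub>i\<close> and \<open>y\<^sub>i y\<^sub>j\<close>, which do not vanish on
  \<open>Y3\<close>; after removing them the equations are the case \<open>g = 0\<close>.
\<close>

lemma ED_iff_hess:
  fixes b :: "complex ^ 3"
  assumes u: "slicewise u N" and y: "y \<in> N" "y \<in> Y3" and C: "C = A + b $ 1 + b $ 3"
  shows "ED A b C u y \<longleftrightarrow>
    (\<forall>i j. pderiv_at i (pderiv_at j u) y = hess A b 0 (u y) (\<lambda>k. pderiv_at k u y) y i j)"
proof -
  define p where "p k = pderiv_at k u y" for k
  define h where "h i j = pderiv_at i (pderiv_at j u) y" for i j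
  have N: "open N" using u by (rule slicewise_open)
  have sym: "h i j = h j i" for i j unfolding h_def by (rule pderiv_commute[OF u y(1)])
  have e0: "euler I c u y = (\<Sum>k\<in>I. y $ k * p k) + c * u y" for I c
    by (simp add: euler_def p_def)
  have e1: "pderiv_at i (euler UNIV c u) y = p i + (\<Sum>k\<in>UNIV. y $ k * h i k) + c * p i" for i c
    by (simp add: euler_jet[OF u y(1)] sum.distrib p_def h_def)
  have e2: "pderiv_at i (euler {j} c u) y = (if i = j then p j else 0) + y $ j * h i j + c * p i" for i j c
    by (simp add: euler_jet[OF u y(1)] p_def h_def)
  have eq1: "euler {i} 0 (euler UNIV (C - 1) u) y - y $ i * euler {i} (b $ i) (euler UNIV A u) y =
     y $ i * ((1 - y $ i) * (\<Sum>k\<in>UNIV. y $ k * h i k) -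
       (A * b $ i * u y - (A + b $ 1 + b $ 3 - (1 + A) * y $ i) * p i + b $ i * (\<Sum>k\<in>UNIV. y $ k * p k)))" for i
    unfolding euler_def[of "{i}"] by (simp add: e1 e0 C) (simp add: algebra_simps)
  have eq2: "y $ i * euler {i} (b $ i) (euler {j} 0 u) y - y $ j * euler {j} (b $ j) (euler {i} 0 u) y =
     y $ i * y $ j * ((y $ i - y $ j) * h i j - (b $ j * p i - b $ i * p j))" for i j
    unfolding euler_def[of "{i}" "b $ i"] euler_def[of "{j}" "b $ j"]
    by (simp add: e2 e0 sym[of j i]) (simp add: algebra_simps)
  have ne: "y $ i \<noteq> 0" for i using y by (simp add: Y3_def)
  have "ED A b C u y \<longleftrightarrow>
     (\<forall>i. (1 - y $ i) * (\<Sum>k\<in>UNIV. y $ k * h i k) =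
       A * b $ i * u y - (A + b $ 1 + b $ 3 - (1 + A) * y $ i) * p i + b $ i * (\<Sum>k\<in>UNIV. y $ k * p k)) \<and>
     (\<forall>i j. (y $ i - y $ j) * h i j = b $ j * p i - b $ i * p j)"
    unfolding ED_def eq1 eq2 using ne by simp
  also have "\<dots> \<longleftrightarrow> (\<forall>i j. h i j = hess A b 0 (u y) p y i j)"
  proof
    assume *: "(\<forall>i. (1 - y $ i) * (\<Sum>k\<in>UNIV. y $ k * h i k) =
       A * b $ i * u y - (A + b $ 1 + b $ 3 - (1 + A) * y $ i) * p i + b $ i * (\<Sum>k\<in>UNIV. y $ k * p k)) \<and>
     (\<forall>i j. (y $ i - y $ j) * h i j = b $ j * p i - b $ i * p j)"
    show "\<forall>i j. h i j = hess A b 0 (u y) p y i j"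
      by (intro allI hess_unique[OF y(2)]; simp add: *)
  next
    assume *: "\<forall>i j. h i j = hess A b 0 (u y) p y i j"
    show "(\<forall>i. (1 - y $ i) * (\<Sum>k\<in>UNIV. y $ k * h i k) =
       A * b $ i * u y - (A + b $ 1 + b $ 3 - (1 + A) * y $ i) * p i + b $ i * (\<Sum>k\<in>UNIV. y $ k * p k)) \<and>
     (\<forall>i j. (y $ i - y $ j) * h i j = b $ j * p i - b $ i * p j)"
    proof (intro conjI allI)
      show "(y $ i - y $ j) * h i j = b $ j * p i - b $ i * p j" for i j
        using hess_off_eq[OF y(2), of i j A b 0 "u y" p] * by (cases "i = j") simp_all
      show "(1 - y $ i) * (\<Sum>k\<in>UNIV. y $ k * h i k) =
       A * b $ i * u y - (A + b $ 1 + b $ 3 - (1 + A) * y $ i) * p i + b $ i * (\<Sum>k\<in>UNIV. y $ k * p k)" for i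
        using hess_diag_eq[OF y(2), of i A b 0 "u y" p] * by simp
    qed
  qed
  finally show ?thesis by (simp add: h_def p_def[abs_def])
qed

lemma hess_add:
  assumes y: "y \<in> Y3"
  shows "hess A b g u p y i j + hess A b g' u' p' y i j = hess A b (g + g') (u + u') (\<lambda>k. p k + p' k) y i j"
proof (rule hess_unique[OF y, where h="\<lambda>i j. hess A b g u p y i j + hess A b g' u' p' y i j"])
  show "(y $ i - y $ j) * (hess A b g u p y i j + hess A b g' u' p' y i j) =
      b $ j * (p i + p' i) - b $ i * (p j + p' j) + obstruction i j y * (g + g')" if "i \<noteq> j" for i j
    unfolding distrib_left[of "y $ i - y $ j"] hess_off_eq[OF y that] by (simp add: algebra_simps)
  show "(1 - y $ i) * (\<Sum>k\<in>UNIV. y $ k * (hess A b g u p y i k + hess A b g' u' p' y i k)) =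
      A * b $ i * (u + u') - (A + b $ 1 + b $ 3 - (1 + A) * y $ i) * (p i + p' i) +
      b $ i * (\<Sum>k\<in>UNIV. y $ k * (p k + p' k)) + obstruction i i y * (g + g')" for i
    unfolding distrib_left[of "y $ _"] sum.distrib distrib_left[of "1 - y $ i"] hess_diag_eq[OF y]
    by (simp add: algebra_simps)
qed

lemma hess_scale:
  assumes y: "y \<in> Y3"
  shows "s * hess A b g u p y i j = hess A b (s * g) (s * u) (\<lambda>k. s * p k) y i j"
proof (rule hess_unique[OF y, where h="\<lambda>i j. s * hess A b g u p y i j"])
  show "(y $ i - y $ j) * (s * hess A b g u p y i j) =
      b $ j * (s * p i) - b $ i * (s * p j) + obstruction i j y * (s * g)" if "i \<noteq> j" for i j
    unfolding mult.left_commute[of _ s] hess_off_eq[OF y that] by (simp add: algebra_simps)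
  show "(1 - y $ i) * (\<Sum>k\<in>UNIV. y $ k * (s * hess A b g u p y i k)) =
      A * b $ i * (s * u) - (A + b $ 1 + b $ 3 - (1 + A) * y $ i) * (s * p i) +
      b $ i * (\<Sum>k\<in>UNIV. y $ k * (s * p k)) + obstruction i i y * (s * g)" for i
    unfolding mult.left_commute[of _ s] sum_distrib_left[symmetric] hess_diag_eq[OF y]
    by (simp add: algebra_simps)
qed

definition ED_solution :: "complex \<Rightarrow> complex ^ 3 \<Rightarrow> (complex ^ 3) set \<Rightarrow> 3 cfun \<Rightarrow> bool" where
  "ED_solution A b N u \<longleftrightarrow> slicewise u N \<and> N \<subseteq> Y3 \<and>
     (\<forall>y\<in>N. \<forall>i j. pderiv_at i (pderiv_at j u) y = hess A b 0 (u y) (\<lambda>k. pderiv_at k u y) y i j)"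

lemma ED_solution_subset: "ED_solution A b N u \<Longrightarrow> open M \<Longrightarrow> M \<subseteq> N \<Longrightarrow> ED_solution A b M u"
  unfolding ED_solution_def using slicewise_subset[of u N M] by auto

lemma solutions_ED_iff:
  assumes p: "p \<in> Y3" and C: "C = A + b $ 1 + b $ 3"
  shows "u \<in> solutions_at (ED A b C) p \<longleftrightarrow> (\<exists>e>0. ED_solution A b (ball p e) u)"
proof
  assume "u \<in> solutions_at (ED A b C) p"
  then obtain U where U: "p \<in> U" "slicewise u U" "\<forall>y\<in>U. ED A b C u y"
    unfolding solutions_at_def holo_on_iff_slicewise by auto
  have "open (U \<inter> Y3)" "p \<in> U \<inter> Y3" using U p open_Y3 slicewise_open by auto
  then obtain e where e: "e > 0" "ball p e \<subseteq> U \<inter> Y3" using openE by blast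
  have "ED_solution A b (ball p e) u"
    unfolding ED_solution_def
  proof (intro conjI ballI)
    show "slicewise u (ball p e)" using e by (intro slicewise_subset[OF U(2)]) auto
    fix y assume y: "y \<in> ball p e"
    then have "y \<in> U" "y \<in> Y3" using e by auto
    then show "\<forall>i j. pderiv_at i (pderiv_at j u) y = hess A b 0 (u y) (\<lambda>k. pderiv_at k u y) y i j"
      using ED_iff_hess[OF U(2) _ _ C, of y] U(3) by simp
  qed (use e in auto)
  then show "\<exists>e>0. ED_solution A b (ball p e) u" using e by blast
next
  assume "\<exists>e>0. ED_solution A b (ball p e) u"
  then obtain e where e: "e > 0" and u: "ED_solution A b (ball p e) u" by auto
  have s: "slicewise u (ball p e)" using u by (simp add: ED_solution_def)
  have "ED A b C u y" if "y \<in> ball p e" for y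
    using u that ED_iff_hess[OF s that _ C] unfolding ED_solution_def by auto
  then show "u \<in> solutions_at (ED A b C) p"
    unfolding solutions_at_def holo_on_iff_slicewise using s e by (intro CollectI exI[of _ "ball p e"]) simp
qed

lemma ED_solution_add:
  assumes u: "ED_solution A b N u" and v: "ED_solution A b N v"
  shows "ED_solution A b N (\<lambda>y. u y + v y)"
proof -
  have s: "slicewise u N" "slicewise v N" and N: "N \<subseteq> Y3" using u v by (simp_all add: ED_solution_def)
  have p: "pderiv_at k (\<lambda>y. u y + v y) y = pderiv_at k u y + pderiv_at k v y" if "y \<in> N" for k y
    by (rule pderiv_add[OF s that])
  have "pderiv_at i (pderiv_at j (\<lambda>y. u y + v y)) y = hess A b 0 (u y + v y) (\<lambda>k. pderiv_at k (\<lambda>y. u y + v y) y) y i j"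
    if y: "y \<in> N" for i j y
  proof -
    have "pderiv_at i (pderiv_at j (\<lambda>y. u y + v y)) y = pderiv_at i (\<lambda>y. pderiv_at j u y + pderiv_at j v y) y"
      by (rule pderiv_at_cong, rule eventually_mono[OF eventually_nhds_in_open[OF slicewise_open[OF s(1)] y]], rule p)
    also have "\<dots> = pderiv_at i (pderiv_at j u) y + pderiv_at i (pderiv_at j v) y"
      by (rule pderiv_add[OF slicewise_pderiv[OF s(1)] slicewise_pderiv[OF s(2)] y])
    also have "\<dots> = hess A b 0 (u y) (\<lambda>k. pderiv_at k u y) y i j + hess A b 0 (v y) (\<lambda>k. pderiv_at k v y) y i j"
      using u v y by (simp add: ED_solution_def)
    also have "\<dots> = hess A b 0 (u y + v y) (\<lambda>k. pderiv_at k (\<lambda>y. u y + v y) y) y i j"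
      using y N by (subst hess_add) (auto simp: p[OF y])
    finally show ?thesis .
  qed
  then show ?thesis using s N by (simp add: ED_solution_def slicewise_add)
qed

lemma ED_solution_scale:
  assumes u: "ED_solution A b N u"
  shows "ED_solution A b N (\<lambda>y. c * u y)"
proof -
  have s: "slicewise u N" and N: "N \<subseteq> Y3" using u by (simp_all add: ED_solution_def)
  have o: "open N" using s by (rule slicewise_open)
  have p: "pderiv_at k (\<lambda>y. c * f y) y = c * pderiv_at k f y" if "y \<in> N" "slicewise f N" for k y f
    unfolding pderiv_mult[OF slicewise_const[OF o] that(2,1)] pderiv_const by simp
  have "pderiv_at i (pderiv_at j (\<lambda>y. c * u y)) y = hess A b 0 (c * u y) (\<lambda>k. pderiv_at k (\<lambda>y. c * u y) y) y i j"
    if y: "y \<in> N" for i j y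
  proof -
    have "pderiv_at i (pderiv_at j (\<lambda>y. c * u y)) y = pderiv_at i (\<lambda>y. c * pderiv_at j u y) y"
      by (rule pderiv_at_cong, rule eventually_mono[OF eventually_nhds_in_open[OF o y]], rule p[OF _ s])
    also have "\<dots> = c * pderiv_at i (pderiv_at j u) y"
      by (rule p[OF y slicewise_pderiv[OF s]])
    also have "\<dots> = c * hess A b 0 (u y) (\<lambda>k. pderiv_at k u y) y i j"
      using u y by (simp add: ED_solution_def)
    also have "\<dots> = hess A b 0 (c * u y) (\<lambda>k. pderiv_at k (\<lambda>y. c * u y) y) y i j"
      using y N by (subst hess_scale) (auto simp: p[OF y s])
    finally show ?thesis .
  qed
  then show ?thesis using s N o by (simp add: ED_solution_def slicewise_mult slicewise_const)
qed

lemma conn_Aux_zero: "c \<noteq> Aux \<Longrightarrow> conn A b i Aux c y = 0"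
  by (simp add: conn_def residue_Aux)

text \<open>
  The germ gives a horizontal section with vanishing \<open>Aux\<close> component near \<open>q\<close>; the section on the
  whole ball with the same initial value extends it. Its \<open>Aux\<close> component satisfies an equation of
  its own, so it vanishes on the whole ball, and the extension solves the system as well.
\<close>

lemma ED_solution_extends:
  assumes p: "p \<in> Y3"
  shows "\<exists>r>0. ball p r \<subseteq> Y3 \<and>
    (\<forall>q u e. q \<in> ball p r \<longrightarrow> e > 0 \<longrightarrow> ED_solution A b (ball q e) u \<longrightarrow>
       (\<exists>v. ED_solution A b (ball p r) v \<and> germ_eq q u v))"
proof -
  obtain r where r: "r > 0" "ball p r \<subseteq> Y3"
    and ex: "\<And>q v. q \<in> ball p r \<Longrightarrow> \<exists>U. pfaffian_solution (conn A b) (ball p r) U \<and> (\<forall>a. U a q = v a)"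
    and un: "\<And>C q U Z a z. convex C \<Longrightarrow> open C \<Longrightarrow> C \<subseteq> ball p r \<Longrightarrow> q \<in> C \<Longrightarrow> pfaffian_solution (conn A b) C U \<Longrightarrow>
       (\<And>i a c y. a \<in> Z \<Longrightarrow> c \<notin> Z \<Longrightarrow> conn A b i a c y = 0) \<Longrightarrow> (\<And>a. a \<in> Z \<Longrightarrow> U a q = 0) \<Longrightarrow>
       a \<in> Z \<Longrightarrow> z \<in> C \<Longrightarrow> U a z = 0"
    by (rule pfaffian_local_theory[where Om="conn A b", OF slicewise_conn p conn_flat]) auto
  have "\<exists>v. ED_solution A b (ball p r) v \<and> germ_eq q u v"
    if q: "q \<in> ball p r" and e: "e > 0" and u: "ED_solution A b (ball q e) u" for q u e
  proof -
    define C where "C = ball q e \<inter> ball p r"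
    have C: "convex C" "open C" "C \<subseteq> ball p r" "q \<in> C" using q e by (auto simp: C_def convex_Int)
    have uC: "ED_solution A b C u" by (rule ED_solution_subset[OF u C(2)]) (simp add: C_def)
    define U' where "U' = (\<lambda>c y. jet_value 0 (u y) (\<lambda>k. pderiv_at k u y) y c)"
    have U': "pfaffian_solution (conn A b) C U'"
      unfolding U'_def using uC by (intro hess_imp_pfaffian) (auto simp: ED_solution_def)
    obtain U where U: "pfaffian_solution (conn A b) (ball p r) U" "\<And>a. U a q = U' a q"
      using ex[OF q, of "\<lambda>a. U' a q"] by auto
    have sU: "slicewise (U Val) (ball p r)" using U by (simp add: pfaffian_solution_def)
    have Aux0: "U Aux z = 0" if "z \<in> ball p r" for z
      by (rule un[of "ball p r" q U "{Aux}"]) (use q U that in \<open>auto simp: conn_Aux_zero U'_def\<close>)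
    have "ED_solution A b (ball p r) (U Val)"
      unfolding ED_solution_def
      using pfaffian_imp_hess[OF U(1) r(2)] Aux0 sU r by auto
    moreover have "germ_eq q u (U Val)"
    proof -
      have UC: "pfaffian_solution (conn A b) C U"
        using U(1) C slicewise_subset[of _ "ball p r" C] unfolding pfaffian_solution_def by auto
      have "U' Val z - U Val z = 0" if "z \<in> C" for z
        by (rule un[of C q "\<lambda>a z. U' a z - U a z" UNIV Val])
           (use C U that pfaffian_solution_diff[OF U' UC] in auto)
      then have "\<forall>\<^sub>F z in nhds q. u z = U Val z"
        using C by (intro eventually_mono[OF eventually_nhds_in_open[OF C(2) C(4)]]) (auto simp: U'_def)
      then show ?thesis by (simp add: germ_eq_def)
    qed
    ultimately show ?thesis by blast
  qed
  then show ?thesis using r by blast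
qed

text \<open>
  Hypergeometric series and Euler integrals degenerate for special parameters, whereas horizontal
  sections with prescribed value exist for all of them.
\<close>

lemma ED_solution_exists:
  assumes p: "p \<in> Y3"
  shows "\<exists>r>0. \<exists>u. ED_solution A b (ball p r) u \<and> u p = 1"
proof -
  obtain r where r: "r > 0" "ball p r \<subseteq> Y3"
    and ex: "\<And>q v. q \<in> ball p r \<Longrightarrow> \<exists>U. pfaffian_solution (conn A b) (ball p r) U \<and> (\<forall>a. U a q = v a)"
    and un: "\<And>C q U Z a z. convex C \<Longrightarrow> open C \<Longrightarrow> C \<subseteq> ball p r \<Longrightarrow> q \<in> C \<Longrightarrow> pfaffian_solution (conn A b) C U \<Longrightarrow>
       (\<And>i a c y. a \<in> Z \<Longrightarrow> c \<notin> Z \<Longrightarrow> conn A b i a c y = 0) \<Longrightarrow> (\<And>a. a \<in> Z \<Longrightarrow> U a q = 0) \<Longrightarrow>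
       a \<in> Z \<Longrightarrow> z \<in> C \<Longrightarrow> U a z = 0"
    by (rule pfaffian_local_theory[where Om="conn A b", OF slicewise_conn p conn_flat]) auto
  have pp: "p \<in> ball p r" using r by simp
  obtain U where U: "pfaffian_solution (conn A b) (ball p r) U" "\<And>a. U a p = (if a = Val then 1 else 0)"
    using ex[OF pp, of "\<lambda>a. if a = Val then 1 else 0"] by auto
  have Aux0: "U Aux z = 0" if "z \<in> ball p r" for z
    by (rule un[of "ball p r" p U "{Aux}"]) (use pp U that in \<open>auto simp: conn_Aux_zero\<close>)
  have "ED_solution A b (ball p r) (U Val)"
    unfolding ED_solution_def
    using pfaffian_imp_hess[OF U(1) r(2)] Aux0 U(1) r by (auto simp: pfaffian_solution_def)
  moreover have "U Val p = 1" using U(2) by simp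
  ultimately show ?thesis using r by blast
qed

text \<open>
  With a nonzero \<open>Aux\<close> component the same flat connection yields a function that misses the
  Appell--Lauricella system by the nonzero multiple \<open>g\<close> of the obstruction.
\<close>

lemma extra_solution_exists:
  assumes p: "p \<in> Y3"
  shows "\<exists>r>0. \<exists>u g. ball p r \<subseteq> Y3 \<and> slicewise u (ball p r) \<and> g p \<noteq> 0 \<and>
    (\<forall>y\<in>ball p r. \<forall>i j. pderiv_at i (pderiv_at j u) y = hess A b (g y) (u y) (\<lambda>k. pderiv_at k u y) y i j)"
proof -
  obtain r where r: "r > 0" "ball p r \<subseteq> Y3"
    and ex: "\<And>q v. q \<in> ball p r \<Longrightarrow> \<exists>U. pfaffian_solution (conn A b) (ball p r) U \<and> (\<forall>a. U a q = v a)"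
    by (rule pfaffian_local_theory[where Om="conn A b", OF slicewise_conn p conn_flat]) auto
  have pp: "p \<in> ball p r" using r by simp
  obtain U where U: "pfaffian_solution (conn A b) (ball p r) U" "\<And>a. U a p = 1"
    using ex[OF pp, of "\<lambda>a. 1"] by auto
  define g where "g y = U Aux y / ((1 - y $ 1) * (1 - y $ 3))" for y
  have "g p \<noteq> 0" using U(2) Y3_D[OF p] by (simp add: g_def)
  moreover have "slicewise (U Val) (ball p r)" using U(1) by (simp add: pfaffian_solution_def)
  moreover have "pderiv_at i (pderiv_at j (U Val)) y = hess A b (g y) (U Val y) (\<lambda>k. pderiv_at k (U Val) y) y i j"
    if "y \<in> ball p r" for y i j
    unfolding g_def by (rule pfaffian_imp_hess[OF U(1) r(2) that])
  ultimately show ?thesis using r by blast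
qed

section \<open>The change of variables and the restricted hypergeometric system\<close>

text \<open>
  The algebra behind the theorem, for the second order jet of \<open>w\<close> expressed by that of \<open>u\<close> through
  \<open>r = 1 / (1 - x\<^sub>1)\<close>. Each of the five expressions is a combination of the relations between the
  \<open>h\<close>'s in which \<open>g\<close> cancels; for example the fifth one involves \<open>L\<^sub>3\<close> and \<open>L\<^sub>1\<^sub>3\<close> only.
\<close>

lemma E36_core:
  fixes y1 y2 y3 :: complex
  assumes k1: "(1 - y1) * k1 = 1" and k3: "(1 - y3) * k3 = 1"
    and r: "r = (1 - y3) * k1" and x1: "x1 = (y1 - y3) * k3"
    and h12: "(y1 - y2) * h12 = b2 * u1 - b1 * u2 + (1 - y3) * g"
    and h23: "(y2 - y3) * h23 = b3 * u2 - b2 * u3 + (1 - y1) * g"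
    and h13: "(y1 - y3) * h13 = b3 * u1 - b1 * u3"
    and d1: "(1 - y1) * (y1 * h11 + y2 * h12 + y3 * h13) =
      A * b1 * u - (A + b1 + b3 - (1 + A) * y1) * u1 + b1 * (y1 * u1 + y2 * u2 + y3 * u3)"
    and d2: "(1 - y2) * (y1 * h12 + y2 * h22 + y3 * h23) =
      A * b2 * u - (A + b1 + b3 - (1 + A) * y2) * u2 + b2 * (y1 * u1 + y2 * u2 + y3 * u3) + (y1 - y3) * g"
    and d3: "(1 - y3) * (y1 * h13 + y2 * h23 + y3 * h33) =
      A * b3 * u - (A + b1 + b3 - (1 + A) * y3) * u3 + b3 * (y1 * u1 + y2 * u2 + y3 * u3)"
    and t: "t1 = x1 * (b3 * r * u - r * (1 - y3) * u3)" "t2 = y1 * (u1 + r * u3)" "t3 = y2 * u2"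
    and T11: "T11 = x1 * x1 * (b3 * (b3 + 1) * r^2 * u - (2 * b3 + 2) * r^2 * (1 - y3) * u3 + r^2 * (1 - y3)^2 * h33) + t1"
    and T12: "T12 = x1 * y1 * (b3 * r * u1 + b3 * r^2 * u3 + r^2 * u3 - r * (1 - y3) * h13 - r^2 * (1 - y3) * h33)"
    and T13: "T13 = x1 * y2 * (b3 * r * u2 - r * (1 - y3) * h23)"
    and T22: "T22 = y1 * y1 * (h11 + 2 * r * h13 + r^2 * h33) + t2"
    and T23: "T23 = y1 * y2 * (h12 + r * h23)"
    and T33: "T33 = y2 * y2 * h22 + t3"
    and s: "s = b3 + A + b1 - 1"
  shows "T11 + T12 + T13 + s * t1 - x1 * (T11 + T12 + b3 * (t1 + t2) + (b1 + b3) * t1 + (b1 + b3) * b3 * u) = 0" (is ?E1)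
    and "T12 + T22 + T23 + s * t2 - y1 * (T12 + T13 + T22 + T23 + A * (t1 + t2) + (b1 + b3) * (t2 + t3) + (b1 + b3) * A * u) = 0" (is ?E2)
    and "T13 + T23 + T33 + s * t3 - y2 * (T23 + T33 + A * t3 + b2 * (t2 + t3) + b2 * A * u) = 0" (is ?E3)
    and "y1 * (T13 + T23 + (b1 + b3) * t3) - y2 * (T23 + b2 * t2) = 0" (is ?E4)
    and "x1 * (T12 + b3 * t2) - y1 * (T12 + T13 + A * t1) = 0" (is ?E5)
proof -
  show ?E4 using k1 k3 r x1 h12 h23 t T13 T23 by algebra
  show ?E3 using k1 k3 r x1 h23 d2 t T13 T23 T33 s by algebra
  show ?E5 using k1 k3 r x1 h13 d3 t T12 T13 by algebra
  have y3: "y3 = 1 - r + r * y1" and x1r: "x1 * r = r - 1" and r0: "r \<noteq> 0"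
    using k1 k3 r x1 by algebra+
  have t': "t1 = (r - 1) * (b3 * u - (1 - y3) * u3)"
    "T11 = (r - 1)^2 * (b3 * (b3 + 1) * u - (2 * b3 + 2) * (1 - y3) * u3 + (1 - y3)^2 * h33) + t1"
    "T12 = (r - 1) * y1 * (b3 * u1 + b3 * r * u3 + r * u3 - (1 - y3) * h13 - r * (1 - y3) * h33)"
    "T13 = (r - 1) * y2 * (b3 * u2 - (1 - y3) * h23)"
    unfolding x1r[symmetric] t(1) T11 T12 T13 by (simp_all add: algebra_simps power2_eq_square)
  \<comment> \<open>as \<open>y3\<close> is a polynomial in \<open>r\<close> and \<open>y1\<close>, the combinations become polynomial identities without
    side conditions; multiplication by \<open>r\<close> removes the explicit \<open>x1\<close>, since \<open>x1 r = r - 1\<close>\<close>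
  define l1 where "l1 = (1 - y1) * (y1 * h11 + y2 * h12 + y3 * h13) -
      (A * b1 * u - (A + b1 + b3 - (1 + A) * y1) * u1 + b1 * (y1 * u1 + y2 * u2 + y3 * u3))"
  define l3 where "l3 = (1 - y3) * (y1 * h13 + y2 * h23 + y3 * h33) -
      (A * b3 * u - (A + b1 + b3 - (1 + A) * y3) * u3 + b3 * (y1 * u1 + y2 * u2 + y3 * u3))"
  define l13 where "l13 = (y1 - y3) * h13 - (b3 * u1 - b1 * u3)"
  have l0: "l1 = 0" "l3 = 0" "l13 = 0" using d1 d3 h13 by (simp_all add: l1_def l3_def l13_def)
  have "r * (T11 + T12 + T13 + s * t1) - (x1 * r) * (T11 + T12 + b3 * (t1 + t2) + (b1 + b3) * t1 + (b1 + b3) * b3 * u)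
      = (1 - r) * r * (l3 - y1 * l13)"
    unfolding x1r t'(2-4) t'(1) t(2) s l3_def l13_def y3 by algebra
  then have "r * (T11 + T12 + T13 + s * t1 - x1 * (T11 + T12 + b3 * (t1 + t2) + (b1 + b3) * t1 + (b1 + b3) * b3 * u)) = 0"
    unfolding l0 by (simp add: right_diff_distrib mult.assoc mult.left_commute[of r])
  then show ?E1 using r0 by simp
  have "T12 + T22 + T23 + s * t2 - y1 * (T12 + T13 + T22 + T23 + A * (t1 + t2) + (b1 + b3) * (t2 + t3) + (b1 + b3) * A * u)
      = y1 * l1 + y1 * r * l3 - y1 * (r - 1) * l13"
    unfolding t'(2-4) T22 T23 t'(1) t(2,3) s l1_def l3_def l13_def y3 by algebra
  then show ?E2 unfolding l0 by simp
qed

definition rho :: "3 cfun" where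
  "rho y = (1 - y $ 3) / (1 - y $ 1)"

text \<open>
  The operator on functions of \<open>y\<close> that corresponds to \<open>\<partial>/\<partial>x\<^sub>i\<close> acting on
  \<open>(1 - x\<^sub>1)\<^bsup>-s\<^esup> \<cdot> (f \<circ> psi)\<close>. Expressing its coefficients in \<open>y\<close> allows it to be iterated.
\<close>

definition pulled_field :: "complex \<Rightarrow> 3 \<Rightarrow> 3 cfun \<Rightarrow> 3 cfun" where
  "pulled_field s i f y =
     (if i = 1 then s * (rho y * f y) - (rho y * (1 - y $ 3)) * pderiv_at 3 f y
      else if i = 2 then pderiv_at 1 f y + rho y * pderiv_at 3 f y
      else pderiv_at 2 f y)"

lemma psi_nth: "psi x $ 1 = x $ 2" "psi x $ 2 = x $ 3" "psi x $ 3 = (x $ 2 - x $ 1) / (1 - x $ 1)"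
  by (simp_all add: psi_def)

lemma slicewise_psi:
  assumes U: "open U" "\<And>x. x \<in> U \<Longrightarrow> x $ 1 \<noteq> 1"
  shows "slicewise (\<lambda>x. psi x $ k) U"
proof -
  have "slicewise (\<lambda>x. (x $ 2 - x $ 1) / (1 - x $ 1)) U"
    using U by (intro slicewise_divide slicewise_diff slicewise_coord slicewise_const) auto
  then have "slicewise (\<lambda>x. psi x $ 1) U" "slicewise (\<lambda>x. psi x $ 2) U" "slicewise (\<lambda>x. psi x $ 3) U"
    unfolding psi_nth by (simp_all add: slicewise_coord U)
  then show ?thesis using exhaust_3[of k] by auto
qed

lemma pderiv_psi:
  assumes x: "x $ 1 \<noteq> 1"
  shows "pderiv_at i (\<lambda>x. psi x $ 1) x = (if i = 2 then 1 else 0)"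
    and "pderiv_at i (\<lambda>x. psi x $ 2) x = (if i = 3 then 1 else 0)"
    and "pderiv_at 1 (\<lambda>x. psi x $ 3) x = - ((1 - x $ 2) / (1 - x $ 1)\<^sup>2)"
    and "pderiv_at 2 (\<lambda>x. psi x $ 3) x = 1 / (1 - x $ 1)"
    and "pderiv_at 3 (\<lambda>x. psi x $ 3) x = 0"
  unfolding psi_nth
proof -
  show "pderiv_at i (\<lambda>x. x $ 2) x = (if i = 2 then 1 else 0)" "pderiv_at i (\<lambda>x. x $ 3) x = (if i = 3 then 1 else 0)"
    by (rule pderiv_coord)+
  have "pderiv_at 1 (\<lambda>x. (x $ 2 - x $ 1) / (1 - x $ 1)) x = - (1 - x $ 2) / (1 - x $ 1)\<^sup>2"
  proof (rule pderiv_atI)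
    have "((\<lambda>t. (x $ 2 - (x $ 1 + t)) / (1 - (x $ 1 + t))) has_field_derivative - (1 - x $ 2) / (1 - x $ 1)\<^sup>2) (at 0)"
      using x by (auto intro!: derivative_eq_intros simp: power2_eq_square)
    then show "((\<lambda>t. ((x + axis 1 t) $ 2 - (x + axis 1 t) $ 1) / (1 - (x + axis 1 t) $ 1)) has_field_derivative - (1 - x $ 2) / (1 - x $ 1)\<^sup>2) (at 0)"
      by (simp add: axis_def)
  qed
  then show "pderiv_at 1 (\<lambda>x. (x $ 2 - x $ 1) / (1 - x $ 1)) x = - ((1 - x $ 2) / (1 - x $ 1)\<^sup>2)"
    by (simp only: minus_divide_left)
  show "pderiv_at 2 (\<lambda>x. (x $ 2 - x $ 1) / (1 - x $ 1)) x = 1 / (1 - x $ 1)"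
  proof (rule pderiv_atI)
    have "((\<lambda>t. (x $ 2 + t - x $ 1) / (1 - x $ 1)) has_field_derivative 1 / (1 - x $ 1)) (at 0)"
      using x by (auto intro!: derivative_eq_intros)
    then show "((\<lambda>t. ((x + axis 2 t) $ 2 - (x + axis 2 t) $ 1) / (1 - (x + axis 2 t) $ 1)) has_field_derivative 1 / (1 - x $ 1)) (at 0)"
      by (simp add: axis_def)
  qed
  show "pderiv_at 3 (\<lambda>x. (x $ 2 - x $ 1) / (1 - x $ 1)) x = 0"
    by (rule pderiv_atI) (simp add: axis_def)
qed

lemma pull_pderiv:
  assumes U: "open U" "\<And>x. x \<in> U \<Longrightarrow> x $ 1 \<noteq> 1"
    and L: "slicewise L U" "\<And>x. x \<in> U \<Longrightarrow> exp (L x) = 1 - x $ 1"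
    and f: "slicewise f N" and sub: "\<And>x. x \<in> U \<Longrightarrow> psi x \<in> N" "N \<subseteq> Y3"
  shows "slicewise (\<lambda>x. exp (- s * L x) * f (psi x)) U"
    and "x \<in> U \<Longrightarrow> pderiv_at i (\<lambda>x. exp (- s * L x) * f (psi x)) x = exp (- s * L x) * pulled_field s i f (psi x)"
proof -
  have sL: "slicewise (\<lambda>x. - s * L x) U"
    by (intro slicewise_mult slicewise_const U L)
  have sE: "slicewise (\<lambda>x. exp (- s * L x)) U"
    by (rule slicewise_compose_holomorphic[OF sL holomorphic_on_exp open_UNIV]) simp
  have sF: "slicewise (\<lambda>x. f (psi x)) U"
    by (rule slicewise_compose(1)[OF f slicewise_psi[OF U] sub(1)])
  show "slicewise (\<lambda>x. exp (- s * L x) * f (psi x)) U"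
    by (rule slicewise_mult[OF sE sF])
  assume x: "x \<in> U"
  have x1: "1 - x $ 1 \<noteq> 0" using U(2)[OF x] by simp
  have dL: "pderiv_at i L x = (if i = 1 then - 1 / (1 - x $ 1) else 0)"
  proof -
    have "((\<lambda>t. exp (L (x + axis i t))) has_field_derivative exp (L x) * pderiv_at i L x) (at 0)"
      using DERIV_chain2[OF DERIV_exp slicewise_deriv[OF L(1) x, of i]] by simp
    then have A: "pderiv_at i (\<lambda>x. exp (L x)) x = (1 - x $ 1) * pderiv_at i L x"
      using L(2)[OF x] by (simp add: pderiv_atI)
    have B: "pderiv_at i (\<lambda>x. exp (L x)) x = pderiv_at i (\<lambda>x. 1 - x $ 1) x"
      by (rule pderiv_at_cong, rule eventually_mono[OF eventually_nhds_in_open[OF U(1) x]], rule L(2))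
    have C: "pderiv_at i (\<lambda>x. 1 - x $ 1) x = 0 - (if i = 1 then 1 else 0)"
      unfolding pderiv_diff[OF slicewise_const[OF U(1)] slicewise_coord[OF U(1)] x] pderiv_const pderiv_coord ..
    have "(1 - x $ 1) * pderiv_at i L x = 0 - (if i = 1 then 1 else 0)"
      unfolding A[symmetric] B C ..
    then have "pderiv_at i L x = (0 - (if i = 1 then 1 else 0)) / (1 - x $ 1)"
      by (metis nonzero_mult_div_cancel_left x1)
    then show ?thesis by simp
  qed
  have dE: "pderiv_at i (\<lambda>x. exp (- s * L x)) x = exp (- s * L x) * (- s * pderiv_at i L x)"
    using DERIV_chain2[OF DERIV_exp DERIV_cmult[OF slicewise_deriv[OF L(1) x, of i], of "- s"]]
    by (intro pderiv_atI) simp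
  have dF: "pderiv_at i (\<lambda>x. f (psi x)) x = (\<Sum>k\<in>UNIV. pderiv_at k f (psi x) * pderiv_at i (\<lambda>x. psi x $ k) x)"
    by (rule slicewise_compose(2)[OF f slicewise_psi[OF U] sub(1) x])
  have Y: "psi x \<in> Y3" using sub x by blast
  then have "psi x $ 1 \<noteq> 1" by (simp add: Y3_def)
  then have x2: "1 - x $ 2 \<noteq> 0" by (simp add: psi_nth)
  have y3: "1 - psi x $ 3 = (1 - x $ 2) / (1 - x $ 1)" using x1 by (simp add: psi_nth field_simps)
  have rho: "rho (psi x) = 1 / (1 - x $ 1)"
    unfolding rho_def y3 psi_nth(1) using x1 x2 by simp
  have main: "pderiv_at i (\<lambda>x. exp (- s * L x) * f (psi x)) x =
      exp (- s * L x) * (- s * pderiv_at i L x * f (psi x) + pderiv_at i (\<lambda>x. f (psi x)) x)"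
    unfolding pderiv_mult[OF sE sF x] dE by (simp add: algebra_simps)
  have "i = 1 \<or> i = 2 \<or> i = 3" using exhaust_3 by auto
  then have "- s * pderiv_at i L x * f (psi x) + pderiv_at i (\<lambda>x. f (psi x)) x = pulled_field s i f (psi x)"
    unfolding pulled_field_def rho y3 dL dF sum_3
    by (elim disjE) (simp_all add: pderiv_psi[OF U(2)[OF x]] power2_eq_square mult.commute)
  with main show "pderiv_at i (\<lambda>x. exp (- s * L x) * f (psi x)) x = exp (- s * L x) * pulled_field s i f (psi x)"
    by simp
qed

lemma slicewise_rho: "open N \<Longrightarrow> N \<subseteq> Y3 \<Longrightarrow> slicewise rho N"
  unfolding rho_def[abs_def]
  by (intro slicewise_divide slicewise_diff slicewise_const slicewise_coord) (auto simp: Y3_def)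

lemma pderiv_rho:
  assumes y: "y \<in> Y3"
  shows "pderiv_at 1 rho y = rho y / (1 - y $ 1)" "pderiv_at 2 rho y = 0" "pderiv_at 3 rho y = - 1 / (1 - y $ 1)"
proof -
  have ne: "1 - y $ 1 \<noteq> 0" using y by (auto simp: Y3_def)
  show "pderiv_at 1 rho y = rho y / (1 - y $ 1)"
  proof (rule pderiv_atI)
    have "((\<lambda>t. (1 - y $ 3) / (1 - (y $ 1 + t))) has_field_derivative rho y / (1 - y $ 1)) (at 0)"
      using ne by (auto intro!: derivative_eq_intros simp: rho_def)
    then show "((\<lambda>t. rho (y + axis 1 t)) has_field_derivative rho y / (1 - y $ 1)) (at 0)"
      by (simp add: rho_def axis_def)
  qed
  show "pderiv_at 2 rho y = 0"
    by (rule pderiv_atI) (simp add: rho_def axis_def)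
  show "pderiv_at 3 rho y = - 1 / (1 - y $ 1)"
  proof (rule pderiv_atI)
    have "((\<lambda>t. 1 - (y $ 3 + t)) has_field_derivative - 1) (at 0)"
      by (auto intro!: derivative_eq_intros)
    from DERIV_cdivide[OF this, of "1 - y $ 1"]
    have "((\<lambda>t. (1 - (y $ 3 + t)) / (1 - y $ 1)) has_field_derivative - 1 / (1 - y $ 1)) (at 0)" .
    then show "((\<lambda>t. rho (y + axis 3 t)) has_field_derivative - 1 / (1 - y $ 1)) (at 0)"
      by (simp add: rho_def axis_def)
  qed
qed

lemma slicewise_pulled_field:
  assumes f: "slicewise f N" and N: "N \<subseteq> Y3"
  shows "slicewise (pulled_field s i f) N"
proof -
  have o: "open N" using f by (rule slicewise_open)
  have i: "i = 1 \<or> i = 2 \<or> i = 3" using exhaust_3 by auto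
  have 1: "slicewise (\<lambda>y. s * (rho y * f y) - (rho y * (1 - y $ 3)) * pderiv_at 3 f y) N"
    by (intro slicewise_diff slicewise_mult slicewise_const[OF o] slicewise_coord[OF o] slicewise_rho[OF o N] f slicewise_pderiv[OF f])
  have 2: "slicewise (\<lambda>y. pderiv_at 1 f y + rho y * pderiv_at 3 f y) N"
    by (intro slicewise_add slicewise_mult slicewise_rho[OF o N] slicewise_pderiv[OF f])
  from i show ?thesis
  proof (elim disjE)
    assume "i = 1" then show ?thesis by (intro slicewise_cong[OF 1]) (simp add: pulled_field_def)
  next
    assume "i = 2" then show ?thesis by (intro slicewise_cong[OF 2]) (simp add: pulled_field_def)
  next
    assume "i = 3" then show ?thesis by (intro slicewise_cong[OF slicewise_pderiv[OF f, of 2]]) (simp add: pulled_field_def)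
  qed
qed

text \<open>
  The functions \<open>rho\<close> and \<open>1 - y\<^sub>3\<close> have simple derivatives along the second field: it kills
  \<open>rho\<close>, which is why no first order term appears in the fourth formula.
\<close>

lemma pulled_field_twice:
  assumes u: "slicewise u N" and N: "N \<subseteq> Y3" and y: "y \<in> N"
  defines "h \<equiv> \<lambda>i j. pderiv_at i (pderiv_at j u) y" and "p \<equiv> \<lambda>i. pderiv_at i u y" and "r \<equiv> rho y"
  shows "pulled_field s 1 (pulled_field s 1 u) y = s * (s + 1) * r^2 * u y - (2 * s + 2) * r^2 * (1 - y $ 3) * p 3 + r^2 * (1 - y $ 3)^2 * h 3 3"
    and "pulled_field s 2 (pulled_field s 1 u) y = s * r * p 1 + s * r^2 * p 3 + r^2 * p 3 - r * (1 - y $ 3) * h 1 3 - r^2 * (1 - y $ 3) * h 3 3"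
    and "pulled_field s 3 (pulled_field s 1 u) y = s * r * p 2 - r * (1 - y $ 3) * h 2 3"
    and "pulled_field s 2 (pulled_field s 2 u) y = h 1 1 + 2 * r * h 1 3 + r^2 * h 3 3"
    and "pulled_field s 3 (pulled_field s 2 u) y = h 1 2 + r * h 2 3"
    and "pulled_field s 3 (pulled_field s 3 u) y = h 2 2"
proof -
  have o: "open N" using u by (rule slicewise_open)
  have Y: "y \<in> Y3" using y N by blast
  have ne: "1 - y $ 1 \<noteq> 0" using Y by (auto simp: Y3_def)
  note su = slicewise_pderiv[OF u] and sr = slicewise_rho[OF o N] and sc = slicewise_const[OF o] and sx = slicewise_coord[OF o]
  have f1: "pulled_field s 1 u = (\<lambda>y. s * (rho y * u y) - (rho y * (1 - y $ 3)) * pderiv_at 3 u y)"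
    and f2: "pulled_field s 2 u = (\<lambda>y. pderiv_at 1 u y + rho y * pderiv_at 3 u y)"
    and f3: "pulled_field s 3 u = pderiv_at 2 u"
    by (simp_all add: fun_eq_iff pulled_field_def)
  have d1: "pderiv_at k (pulled_field s 1 u) y = s * (pderiv_at k rho y * u y + r * p k)
     - ((pderiv_at k rho y * (1 - y $ 3) + r * (0 - (if k = 3 then 1 else 0))) * p 3 + (r * (1 - y $ 3)) * h k 3)" for k
    unfolding f1
      pderiv_diff[OF slicewise_mult[OF sc slicewise_mult[OF sr u]] slicewise_mult[OF slicewise_mult[OF sr slicewise_diff[OF sc sx]] su] y]
      pderiv_mult[OF sc slicewise_mult[OF sr u] y] pderiv_mult[OF sr u y]
      pderiv_mult[OF slicewise_mult[OF sr slicewise_diff[OF sc sx]] su y] pderiv_mult[OF sr slicewise_diff[OF sc sx] y]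
      pderiv_diff[OF sc sx y] pderiv_const pderiv_coord p_def h_def r_def by simp
  have d2: "pderiv_at k (pulled_field s 2 u) y = h k 1 + (pderiv_at k rho y * p 3 + r * h k 3)" for k
    unfolding f2 pderiv_add[OF su slicewise_mult[OF sr su] y] pderiv_mult[OF sr su y] p_def h_def r_def by simp
  have sym: "h 3 1 = h 1 3" "h 2 1 = h 1 2" "h 3 2 = h 2 3"
    unfolding h_def by (rule pderiv_commute[OF u y])+
  have F1: "pulled_field s 1 u y = s * (r * u y) - (r * (1 - y $ 3)) * p 3"
    by (simp add: pulled_field_def p_def r_def)
  define k where "k = 1 / (1 - y $ 1)"
  have k: "(1 - y $ 1) * k = 1" "r = (1 - y $ 3) * k" using ne by (simp_all add: k_def r_def rho_def)
  have dr: "pderiv_at 1 rho y = r * k" "pderiv_at 2 rho y = 0" "pderiv_at 3 rho y = - k"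
    unfolding pderiv_rho[OF Y] by (simp_all add: k_def r_def)
  show "pulled_field s 1 (pulled_field s 1 u) y = s * (s + 1) * r^2 * u y - (2 * s + 2) * r^2 * (1 - y $ 3) * p 3 + r^2 * (1 - y $ 3)^2 * h 3 3"
    unfolding pulled_field_def[of s 1 "pulled_field s 1 u"] by (simp add: d1 F1 dr flip: r_def) (use k in algebra)
  show "pulled_field s 2 (pulled_field s 1 u) y = s * r * p 1 + s * r^2 * p 3 + r^2 * p 3 - r * (1 - y $ 3) * h 1 3 - r^2 * (1 - y $ 3) * h 3 3"
    unfolding pulled_field_def[of s 2 "pulled_field s 1 u"] by (simp add: d1 dr flip: r_def) (simp add: algebra_simps power2_eq_square)
  show "pulled_field s 3 (pulled_field s 1 u) y = s * r * p 2 - r * (1 - y $ 3) * h 2 3"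
    unfolding pulled_field_def[of s 3 "pulled_field s 1 u"] by (simp add: d1 dr)
  show "pulled_field s 2 (pulled_field s 2 u) y = h 1 1 + 2 * r * h 1 3 + r^2 * h 3 3"
    unfolding pulled_field_def[of s 2 "pulled_field s 2 u"]
    by (simp add: d2 dr sym flip: r_def) (simp add: algebra_simps power2_eq_square)
  show "pulled_field s 3 (pulled_field s 2 u) y = h 1 2 + r * h 2 3"
    unfolding pulled_field_def[of s 3 "pulled_field s 2 u"] by (simp add: d2 dr sym)
  show "pulled_field s 3 (pulled_field s 3 u) y = h 2 2"
    by (simp add: pulled_field_def[of s 3 "pulled_field s 3 u"]) (simp add: f3 h_def)
qed

lemma euler_euler:
  assumes w: "slicewise w N" and x: "x \<in> N" and I: "finite I" "finite J"
  shows "euler J d (euler I c w) x =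
    (\<Sum>j\<in>J. \<Sum>i\<in>I. x $ j * x $ i * pderiv_at j (pderiv_at i w) x + (if j = i then x $ i * pderiv_at i w x else 0))
    + c * (\<Sum>j\<in>J. x $ j * pderiv_at j w x) + d * (\<Sum>i\<in>I. x $ i * pderiv_at i w x) + d * c * w x"
proof -
  have "euler J d (euler I c w) x = (\<Sum>j\<in>J. x $ j * pderiv_at j (euler I c w) x) + d * euler I c w x"
    by (simp add: euler_def)
  also have "(\<Sum>j\<in>J. x $ j * pderiv_at j (euler I c w) x) =
     (\<Sum>j\<in>J. (\<Sum>i\<in>I. x $ j * x $ i * pderiv_at j (pderiv_at i w) x + (if j = i then x $ i * pderiv_at i w x else 0)) + c * (x $ j * pderiv_at j w x))"
  proof (intro sum.cong refl)
    fix j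
    have "x $ j * (\<Sum>i\<in>I. (if j = i then pderiv_at i w x else 0) + x $ i * pderiv_at j (pderiv_at i w) x) =
      (\<Sum>i\<in>I. x $ j * x $ i * pderiv_at j (pderiv_at i w) x + (if j = i then x $ i * pderiv_at i w x else 0))"
      unfolding sum_distrib_left by (intro sum.cong refl) (simp add: distrib_left)
    then show "x $ j * pderiv_at j (euler I c w) x =
      (\<Sum>i\<in>I. x $ j * x $ i * pderiv_at j (pderiv_at i w) x + (if j = i then x $ i * pderiv_at i w x else 0)) + c * (x $ j * pderiv_at j w x)"
      unfolding euler_jet[OF w x I(1)] by (simp add: distrib_left)
  qed
  also have "\<dots> = (\<Sum>j\<in>J. \<Sum>i\<in>I. x $ j * x $ i * pderiv_at j (pderiv_at i w) x + (if j = i then x $ i * pderiv_at i w x else 0))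
    + c * (\<Sum>j\<in>J. x $ j * pderiv_at j w x)"
    by (simp add: sum.distrib sum_distrib_left)
  finally show ?thesis unfolding euler_def[of I c w x] by (simp add: distrib_left)
qed

lemma open_X3: "open X3"
proof -
  have "X3 = {x. x $ 1 \<noteq> 0 \<and> x $ 2 \<noteq> 0 \<and> x $ 3 \<noteq> 0 \<and> x $ 1 \<noteq> 1 \<and> x $ 2 \<noteq> 1 \<and> x $ 3 \<noteq> 1 \<and>
      x $ 1 \<noteq> x $ 2 \<and> x $ 2 \<noteq> x $ 3 \<and> x $ 1 * x $ 3 - x $ 1 - x $ 3 + x $ 2 \<noteq> 0}"
    by (auto simp: X3_def forall_3)
  also have "open \<dots>"
    by (intro open_Collect_conj open_Collect_neq continuous_intros)
  finally show ?thesis .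
qed

definition psi_inv :: "complex ^ 3 \<Rightarrow> complex ^ 3" where
  "psi_inv y = vector [(y $ 1 - y $ 3) / (1 - y $ 3), y $ 1, y $ 2]"

lemma psi_inv_nth: "psi_inv y $ 1 = (y $ 1 - y $ 3) / (1 - y $ 3)" "psi_inv y $ 2 = y $ 1" "psi_inv y $ 3 = y $ 2"
  by (simp_all add: psi_inv_def)

lemma X3_D:
  assumes "x \<in> X3"
  shows "x $ 1 \<noteq> 0" "x $ 2 \<noteq> 0" "x $ 3 \<noteq> 0" "x $ 1 \<noteq> 1" "x $ 2 \<noteq> 1" "x $ 3 \<noteq> 1"
    "x $ 1 \<noteq> x $ 2" "x $ 2 \<noteq> x $ 3" "x $ 1 * x $ 3 - x $ 1 - x $ 3 + x $ 2 \<noteq> 0"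
  using assms by (auto simp: X3_def)

lemma psi_in_Y3:
  assumes x: "x \<in> X3"
  shows "psi x \<in> Y3"
proof -
  note D = X3_D[OF x]
  have "1 - x $ 1 \<noteq> 0" using D by simp
  then have "(x $ 2 - x $ 1) / (1 - x $ 1) \<noteq> 0" "(x $ 2 - x $ 1) / (1 - x $ 1) \<noteq> 1"
    "(x $ 2 - x $ 1) / (1 - x $ 1) \<noteq> x $ 2" "(x $ 2 - x $ 1) / (1 - x $ 1) \<noteq> x $ 3"
    using D by (auto simp: divide_eq_eq algebra_simps)
  then show ?thesis
    using D by (auto simp: Y3_def forall_3 psi_nth)
qed

lemma psi_inv_in_X3:
  assumes y: "y \<in> Y3"
  shows "psi_inv y \<in> X3"
proof -
  note D = Y3_D[OF y]
  have n: "1 - y $ 3 \<noteq> 0" using D by simp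
  then have "(y $ 1 - y $ 3) / (1 - y $ 3) \<noteq> 0" "(y $ 1 - y $ 3) / (1 - y $ 3) \<noteq> 1"
    "(y $ 1 - y $ 3) / (1 - y $ 3) \<noteq> y $ 1"
    using D by (auto simp: divide_eq_eq algebra_simps)
  moreover have "(y $ 1 - y $ 3) / (1 - y $ 3) * y $ 2 - (y $ 1 - y $ 3) / (1 - y $ 3) - y $ 2 + y $ 1 =
      (1 - y $ 1) * (y $ 3 - y $ 2) / (1 - y $ 3)"
  proof -
    define d where "d = 1 / (1 - y $ 3)"
    have e: "(1 - y $ 3) * d = 1" using n by (simp add: d_def)
    show ?thesis unfolding divide_via_inverse[OF e] using e by algebra
  qed
  ultimately show ?thesis
    using D n by (auto simp: X3_def forall_3 psi_inv_nth)
qed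

lemma psi_inv_psi:
  assumes x: "x \<in> X3"
  shows "psi_inv (psi x) = x"
proof -
  note D = X3_D[OF x]
  have n: "1 - x $ 1 \<noteq> 0" "1 - x $ 2 \<noteq> 0" using D by simp_all
  have "1 - psi x $ 3 = (1 - x $ 2) / (1 - x $ 1)"
    using n by (simp add: psi_nth field_simps)
  moreover have "psi x $ 1 - psi x $ 3 = x $ 1 * ((1 - x $ 2) / (1 - x $ 1))"
    using n by (simp add: psi_nth field_simps)
  ultimately have "(psi x $ 1 - psi x $ 3) / (1 - psi x $ 3) = x $ 1" using n by simp
  then show ?thesis by (simp add: vec_eq_iff forall_3 psi_inv_nth) (simp add: psi_nth)
qed

lemma psi_psi_inv:
  assumes y: "y \<in> Y3"
  shows "psi (psi_inv y) = y"
proof -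
  note D = Y3_D[OF y]
  have n: "1 - y $ 1 \<noteq> 0" "1 - y $ 3 \<noteq> 0" using D by simp_all
  have "1 - psi_inv y $ 1 = (1 - y $ 1) / (1 - y $ 3)"
    using n by (simp add: psi_inv_nth field_simps)
  moreover have "psi_inv y $ 2 - psi_inv y $ 1 = y $ 3 * ((1 - y $ 1) / (1 - y $ 3))"
    using n by (simp add: psi_inv_nth field_simps)
  ultimately have "(psi_inv y $ 2 - psi_inv y $ 1) / (1 - psi_inv y $ 1) = y $ 3" using n by simp
  then show ?thesis by (simp add: vec_eq_iff forall_3 psi_nth) (simp add: psi_inv_nth)
qed

lemma slicewise_psi_X3: "slicewise (\<lambda>x. psi x $ k) X3"
  by (rule slicewise_psi[OF open_X3 X3_D(4)])

lemma slicewise_psi_inv: "slicewise (\<lambda>y. psi_inv y $ k) Y3"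
proof -
  have "slicewise (\<lambda>y. (y $ 1 - y $ 3) / (1 - y $ 3)) Y3"
    using Y3_D(6) by (intro slicewise_divide slicewise_diff slicewise_coord slicewise_const open_Y3) force
  then have "slicewise (\<lambda>y. psi_inv y $ 1) Y3" "slicewise (\<lambda>y. psi_inv y $ 2) Y3" "slicewise (\<lambda>y. psi_inv y $ 3) Y3"
    unfolding psi_inv_nth by (simp_all add: slicewise_coord open_Y3)
  then show ?thesis using exhaust_3[of k] by auto
qed

lemma biholomorphic_psi: "biholomorphic psi X3 Y3"
proof -
  have bij: "bij_betw psi X3 Y3"
    by (rule bij_betw_byWitness[where f'=psi_inv])
       (auto simp: psi_inv_psi psi_psi_inv psi_in_Y3 psi_inv_in_X3)
  have inv: "the_inv_into X3 psi y = psi_inv y" if "y \<in> Y3" for y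
    using bij that by (intro the_inv_into_f_eq) (auto simp: bij_betw_def psi_psi_inv psi_inv_in_X3)
  show ?thesis
    unfolding biholomorphic_def holo_on_iff_slicewise
  proof (intro conjI allI bij slicewise_psi_X3)
    fix i show "slicewise (\<lambda>y. the_inv_into X3 psi y $ i) Y3"
      by (rule slicewise_cong[OF slicewise_psi_inv]) (simp add: inv)
  qed
qed

lemma continuous_psi:
  assumes x: "x \<in> X3"
  shows "isCont psi x"
proof -
  have "continuous_on X3 (\<lambda>x. \<Sum>k\<in>UNIV. axis k (psi x $ k))"
    using slicewise_psi_X3 by (intro continuous_on_sum continuous_on_axis) (simp add: slicewise_def)
  then have "continuous_on X3 psi" unfolding sum_axis .
  then show ?thesis using x open_X3 by (simp add: continuous_on_eq_continuous_at)
qed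

lemma continuous_psi_inv:
  assumes y: "y \<in> Y3"
  shows "isCont psi_inv y"
proof -
  have "continuous_on Y3 (\<lambda>x. \<Sum>k\<in>UNIV. axis k (psi_inv x $ k))"
    using slicewise_psi_inv by (intro continuous_on_sum continuous_on_axis) (simp add: slicewise_def)
  then have "continuous_on Y3 psi_inv" unfolding sum_axis .
  then show ?thesis using y open_Y3 by (simp add: continuous_on_eq_continuous_at)
qed

lemma eventually_psi:
  assumes x: "x \<in> X3" and P: "\<forall>\<^sub>F y in nhds (psi x). P y"
  shows "\<forall>\<^sub>F z in nhds x. P (psi z)"
proof -
  have "filterlim psi (nhds (psi x)) (nhds x)"
    using continuous_psi[OF x] by (simp add: isCont_def tendsto_at_iff_tendsto_nhds)
  then show ?thesis using P unfolding filterlim_iff by blast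
qed

lemma eventually_psi_inv:
  assumes x: "x \<in> X3" and P: "\<forall>\<^sub>F z in nhds x. P z"
  shows "\<forall>\<^sub>F y in nhds (psi x). P (psi_inv y)"
proof -
  have "filterlim psi_inv (nhds (psi_inv (psi x))) (nhds (psi x))"
    using continuous_psi_inv[OF psi_in_Y3[OF x]] by (simp add: isCont_def tendsto_at_iff_tendsto_nhds)
  then show ?thesis using P unfolding filterlim_iff psi_inv_psi[OF x] by blast
qed

text \<open>
  With \<open>g = 0\<close> this is the inclusion of the Appell--Lauricella solutions; the case \<open>g \<noteq> 0\<close> provides
  the solution outside the subsystem.
\<close>

lemma E36_pull:
  assumes U: "U \<subseteq> X3" and L: "slicewise L U" "\<And>x. x \<in> U \<Longrightarrow> exp (L x) = 1 - x $ 1"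
    and u: "slicewise u N" and sub: "\<And>x. x \<in> U \<Longrightarrow> psi x \<in> N" "N \<subseteq> Y3"
    and hs: "\<And>y i j. y \<in> N \<Longrightarrow> pderiv_at i (pderiv_at j u) y = hess A b (g y) (u y) (\<lambda>k. pderiv_at k u y) y i j"
    and a: "a $ 2 = b $ 3" "a $ 3 = A" "a $ 4 = b $ 1" "1 - a $ 6 = b $ 2" "1 - a $ 5 = b $ 1 + b $ 3"
    and x: "x \<in> U"
  shows "E36_X3 a (\<lambda>x. exp (- (b $ 3) * L x) * u (psi x)) x"
proof -
  define s where "s = b $ 3"
  define w where "w = (\<lambda>x. exp (- s * L x) * u (psi x))"
  define y where "y = psi x"
  have oU: "open U" using L(1) by (rule slicewise_open)
  have ne1: "x $ 1 \<noteq> 1" if "x \<in> U" for x using X3_D(4) U that by blast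
  have y: "y \<in> N" "y \<in> Y3" using sub x by (auto simp: y_def)
  have xX: "x \<in> X3" using U x by blast
  have pull: "x \<in> U \<Longrightarrow> pderiv_at i (\<lambda>x. exp (- s * L x) * f (psi x)) x = exp (- s * L x) * pulled_field s i f (psi x)"
    if "slicewise f N" for f i x
    by (rule pull_pderiv(2)[OF oU]) (use ne1 L sub that in auto)
  have sw: "slicewise w U" unfolding w_def
    by (rule pull_pderiv(1)[OF oU]) (use ne1 L sub u in auto)
  have sX: "slicewise (pulled_field s j u) N" for j by (rule slicewise_pulled_field[OF u sub(2)])
  have pw: "pderiv_at j w z = exp (- s * L z) * pulled_field s j u (psi z)" if "z \<in> U" for j z
    unfolding w_def by (rule pull[OF u that])
  have hw: "pderiv_at i (pderiv_at j w) x = exp (- s * L x) * pulled_field s i (pulled_field s j u) y" for i j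
  proof -
    have "pderiv_at i (pderiv_at j w) x = pderiv_at i (\<lambda>z. exp (- s * L z) * pulled_field s j u (psi z)) x"
      by (rule pderiv_at_cong, rule eventually_mono[OF eventually_nhds_in_open[OF oU x]], rule pw)
    also have "\<dots> = exp (- s * L x) * pulled_field s i (pulled_field s j u) y"
      unfolding y_def by (rule pull[OF sX x])
    finally show ?thesis .
  qed
  have symX: "pulled_field s i (pulled_field s j u) y = pulled_field s j (pulled_field s i u) y" for i j
    using pderiv_commute[OF sw x, of i j] unfolding hw by simp
  define t where "t j = x $ j * pulled_field s j u y" for j
  define T where "T i j = x $ i * x $ j * pulled_field s i (pulled_field s j u) y + (if i = j then t j else 0)" for i j
  have symT: "T 2 1 = T 1 2" "T 3 1 = T 1 3" "T 3 2 = T 2 3"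
    by (simp_all add: T_def symX mult.commute)
  have EE: "euler J d (euler I c w) x = exp (- s * L x) *
     ((\<Sum>j\<in>J. \<Sum>i\<in>I. T j i) + c * (\<Sum>j\<in>J. t j) + d * (\<Sum>i\<in>I. t i) + d * c * u y)" for J I d c
  proof -
    have 1: "(\<Sum>j\<in>J. x $ j * pderiv_at j w x) = exp (- s * L x) * (\<Sum>j\<in>J. t j)" for J
      unfolding sum_distrib_left by (intro sum.cong refl) (simp add: pw[OF x] t_def y_def mult_ac)
    have 2: "(\<Sum>j\<in>J. \<Sum>i\<in>I. x $ j * x $ i * pderiv_at j (pderiv_at i w) x + (if j = i then x $ i * pderiv_at i w x else 0)) =
       exp (- s * L x) * (\<Sum>j\<in>J. \<Sum>i\<in>I. T j i)"
      unfolding sum_distrib_left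
      by (intro sum.cong refl) (simp add: hw pw[OF x] T_def t_def y_def mult_ac distrib_left)
    have 3: "w x = exp (- s * L x) * u y" by (simp add: w_def y_def)
    show ?thesis
      unfolding euler_euler[OF sw x finite finite] 1 2 3 by (simp add: algebra_simps)
  qed
  define p where "p = (\<lambda>i. pderiv_at i u y)"
  define h where "h = (\<lambda>i j. pderiv_at i (pderiv_at j u) y)"
  have hh: "h i j = hess A b (g y) (u y) p y i j" for i j
    unfolding h_def p_def by (rule hs[OF y(1)])
  have symh: "h i j = h j i" for i j unfolding h_def by (rule pderiv_commute[OF u y(1)])
  have off: "i \<noteq> j \<Longrightarrow> (y $ i - y $ j) * h i j = b $ j * p i - b $ i * p j + obstruction i j y * g y" for i j
    unfolding hh by (rule hess_off_eq[OF y(2)])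
  have diag: "(1 - y $ i) * (\<Sum>k\<in>UNIV. y $ k * h i k) =
    A * b $ i * u y - (A + b $ 1 + b $ 3 - (1 + A) * y $ i) * p i + b $ i * (\<Sum>k\<in>UNIV. y $ k * p k) + obstruction i i y * g y" for i
    unfolding hh by (rule hess_diag_eq[OF y(2)])
  have k: "(1 - y $ 1) * (1 / (1 - y $ 1)) = 1" "(1 - y $ 3) * (1 / (1 - y $ 3)) = 1"
    using Y3_D[OF y(2)] by simp_all
  have r: "rho y = (1 - y $ 3) * (1 / (1 - y $ 1))" by (simp add: rho_def)
  have x1: "x $ 1 = (y $ 1 - y $ 3) * (1 / (1 - y $ 3))"
    using psi_inv_psi[OF xX] psi_inv_nth(1)[of y] by (simp add: y_def)
  have y12: "x $ 2 = y $ 1" "x $ 3 = y $ 2" by (simp_all add: y_def psi_nth)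
  note twice = pulled_field_twice[OF u sub(2) y(1), of s]
  have o12: "(y $ 1 - y $ 2) * h 1 2 = b $ 2 * p 1 - b $ 1 * p 2 + (1 - y $ 3) * g y"
    and o23: "(y $ 2 - y $ 3) * h 2 3 = s * p 2 - b $ 2 * p 3 + (1 - y $ 1) * g y"
    and o13: "(y $ 1 - y $ 3) * h 1 3 = s * p 1 - b $ 1 * p 3"
    using off[of 1 2] off[of 2 3] off[of 1 3] by (simp_all add: obstruction_def s_def)
  have D1: "(1 - y $ 1) * (y $ 1 * h 1 1 + y $ 2 * h 1 2 + y $ 3 * h 1 3) =
      A * b $ 1 * u y - (A + b $ 1 + s - (1 + A) * y $ 1) * p 1 + b $ 1 * (y $ 1 * p 1 + y $ 2 * p 2 + y $ 3 * p 3)"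
    and D2: "(1 - y $ 2) * (y $ 1 * h 1 2 + y $ 2 * h 2 2 + y $ 3 * h 2 3) =
      A * b $ 2 * u y - (A + b $ 1 + s - (1 + A) * y $ 2) * p 2 + b $ 2 * (y $ 1 * p 1 + y $ 2 * p 2 + y $ 3 * p 3) + (y $ 1 - y $ 3) * g y"
    and D3: "(1 - y $ 3) * (y $ 1 * h 1 3 + y $ 2 * h 2 3 + y $ 3 * h 3 3) =
      A * s * u y - (A + b $ 1 + s - (1 + A) * y $ 3) * p 3 + s * (y $ 1 * p 1 + y $ 2 * p 2 + y $ 3 * p 3)"
    using diag[of 1] diag[of 2] diag[of 3] symh[of 2 1] symh[of 3 1] symh[of 3 2]
    by (simp_all add: obstruction_def s_def sum_3)
  have t1: "t 1 = x $ 1 * (s * rho y * u y - rho y * (1 - y $ 3) * p 3)"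
    and t2: "t 2 = y $ 1 * (p 1 + rho y * p 3)" and t3: "t 3 = y $ 2 * p 2"
    unfolding t_def y12 by (simp_all add: pulled_field_def p_def)
  have T11: "T 1 1 = x $ 1 * x $ 1 * (s * (s + 1) * (rho y)^2 * u y - (2 * s + 2) * (rho y)^2 * (1 - y $ 3) * p 3 + (rho y)^2 * (1 - y $ 3)^2 * h 3 3) + t 1"
    and T12: "T 1 2 = x $ 1 * y $ 1 * (s * rho y * p 1 + s * (rho y)^2 * p 3 + (rho y)^2 * p 3 - rho y * (1 - y $ 3) * h 1 3 - (rho y)^2 * (1 - y $ 3) * h 3 3)"
    and T13: "T 1 3 = x $ 1 * y $ 2 * (s * rho y * p 2 - rho y * (1 - y $ 3) * h 2 3)"
    and T22: "T 2 2 = y $ 1 * y $ 1 * (h 1 1 + 2 * rho y * h 1 3 + (rho y)^2 * h 3 3) + t 2"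
    and T23: "T 2 3 = y $ 1 * y $ 2 * (h 1 2 + rho y * h 2 3)"
    and T33: "T 3 3 = y $ 2 * y $ 2 * h 2 2 + t 3"
    unfolding T_def y12 symX[of 1 2] symX[of 1 3] symX[of 2 3] twice by (simp_all add: h_def p_def)
  note core = E36_core[OF k r x1 o12 o23 o13 D1 D2 D3 t1 t2 t3 T11 T12 T13 T22 T23 T33 refl]
  have sums: "(\<Sum>j\<in>{1,2,3}. f j) = f 1 + f 2 + f 3" "(\<Sum>j\<in>{1,2}. f j) = f 1 + f 2" "(\<Sum>j\<in>{2,3}. f j) = f 2 + f 3"
    for f :: "3 \<Rightarrow> complex" by simp_all
  have fin: "X - d * Y = 0 \<Longrightarrow> E * X - d * (E * Y) = 0" "e * X - d * Y = 0 \<Longrightarrow> e * (E * X) - d * (E * Y) = 0"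
    for X Y E d e :: complex by algebra+
  have "E36_X3 a w x"
    unfolding E36_X3_def Let_def EE a sums y12 s_def[symmetric]
    apply (intro conjI)
        apply (rule fin(1), use core(1) in \<open>simp add: symT add_ac\<close>)
       apply (rule fin(1), use core(2) in \<open>simp add: symT add_ac\<close>)
      apply (rule fin(1), use core(3) in \<open>simp add: symT add_ac\<close>)
     apply (rule fin(2), use core(4) in \<open>simp add: symT add_ac\<close>)
    apply (rule fin(2), use core(5) in \<open>simp add: symT add_ac\<close>)
    done
  then show ?thesis by (simp add: w_def s_def)
qed

section \<open>Twisted pull-backs\<close>

lemma log_branch:
  assumes p: "p \<in> X3"
  shows "\<exists>r>0. \<exists>L. ball p r \<subseteq> X3 \<and> slicewise L (ball p r) \<and> (\<forall>x\<in>ball p r. exp (L x) = 1 - x $ 1)"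
proof -
  define c where "c = 1 - p $ 1"
  have c: "c \<noteq> 0" using X3_D(4)[OF p] by (simp add: c_def)
  define W where "W = X3 \<inter> (\<lambda>x. (1 - x $ 1) / c) -` (- \<real>\<^sub>\<le>\<^sub>0)"
  have "open ((\<lambda>x :: complex ^ 3. (1 - x $ 1) / c) -` (- \<real>\<^sub>\<le>\<^sub>0))"
    by (intro open_vimage open_Compl closed_nonpos_Reals_complex continuous_intros) (use c in auto)
  then have "open W" unfolding W_def by (intro open_Int open_X3)
  moreover have "p \<in> W" using p c by (simp add: W_def c_def)
  ultimately obtain r where r: "r > 0" "ball p r \<subseteq> W" using openE by blast
  define L where "L = (\<lambda>x :: complex ^ 3. Ln ((1 - x $ 1) / c) + Ln c)"
  have "slicewise (\<lambda>x. (1 - x $ 1) / c) (ball p r)"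
    using c by (intro slicewise_divide slicewise_diff slicewise_const slicewise_coord open_ball)
  moreover have "Ln holomorphic_on (- \<real>\<^sub>\<le>\<^sub>0)" by (rule holomorphic_on_Ln) auto
  ultimately have "slicewise (\<lambda>x. Ln ((1 - x $ 1) / c)) (ball p r)"
    using r by (intro slicewise_compose_holomorphic[of _ _ Ln "- \<real>\<^sub>\<le>\<^sub>0"] open_Compl closed_nonpos_Reals_complex)
      (auto simp: W_def)
  then have "slicewise L (ball p r)"
    unfolding L_def by (intro slicewise_add slicewise_const open_ball)
  moreover have "exp (L x) = 1 - x $ 1" if "x \<in> ball p r" for x
  proof -
    have "x \<in> X3" using r that by (auto simp: W_def)
    then show ?thesis using c X3_D(4) by (simp add: L_def exp_add exp_Ln)
  qed
  moreover have "ball p r \<subseteq> X3" using r by (auto simp: W_def)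
  ultimately show ?thesis using r(1) by blast
qed

text \<open>
  Two logarithms of the same function differ by a continuous function with values in
  \<open>2 \<pi> \<i> \<int>\<close>. Comparison with the value at \<open>q\<close> shows that it is constant near \<open>q\<close>.
\<close>

lemma log_germ_unique:
  fixes L L' :: "complex ^ 'n::finite \<Rightarrow> complex"
  assumes L: "isCont L q" "isCont L' q" and eq: "\<forall>\<^sub>F x in nhds q. exp (L x) = exp (L' x)"
  shows "\<exists>k. \<forall>\<^sub>F x in nhds q. L' x = L x + k"
proof -
  define k where "k = L' q - L q"
  have k: "exp k = 1"
    using eventually_nhds_x_imp_x[OF eq] by (simp add: k_def exp_diff)
  define D where "D x = L' x - L x - k" for x
  have "isCont D q" unfolding D_def using L by (intro continuous_intros)
  then have "(D \<longlongrightarrow> D q) (nhds q)" by (simp add: isCont_def tendsto_at_iff_tendsto_nhds)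
  moreover have "D q = 0" by (simp add: D_def k_def)
  ultimately have "\<forall>\<^sub>F x in nhds q. norm (D x) < 1"
    using tendstoD[of D 0 "nhds q" 1] by simp
  with eq have "\<forall>\<^sub>F x in nhds q. L' x = L x + k"
  proof eventually_elim
    case (elim x)
    have "exp (D x) = 1" using elim(1) k by (simp add: D_def exp_diff)
    then obtain n :: int where n: "Re (D x) = 0" "Im (D x) = of_int (2 * n) * pi"
      unfolding exp_eq_1 by auto
    have "\<bar>Im (D x)\<bar> < 1" using elim(2) abs_Im_le_cmod[of "D x"] by simp
    then have "\<bar>of_int n\<bar> * (2 * pi) < 1" unfolding n by (simp add: abs_mult mult_ac)
    moreover have "\<bar>real_of_int n\<bar> * 1 \<le> \<bar>real_of_int n\<bar> * (2 * pi)"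
      using pi_gt3 by (intro mult_left_mono) simp_all
    ultimately have "\<bar>real_of_int n\<bar> < 1" by linarith
    then have "n = 0" by linarith
    then have "D x = 0" using n by (simp add: complex_eq_iff)
    then show ?case by (simp add: D_def diff_eq_eq add.commute)
  qed
  then show ?thesis by (rule exI)
qed

lemma slicewise_imp_isCont: "slicewise f U \<Longrightarrow> x \<in> U \<Longrightarrow> isCont f x"
  by (auto simp: slicewise_def continuous_on_eq_continuous_at)

lemma power_branch_eq:
  assumes L: "slicewise L B" "\<forall>x\<in>B. exp (L x) = 1 - x $ 1" and z: "z \<in> B"
    and phi: "\<phi> \<in> power_branches (\<lambda>x. 1 - x $ 1) c z"
  shows "\<exists>s. s \<noteq> 0 \<and> (\<forall>\<^sub>F x in nhds z. \<phi> x = s * exp (c * L x))"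
proof -
  have B: "\<forall>\<^sub>F x in nhds z. x \<in> B"
    using slicewise_open[OF L(1)] z by (rule eventually_nhds_in_open)
  obtain L' where L': "holo_at L' z" "\<forall>\<^sub>F x in nhds z. exp (L' x) = 1 - x $ 1 \<and> \<phi> x = exp (c * L' x)"
    using phi unfolding power_branches_def by auto
  obtain U where "z \<in> U" "slicewise L' U"
    using L'(1) unfolding holo_at_def holo_on_iff_slicewise by auto
  then have "isCont L' z" by (intro slicewise_imp_isCont)
  moreover have "\<forall>\<^sub>F x in nhds z. exp (L x) = exp (L' x)"
    using B L'(2) by eventually_elim (simp add: L(2)[rule_format])
  ultimately have "\<exists>k. \<forall>\<^sub>F x in nhds z. L' x = L x + k"
    by (intro log_germ_unique slicewise_imp_isCont[OF L(1) z])
  then obtain k where k: "\<forall>\<^sub>F x in nhds z. L' x = L x + k" ..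
  have "\<forall>\<^sub>F x in nhds z. \<phi> x = exp (c * k) * exp (c * L x)"
    using k L'(2) by eventually_elim (simp add: distrib_left exp_add mult.commute)
  then show ?thesis by (intro exI[of _ "exp (c * k)"]) simp
qed

text \<open>
  Once a logarithm of \<open>1 - x\<^sub>1\<close> is fixed near \<open>z\<close>, all branches of the power are constant multiples
  of one of them, and the constant can be absorbed into \<open>u\<close>. So one branch suffices.
\<close>

lemma twisted_pullback_iff:
  assumes L: "slicewise L B" "\<forall>x\<in>B. exp (L x) = 1 - x $ 1" and z: "z \<in> B"
    and W: "\<And>u s. u \<in> W (psi z) \<Longrightarrow> (\<lambda>y. s * u y) \<in> W (psi z)"
  shows "f \<in> twisted_pullback (\<lambda>x. 1 - x $ 1) c psi W z \<longleftrightarrow>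
    (\<exists>u\<in>W (psi z). germ_eq z f (\<lambda>x. exp (c * L x) * u (psi x)))"
proof -
  have B: "\<forall>\<^sub>F x in nhds z. x \<in> B"
    using slicewise_open[OF L(1)] z by (rule eventually_nhds_in_open)
  show "f \<in> twisted_pullback (\<lambda>x. 1 - x $ 1) c psi W z \<longleftrightarrow>
    (\<exists>u\<in>W (psi z). germ_eq z f (\<lambda>x. exp (c * L x) * u (psi x)))"
  proof
    assume "f \<in> twisted_pullback (\<lambda>x. 1 - x $ 1) c psi W z"
    then obtain \<phi> u where \<phi>: "\<phi> \<in> power_branches (\<lambda>x. 1 - x $ 1) c z" and u: "u \<in> W (psi z)"
      and f: "germ_eq z f (\<lambda>x. \<phi> x * u (psi x))"
      unfolding twisted_pullback_def by auto
    obtain s where s: "\<forall>\<^sub>F x in nhds z. \<phi> x = s * exp (c * L x)" using power_branch_eq[OF L z \<phi>] by auto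
    have "germ_eq z f (\<lambda>x. exp (c * L x) * (s * u (psi x)))"
      using f s unfolding germ_eq_def by eventually_elim simp
    then show "\<exists>u\<in>W (psi z). germ_eq z f (\<lambda>x. exp (c * L x) * u (psi x))"
      using W[OF u, of s] by (intro bexI[of _ "\<lambda>y. s * u y"])
  next
    assume "\<exists>u\<in>W (psi z). germ_eq z f (\<lambda>x. exp (c * L x) * u (psi x))"
    then obtain u where u: "u \<in> W (psi z)" "germ_eq z f (\<lambda>x. exp (c * L x) * u (psi x))" by auto
    have "holo_at L z" using L(1) z unfolding holo_at_def holo_on_iff_slicewise by auto
    moreover have "\<forall>\<^sub>F x in nhds z. exp (L x) = 1 - x $ 1 \<and> exp (c * L x) = exp (c * L x)"
      using B by eventually_elim (simp add: L(2)[rule_format])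
    ultimately have "(\<lambda>x. exp (c * L x)) \<in> power_branches (\<lambda>x. 1 - x $ 1) c z"
      unfolding power_branches_def by (intro CollectI exI[of _ L] conjI)
    then show "f \<in> twisted_pullback (\<lambda>x. 1 - x $ 1) c psi W z"
      unfolding twisted_pullback_def using u by (intro CollectI bexI[of _ "\<lambda>x. exp (c * L x)"] bexI[of _ u])
  qed
qed

lemma germ_eq_psi:
  assumes p: "p \<in> X3" and eq: "\<forall>\<^sub>F x in nhds p. u (psi x) = v (psi x)"
  shows "germ_eq (psi p) u v"
proof -
  have "\<forall>\<^sub>F y in nhds (psi p). u (psi (psi_inv y)) = v (psi (psi_inv y))"
    by (rule eventually_psi_inv[OF p eq])
  moreover have "\<forall>\<^sub>F y in nhds (psi p). y \<in> Y3"
    by (rule eventually_nhds_in_open[OF open_Y3 psi_in_Y3[OF p]])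
  ultimately show ?thesis
    unfolding germ_eq_def by eventually_elim (simp add: psi_psi_inv)
qed

lemma euler_cong:
  assumes U: "open U" "x \<in> U" and eq: "\<And>x. x \<in> U \<Longrightarrow> f x = g x"
  shows "euler I c f x = euler I c g x"
proof -
  have "pderiv_at i f x = pderiv_at i g x" for i
    by (rule pderiv_at_cong, rule eventually_mono[OF eventually_nhds_in_open[OF U]], rule eq)
  then show ?thesis by (simp add: euler_def eq[OF U(2)])
qed

lemma E36_cong:
  assumes U: "open U" "x \<in> U" and eq: "\<And>x. x \<in> U \<Longrightarrow> f x = g x"
  shows "E36_X3 a f x \<longleftrightarrow> E36_X3 a g x"
proof -
  have 1: "euler I c f z = euler I c g z" if "z \<in> U" for I c z
    by (rule euler_cong[OF U(1) that eq])
  have "euler J d (euler I c f) x = euler J d (euler I c g) x" for J d I c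
    by (rule euler_cong[OF U 1])
  then show ?thesis by (simp add: E36_X3_def)
qed

lemma pull_in_solutions:
  assumes p: "p \<in> X3"
    and L: "slicewise L B" "\<And>x. x \<in> B \<Longrightarrow> exp (L x) = 1 - x $ 1" and B: "p \<in> B" "B \<subseteq> X3"
    and u: "slicewise u N" and N: "psi p \<in> N" "N \<subseteq> Y3"
    and hs: "\<And>y i j. y \<in> N \<Longrightarrow> pderiv_at i (pderiv_at j u) y = hess A b (g y) (u y) (\<lambda>k. pderiv_at k u y) y i j"
    and a: "a $ 2 = b $ 3" "a $ 3 = A" "a $ 4 = b $ 1" "1 - a $ 6 = b $ 2" "1 - a $ 5 = b $ 1 + b $ 3"
    and f: "germ_eq p f (\<lambda>x. exp (- (b $ 3) * L x) * u (psi x))"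
  shows "f \<in> solutions_at (E36_X3 a) p"
proof -
  have oB: "open B" using L(1) by (rule slicewise_open)
  have "\<forall>\<^sub>F x in nhds p. psi x \<in> N"
    by (rule eventually_psi[OF p]) (rule eventually_nhds_in_open[OF slicewise_open[OF u] N(1)])
  moreover have "\<forall>\<^sub>F x in nhds p. x \<in> B" by (rule eventually_nhds_in_open[OF oB B(1)])
  ultimately have "\<forall>\<^sub>F x in nhds p. psi x \<in> N \<and> x \<in> B \<and> f x = exp (- (b $ 3) * L x) * u (psi x)"
    using f unfolding germ_eq_def by eventually_elim simp
  then obtain U where U: "open U" "p \<in> U"
    "\<And>x. x \<in> U \<Longrightarrow> psi x \<in> N \<and> x \<in> B \<and> f x = exp (- (b $ 3) * L x) * u (psi x)"
    unfolding eventually_nhds by auto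
  have UX: "U \<subseteq> X3" using U(3) B(2) by auto
  have LU: "slicewise L U" by (rule slicewise_subset[OF L(1) U(1)]) (use U(3) in auto)
  have eL: "exp (L x) = 1 - x $ 1" if "x \<in> U" for x using L(2) U(3)[OF that] by simp
  have sub: "psi x \<in> N" if "x \<in> U" for x using U(3)[OF that] by simp
  have "slicewise (\<lambda>x. exp (- (b $ 3) * L x) * u (psi x)) U"
    by (rule pull_pderiv(1)[OF U(1)]) (use UX X3_D(4) LU eL sub u N(2) in auto)
  then have "slicewise f U"
    by (rule slicewise_cong) (use U(3) in auto)
  moreover have "E36_X3 a f x" if x: "x \<in> U" for x
  proof -
    have "E36_X3 a (\<lambda>x. exp (- (b $ 3) * L x) * u (psi x)) x"
      by (rule E36_pull[OF UX LU eL u sub N(2) hs a x])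
    moreover have "E36_X3 a f x \<longleftrightarrow> E36_X3 a (\<lambda>x. exp (- (b $ 3) * L x) * u (psi x)) x"
      by (rule E36_cong[OF U(1) x]) (use U(3) in auto)
    ultimately show ?thesis by simp
  qed
  ultimately show ?thesis
    unfolding solutions_at_def holo_on_iff_slicewise using U(2) by blast
qed

lemma UNIV_6: "UNIV = {1, 2, 3, 4, 5, 6 :: 6}"
proof (rule UNIV_eq_I)
  show "x \<in> {1, 2, 3, 4, 5, 6}" for x :: 6
  proof (induct x)
    case (of_int z)
    then have "z = 0 \<or> z = 1 \<or> z = 2 \<or> z = 3 \<or> z = 4 \<or> z = 5" by fastforce
    then show ?case by auto
  qed
qed

lemma free_parameters:
  "bij_betw (\<lambda>a' :: complex ^ 6. (a' $ 3, a' $ 4, 1 - a' $ 6, a' $ 2))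
      {a'. (\<Sum>i\<in>UNIV. a' $ i) = 3 \<and> a' $ 2 + a' $ 4 + a' $ 5 = 1} UNIV"
proof -
  define inv :: "complex \<times> complex \<times> complex \<times> complex \<Rightarrow> complex ^ 6" where
    "inv = (\<lambda>(p, q, r, s). \<chi> i. if i = 2 then s else if i = 3 then p else if i = 4 then q
       else if i = 5 then 1 - s - q else if i = 6 then 1 - r else 1 - p + r)"
  have all_6: "(\<forall>i. P i) \<longleftrightarrow> P 1 \<and> P 2 \<and> P 3 \<and> P 4 \<and> P 5 \<and> P (6::6)" for P
  proof -
    have "(\<forall>i. P i) \<longleftrightarrow> (\<forall>i\<in>UNIV. P i)" by simp
    then show ?thesis unfolding UNIV_6 by simp
  qed
  have sum_6: "(\<Sum>i\<in>UNIV. f i) = f 1 + f 2 + f 3 + f 4 + f 5 + f (6::6)" for f :: "6 \<Rightarrow> complex"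
    unfolding UNIV_6 by (simp add: add_ac)
  show ?thesis
  proof (rule bij_betw_byWitness[where f'=inv])
    show "\<forall>a'\<in>{a'. (\<Sum>i\<in>UNIV. a' $ i) = 3 \<and> a' $ 2 + a' $ 4 + a' $ 5 = 1}. inv (a' $ 3, a' $ 4, 1 - a' $ 6, a' $ 2) = a'"
    proof
      fix a' :: "complex ^ 6"
      assume a': "a' \<in> {a'. (\<Sum>i\<in>UNIV. a' $ i) = 3 \<and> a' $ 2 + a' $ 4 + a' $ 5 = 1}"
      then have "a' $ 1 + a' $ 2 + a' $ 3 + a' $ 4 + a' $ 5 + a' $ 6 = 3" "a' $ 2 + a' $ 4 + a' $ 5 = 1"
        by (simp_all add: sum_6)
      note e = this
      have "a' $ 5 = (a' $ 2 + a' $ 4 + a' $ 5) - a' $ 2 - a' $ 4" by simp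
      then have 5: "a' $ 5 = 1 - a' $ 2 - a' $ 4" unfolding e .
      have "a' $ 1 = (a' $ 1 + a' $ 2 + a' $ 3 + a' $ 4 + a' $ 5 + a' $ 6) - (a' $ 2 + a' $ 4 + a' $ 5) - a' $ 3 - a' $ 6" by simp
      then have 1: "a' $ 1 = 2 - a' $ 3 - a' $ 6" unfolding e by simp
      show "inv (a' $ 3, a' $ 4, 1 - a' $ 6, a' $ 2) = a'"
        unfolding vec_eq_iff all_6 by (simp add: inv_def 1 5)
    qed
    show "\<forall>x\<in>UNIV. (inv x $ 3, inv x $ 4, 1 - inv x $ 6, inv x $ 2) = x"
      by (auto simp: inv_def)
    show "range inv \<subseteq> {a'. (\<Sum>i\<in>UNIV. a' $ i) = 3 \<and> a' $ 2 + a' $ 4 + a' $ 5 = 1}"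
      by (auto simp: inv_def sum_6)
  qed simp
qed

theorem propositionA1:
  fixes a :: "complex ^ 6"
  assumes "(\<Sum>i\<in>UNIV. a $ i) = 3"
    and "a $ 2 + a $ 4 + a $ 5 = 1"
  defines "S \<equiv> solutions_at (E36_X3 a)"
    and "SD \<equiv> solutions_at (ED (a $ 3) (vector [a $ 4, 1 - a $ 6, a $ 2]) (1 + a $ 3 - a $ 5))"
    and "h \<equiv> \<lambda>x :: complex ^ 3. 1 - x $ 1"
  shows "reducible_on X3 S \<and>
    subsystem_of X3 S (twisted_pullback h (- a $ 2) psi SD) \<and>
    isomorphic_via h (- a $ 2) psi X3 (twisted_pullback h (- a $ 2) psi SD) Y3 SD \<and>
    (\<forall>p\<in>X3. twisted_pullback h (- a $ 2) psi SD p \<subseteq> S p) \<and>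
    \<comment> \<open>four free parameters: the fifth one is determined by the others, which are arbitrary\<close>
    1 + a $ 3 - a $ 5 = a $ 3 + a $ 4 + a $ 2 \<and>
    bij_betw (\<lambda>a' :: complex ^ 6. (a' $ 3, a' $ 4, 1 - a' $ 6, a' $ 2))
      {a'. (\<Sum>i\<in>UNIV. a' $ i) = 3 \<and> a' $ 2 + a' $ 4 + a' $ 5 = 1} UNIV"
proof -
  define A where "A = a $ 3"
  define b :: "complex ^ 3" where "b = vector [a $ 4, 1 - a $ 6, a $ 2]"
  define V where "V = twisted_pullback h (- a $ 2) psi SD"
  have a5: "a $ 5 = 1 - a $ 2 - a $ 4" using assms(2) by (simp add: algebra_simps)
  have ab: "a $ 2 = b $ 3" "a $ 3 = A" "a $ 4 = b $ 1" "1 - a $ 6 = b $ 2" "1 - a $ 5 = b $ 1 + b $ 3"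
    by (simp_all add: b_def A_def a5)
  have C: "1 + a $ 3 - a $ 5 = A + b $ 1 + b $ 3" by (simp add: b_def A_def a5)
  have SD: "u \<in> SD q \<longleftrightarrow> (\<exists>e>0. ED_solution A b (ball q e) u)" if "q \<in> Y3" for q u
    unfolding SD_def b_def[symmetric] A_def[symmetric] using solutions_ED_iff[OF that C] by (simp add: A_def)
  have SDscale: "(\<lambda>y. s * u y) \<in> SD q" if "q \<in> Y3" "u \<in> SD q" for q u s
    using that(2) ED_solution_scale[of A b _ u s] unfolding SD[OF that(1)] by auto
  have c: "- a $ 2 = - (b $ 3)" by (simp add: ab)
  have V_iff: "f \<in> V z \<longleftrightarrow> (\<exists>u\<in>SD (psi z). germ_eq z f (\<lambda>x. exp (- (b $ 3) * L x) * u (psi x)))"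
    if "slicewise L B" "\<forall>x\<in>B. exp (L x) = 1 - x $ 1" "z \<in> B" "B \<subseteq> X3" for f z L B
    unfolding V_def h_def c
    by (rule twisted_pullback_iff[OF that(1-3)]) (use that SDscale psi_in_Y3 in auto)
  have VS: "V p \<subseteq> S p" if p: "p \<in> X3" for p
  proof
    fix f assume f: "f \<in> V p"
    obtain r L where r: "r > 0" "ball p r \<subseteq> X3" and L: "slicewise L (ball p r)" "\<forall>x\<in>ball p r. exp (L x) = 1 - x $ 1"
      using log_branch[OF p] by blast
    have pb: "p \<in> ball p r" using r by simp
    obtain u where u: "u \<in> SD (psi p)" "germ_eq p f (\<lambda>x. exp (- (b $ 3) * L x) * u (psi x))"
      using f V_iff[OF L pb r(2)] by auto
    then obtain e where e: "e > 0" "ED_solution A b (ball (psi p) e) u"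
      unfolding SD[OF psi_in_Y3[OF p]] by auto
    show "f \<in> S p"
      unfolding S_def
    proof (rule pull_in_solutions[OF p L(1) L(2)[rule_format] pb r(2) _ _ _ _ ab u(2)])
      show "slicewise u (ball (psi p) e)" "psi p \<in> ball (psi p) e" "ball (psi p) e \<subseteq> Y3"
        using e by (auto simp: ED_solution_def)
      show "pderiv_at i (pderiv_at j u) y = hess A b 0 (u y) (\<lambda>k. pderiv_at k u y) y i j" if "y \<in> ball (psi p) e" for y i j
        using e that by (simp add: ED_solution_def)
    qed
  qed
  have V_sub: "germ_subspace p (V p)" if p: "p \<in> X3" for p
  proof -
    obtain r L where r: "r > 0" "ball p r \<subseteq> X3" and L: "slicewise L (ball p r)" "\<forall>x\<in>ball p r. exp (L x) = 1 - x $ 1"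
      using log_branch[OF p] by blast
    have pb: "p \<in> ball p r" using r by simp
    note V = V_iff[OF L pb r(2)]
    have Y: "psi p \<in> Y3" by (rule psi_in_Y3[OF p])
    have zero: "(\<lambda>y. 0) \<in> SD (psi p)"
    proof -
      obtain e u where "e > 0" "ED_solution A b (ball (psi p) e) u"
        using ED_solution_exists[OF Y, of A b] by auto
      then show ?thesis unfolding SD[OF Y] using ED_solution_scale[of A b _ u 0] by auto
    qed
    have add: "(\<lambda>y. u y + v y) \<in> SD (psi p)" if uv: "u \<in> SD (psi p)" "v \<in> SD (psi p)" for u v
    proof -
      obtain e1 e2 where e: "e1 > 0" "e2 > 0" "ED_solution A b (ball (psi p) e1) u" "ED_solution A b (ball (psi p) e2) v"
        using uv unfolding SD[OF Y] by auto
      have "ED_solution A b (ball (psi p) (min e1 e2)) (\<lambda>y. u y + v y)"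
        by (intro ED_solution_add ED_solution_subset[OF e(3)] ED_solution_subset[OF e(4)]) auto
      then show ?thesis unfolding SD[OF Y] using e(1,2) by (intro exI[of _ "min e1 e2"]) simp
    qed
    show ?thesis
      unfolding germ_subspace_def
    proof (intro conjI ballI allI impI)
      show "(\<lambda>x. 0) \<in> V p"
        unfolding V using zero by (intro bexI[of _ "\<lambda>y. 0"]) (simp_all add: germ_eq_refl)
      show "(\<lambda>x. f x + g x) \<in> V p" if fg: "f \<in> V p" "g \<in> V p" for f g
      proof -
        obtain u v where uv: "u \<in> SD (psi p)" "v \<in> SD (psi p)" "germ_eq p f (\<lambda>x. exp (- (b $ 3) * L x) * u (psi x))"
          "germ_eq p g (\<lambda>x. exp (- (b $ 3) * L x) * v (psi x))"
          using fg unfolding V by auto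
        have "germ_eq p (\<lambda>x. f x + g x) (\<lambda>x. exp (- (b $ 3) * L x) * (u (psi x) + v (psi x)))"
          using uv(3,4) unfolding germ_eq_def by eventually_elim (simp add: distrib_left)
        then show ?thesis unfolding V using add[OF uv(1,2)] by (intro bexI[of _ "\<lambda>y. u y + v y"])
      qed
      show "(\<lambda>x. s * f x) \<in> V p" if f: "f \<in> V p" for s f
      proof -
        obtain u where u: "u \<in> SD (psi p)" "germ_eq p f (\<lambda>x. exp (- (b $ 3) * L x) * u (psi x))"
          using f unfolding V by auto
        have "germ_eq p (\<lambda>x. s * f x) (\<lambda>x. exp (- (b $ 3) * L x) * (s * u (psi x)))"
          using u(2) unfolding germ_eq_def by eventually_elim simp
        then show ?thesis unfolding V using SDscale[OF Y u(1), of s] by (intro bexI[of _ "\<lambda>y. s * u y"])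
      qed
      show "g \<in> V p" if "f \<in> V p" "germ_eq p f g" for f g
        using that germ_eq_trans germ_eq_sym unfolding V by meson
    qed
  qed
  have V_ext: "\<exists>e>0. \<forall>q\<in>ball p e. \<forall>f\<in>V q. \<exists>G. germ_eq q f G \<and> (\<forall>z\<in>ball p e. holo_at G z \<and> G \<in> V z)"
    if p: "p \<in> X3" for p
  proof -
    obtain r L where r: "r > 0" "ball p r \<subseteq> X3" and L: "slicewise L (ball p r)" "\<forall>x\<in>ball p r. exp (L x) = 1 - x $ 1"
      using log_branch[OF p] by blast
    have Y: "psi p \<in> Y3" by (rule psi_in_Y3[OF p])
    obtain R where R: "R > 0" "ball (psi p) R \<subseteq> Y3"
      "\<And>q u e. q \<in> ball (psi p) R \<Longrightarrow> e > 0 \<Longrightarrow> ED_solution A b (ball q e) u \<Longrightarrow>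
         \<exists>v. ED_solution A b (ball (psi p) R) v \<and> germ_eq q u v"
      using ED_solution_extends[OF Y, of A b] by auto
    have "\<forall>\<^sub>F x in nhds p. psi x \<in> ball (psi p) R"
      by (rule eventually_psi[OF p]) (rule eventually_nhds_in_open, use R in auto)
    then obtain d where d: "d > 0" "\<And>x. dist x p < d \<Longrightarrow> psi x \<in> ball (psi p) R"
      unfolding eventually_nhds_metric by auto
    define e where "e = min r d"
    have e: "e > 0" "ball p e \<subseteq> ball p r" "\<And>x. x \<in> ball p e \<Longrightarrow> psi x \<in> ball (psi p) R"
      using r d by (auto simp: e_def dist_commute)
    have "\<exists>G. germ_eq q f G \<and> (\<forall>z\<in>ball p e. holo_at G z \<and> G \<in> V z)" if q: "q \<in> ball p e" and f: "f \<in> V q" for q f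
    proof -
      have qr: "q \<in> ball p r" "q \<in> X3" using q e r by auto
      obtain u where u: "u \<in> SD (psi q)" "germ_eq q f (\<lambda>x. exp (- (b $ 3) * L x) * u (psi x))"
        using f V_iff[OF L qr(1) r(2)] by auto
      obtain \<epsilon> where "\<epsilon> > 0" "ED_solution A b (ball (psi q) \<epsilon>) u"
        using u(1) unfolding SD[OF psi_in_Y3[OF qr(2)]] by auto
      from R(3)[OF e(3)[OF q] this] obtain v where v: "ED_solution A b (ball (psi p) R) v" "germ_eq (psi q) u v" by auto
      define G where "G = (\<lambda>x. exp (- (b $ 3) * L x) * v (psi x))"
      have "\<forall>\<^sub>F x in nhds q. u (psi x) = v (psi x)"
        using v(2) unfolding germ_eq_def by (rule eventually_psi[OF qr(2)])
      then have "germ_eq q f G"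
        using u(2) unfolding germ_eq_def G_def by eventually_elim simp
      moreover have "holo_at G z" "G \<in> V z" if z: "z \<in> ball p e" for z
      proof -
        have zr: "z \<in> ball p r" "z \<in> X3" using z e r by auto
        have "slicewise G (ball p e)"
          unfolding G_def
        proof (rule pull_pderiv(1)[OF open_ball])
          show "slicewise L (ball p e)" by (rule slicewise_subset[OF L(1) open_ball e(2)])
          show "slicewise v (ball (psi p) R)" "ball (psi p) R \<subseteq> Y3" using v by (simp_all add: ED_solution_def)
          show "x $ 1 \<noteq> 1" if "x \<in> ball p e" for x using that e r X3_D(4) by blast
          show "exp (L x) = 1 - x $ 1" if "x \<in> ball p e" for x using that e L(2) by blast
        qed (rule e(3))
        then show "holo_at G z" unfolding holo_at_def holo_on_iff_slicewise using z by blast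
        obtain \<delta> where "\<delta> > 0" "ball (psi z) \<delta> \<subseteq> ball (psi p) R"
          using openE[OF open_ball e(3)[OF z]] by blast
        then have "v \<in> SD (psi z)"
          unfolding SD[OF psi_in_Y3[OF zr(2)]] using ED_solution_subset[OF v(1) open_ball] by auto
        then show "G \<in> V z"
          unfolding V_iff[OF L zr(1) r(2)] G_def using germ_eq_refl by blast
      qed
      ultimately show ?thesis by blast
    qed
    then show ?thesis using e(1) by blast
  qed
  have sub: "subsystem_of X3 S V"
    unfolding subsystem_of_def
  proof (intro conjI ballI allI impI)
    fix \<gamma> f assume "path \<gamma> \<and> path_image \<gamma> \<subseteq> X3" "f \<in> V (pathstart \<gamma>)"
    then show "\<exists>g\<in>V (pathfinish \<gamma>). continuation_along \<gamma> f g"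
      by (intro continuation_along_paths[of \<gamma> X3 V f] V_ext) auto
  qed (use VS V_sub in auto)
  have nonzero: "\<exists>f\<in>V p. \<not> germ_eq p f (\<lambda>x. 0)" if p: "p \<in> X3" for p
  proof -
    obtain r L where r: "r > 0" "ball p r \<subseteq> X3" and L: "slicewise L (ball p r)" "\<forall>x\<in>ball p r. exp (L x) = 1 - x $ 1"
      using log_branch[OF p] by blast
    have pb: "p \<in> ball p r" using r by simp
    obtain e u where e: "e > 0" "ED_solution A b (ball (psi p) e) u" "u (psi p) = 1"
      using ED_solution_exists[OF psi_in_Y3[OF p], of A b] by auto
    define f where "f = (\<lambda>x. exp (- (b $ 3) * L x) * u (psi x))"
    have "u \<in> SD (psi p)" unfolding SD[OF psi_in_Y3[OF p]] using e by auto
    then have "f \<in> V p" unfolding V_iff[OF L pb r(2)] f_def using germ_eq_refl by blast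
    moreover have "\<not> germ_eq p f (\<lambda>x. 0)"
    proof
      assume "germ_eq p f (\<lambda>x. 0)"
      then have "f p = 0" unfolding germ_eq_def by (rule eventually_nhds_x_imp_x)
      then show False by (simp add: f_def e)
    qed
    ultimately show ?thesis by blast
  qed
  have proper: "V p \<noteq> S p" if p: "p \<in> X3" for p
  proof
    assume VeqS: "V p = S p"
    obtain r L where r: "r > 0" "ball p r \<subseteq> X3" and L: "slicewise L (ball p r)" "\<forall>x\<in>ball p r. exp (L x) = 1 - x $ 1"
      using log_branch[OF p] by blast
    have pb: "p \<in> ball p r" using r by simp
    have Y: "psi p \<in> Y3" by (rule psi_in_Y3[OF p])
    obtain R u g where R: "R > 0" "ball (psi p) R \<subseteq> Y3" and u: "slicewise u (ball (psi p) R)" "g (psi p) \<noteq> 0"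
      "\<And>y i j. y \<in> ball (psi p) R \<Longrightarrow> pderiv_at i (pderiv_at j u) y = hess A b (g y) (u y) (\<lambda>k. pderiv_at k u y) y i j"
      using extra_solution_exists[OF Y, of A b] by auto
    have yR: "psi p \<in> ball (psi p) R" using R by simp
    define f where "f = (\<lambda>x. exp (- (b $ 3) * L x) * u (psi x))"
    have "f \<in> S p"
      unfolding S_def by (rule pull_in_solutions[OF p L(1) L(2)[rule_format] pb r(2) u(1) yR R(2) u(3) ab]) (simp_all add: f_def germ_eq_refl)
    then have "f \<in> V p" using VeqS by simp
    then obtain v where v: "v \<in> SD (psi p)" "germ_eq p f (\<lambda>x. exp (- (b $ 3) * L x) * v (psi x))"
      unfolding V_iff[OF L pb r(2)] by auto
    have "\<forall>\<^sub>F x in nhds p. u (psi x) = v (psi x)"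
      using v(2) unfolding germ_eq_def f_def by eventually_elim simp
    then have uv: "\<forall>\<^sub>F y in nhds (psi p). u y = v y"
      using germ_eq_psi[OF p] by (simp add: germ_eq_def)
    obtain e where e: "e > 0" "ED_solution A b (ball (psi p) e) v"
      using v(1) unfolding SD[OF Y] by auto
    have p1: "pderiv_at k u (psi p) = pderiv_at k v (psi p)" for k by (rule pderiv_at_cong[OF uv])
    have p2: "pderiv_at i (pderiv_at j u) (psi p) = pderiv_at i (pderiv_at j v) (psi p)" for i j
    proof (rule pderiv_at_cong)
      have "\<forall>\<^sub>F y in nhds (psi p). \<forall>\<^sub>F y in nhds y. u y = v y" using uv by (simp add: eventually_eventually)
      then show "\<forall>\<^sub>F y in nhds (psi p). pderiv_at j u y = pderiv_at j v y"
        by eventually_elim (rule pderiv_at_cong)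
    qed
    have u0: "u (psi p) = v (psi p)" using uv by (rule eventually_nhds_x_imp_x)
    \<comment> \<open>the mixed derivative in the directions 2 and 3 detects \<open>g\<close>, as the obstruction is nonzero there\<close>
    have "hess A b (g (psi p)) (u (psi p)) (\<lambda>k. pderiv_at k u (psi p)) (psi p) 2 3 =
        hess A b 0 (u (psi p)) (\<lambda>k. pderiv_at k u (psi p)) (psi p) 2 3"
      using u(3)[OF yR, of 2 3] e p2[of 2 3] unfolding ED_solution_def p1 u0 by auto
    then have "obstruction 2 3 (psi p) * g (psi p) = obstruction 2 3 (psi p) * 0"
      using hess_off_eq[OF Y, of 2 3 A b "g (psi p)" "u (psi p)" "\<lambda>k. pderiv_at k u (psi p)"]
        hess_off_eq[OF Y, of 2 3 A b 0 "u (psi p)" "\<lambda>k. pderiv_at k u (psi p)"] by simp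
    then show False using u(2) Y3_D(4)[OF Y] by (simp add: obstruction_def)
  qed
  have red: "reducible_on X3 S"
    unfolding reducible_on_def using sub nonzero proper by blast
  have iso: "isomorphic_via h (- a $ 2) psi X3 V Y3 SD"
    unfolding isomorphic_via_def
  proof (intro conjI ballI impI biholomorphic_psi)
    show "holo_on h X3"
      unfolding holo_on_iff_slicewise h_def by (intro slicewise_diff slicewise_const slicewise_coord open_X3)
    show "h p \<noteq> 0" if "p \<in> X3" for p using X3_D(4)[OF that] by (simp add: h_def)
    fix p \<phi> assume p: "p \<in> X3" and \<phi>: "\<phi> \<in> power_branches h (- a $ 2) p"
    obtain r L where r: "r > 0" "ball p r \<subseteq> X3" and L: "slicewise L (ball p r)" "\<forall>x\<in>ball p r. exp (L x) = 1 - x $ 1"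
      using log_branch[OF p] by blast
    have pb: "p \<in> ball p r" using r by simp
    have Y: "psi p \<in> Y3" by (rule psi_in_Y3[OF p])
    obtain s where s: "s \<noteq> 0" "\<forall>\<^sub>F x in nhds p. \<phi> x = s * exp (- (b $ 3) * L x)"
      using power_branch_eq[OF L pb \<phi>[unfolded h_def c]] by auto
    show "(\<lambda>x. \<phi> x * u (psi x)) \<in> V p" if "u \<in> SD (psi p)" for u
      unfolding V_def twisted_pullback_def using that \<phi> germ_eq_refl by blast
    show "germ_eq (psi p) u v"
      if "u \<in> SD (psi p)" "v \<in> SD (psi p)"
        and "germ_eq p (\<lambda>x. \<phi> x * u (psi x)) (\<lambda>x. \<phi> x * v (psi x))" for u v
    proof (rule germ_eq_psi[OF p])
      show "\<forall>\<^sub>F x in nhds p. u (psi x) = v (psi x)"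
        using that(3) s(2) unfolding germ_eq_def by eventually_elim (use s(1) in simp)
    qed
    show "\<exists>u\<in>SD (psi p). germ_eq p f (\<lambda>x. \<phi> x * u (psi x))" if f: "f \<in> V p" for f
    proof -
      obtain u where u: "u \<in> SD (psi p)" "germ_eq p f (\<lambda>x. exp (- (b $ 3) * L x) * u (psi x))"
        using f V_iff[OF L pb r(2)] by auto
      have "germ_eq p f (\<lambda>x. \<phi> x * ((1 / s) * u (psi x)))"
        using u(2) s(2) unfolding germ_eq_def by eventually_elim (use s(1) in simp)
      then show ?thesis using SDscale[OF Y u(1), of "1 / s"] by (intro bexI[of _ "\<lambda>y. (1 / s) * u y"])
    qed
  qed
  have bij: "bij_betw (\<lambda>a' :: complex ^ 6. (a' $ 3, a' $ 4, 1 - a' $ 6, a' $ 2))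
      {a'. (\<Sum>i\<in>UNIV. a' $ i) = 3 \<and> a' $ 2 + a' $ 4 + a' $ 5 = 1} UNIV"
    by (rule free_parameters)
  show ?thesis
    using red sub iso VS C bij unfolding V_def by (auto simp: A_def b_def)
qed

end
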